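(* Assume $\mu_0=\nu$ (stationary chain), $\sigma^2>0$, and that hypothesis $(\mathcal H)$ holds. Then $S_n/\sqrt n$ converges in law to $\mathcal N(0,\sigma^2)$, and for every $\tau<1$, $$\sup_{x\in\mathbb R}\Big|\mathbb P\Big(\frac{S_n}{\sigma\sqrt n}\le x\Big)-\mathcal N(0,1)(]-\infty,x])\Big| = O(n^{-\tau/2}).$$
   Context: Let $(E,\mathcal E)$ be a measurable space, $Q$ a transition probability on $E$ admitting an invariant probability $\nu$, $(X_n)_{n\ge0}$ a Markov chain with transition $Q$ and initial law $\mu_0$, and $\xi:E\to\mathbb R$ a measurable $\nu$-integrable function with $\nu(\xi)=0$; put $S_n=\sum_{k=1}^n\xi(X_k)$. $\mathbf 1$ is the constant function $1$ on $E$. For $t\in\mathbb R$, $Q(t)$ is the Fourier kernel $Q(t)f(x)=\int e^{it\xi(y)}f(y)\,Q(x,dy)$. For a Banach space $(\mathcal B,\|\cdot\|)$ of measurable complex functions on $E$, $Q$ is called $\mathcal B$-geometrically ergodic if $\mathbf 1\in\mathcal B$, $\mathcal B$ embeds continuously in $L^1(\nu)$, $Q$ is a bounded operator on $\mathcal B$, and there are $\kappa_0<1$, $C\ge0$ with $\|Q^nf-\nu(f)\mathbf 1\|\le C\kappa_0^n\|f\|$ for all $n\ge1$, $f\in\mathcal B$. If so and $\xi\in\mathcal B$, set $\check\xi=\sum_{n\ge0}Q^n\xi$ (absolutely convergent in $\mathcal B$), and if moreover $\mathcal B\subset L^2(\nu)$, set $\sigma^2=\nu(\check\xi^2)-\nu((Q\check\xi)^2)$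 and $\psi=Q(\check\xi^2)-(Q\check\xi)^2-\sigma^2\mathbf 1$. Hypothesis $(\mathcal H)$: there is a Banach space $(\mathcal B,\|\cdot\|)$ of measurable complex functions with $\mathcal B\subset L^3(\nu)$, $\xi\in\mathcal B$, such that: (H1) $Q$ is $\mathcal B$-geometrically ergodic; (H2) $\sum_{p\ge0}\nu(|Q^p\psi|^{3/2})^{2/3}<\infty$; (H3) $\sup\{\nu(|e^{it\xi}-1|\,|f|): f\in\mathcal B,\|f\|\le1\}=O(|t|)$ as $t\to0$; (H4) there is an open interval $I\ni0$ such that for $t\in I$, $Q(t)$ is a bounded operator on $\mathcal B$, there are constants $\kappa<1$, $C\ge0$ with $\|Q(t)^nf\|\le C\kappa^n\|f\|+C\nu(|f|)$ for all $n\ge1$, $t\in I$, $f\in\mathcal B$, and the essential spectral radius of $Q(t)$ acting on $\mathcal B$ is $\le\kappa$ for all $t\in I$. *)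

theory Defs
  imports "HOL-Probability.Probability"
begin

definition Qop :: "('a \<Rightarrow> 'a measure) \<Rightarrow> ('a \<Rightarrow> complex) \<Rightarrow> ('a \<Rightarrow> complex)" where
  "Qop Q f = (\<lambda>x. \<integral>y. f y \<partial>(Q x))"

definition Qfourier :: "('a \<Rightarrow> 'a measure) \<Rightarrow> ('a \<Rightarrow> real) \<Rightarrow> real \<Rightarrow> ('a \<Rightarrow> complex) \<Rightarrow> ('a \<Rightarrow> complex)" where
  "Qfourier Q \<xi> t f = (\<lambda>x. \<integral>y. exp (\<i> * complex_of_real (t * \<xi> y)) * f y \<partial>(Q x))"

definition markov_chain :: "'w measure \<Rightarrow> 'a measure \<Rightarrow> ('a \<Rightarrow> 'a measure) \<Rightarrow> 'a measure \<Rightarrow> (nat \<Rightarrow> 'w \<Rightarrow> 'a) \<Rightarrow> bool" where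
  "markov_chain M E Q \<mu>0 X \<longleftrightarrow>
     prob_space M \<and> (\<forall>n. X n \<in> measurable M E) \<and> distr M E (X 0) = \<mu>0 \<and>
     (\<forall>n (A :: nat \<Rightarrow> 'a set) B. (\<forall>i\<le>n. A i \<in> sets E) \<longrightarrow> B \<in> sets E \<longrightarrow>
        measure M {\<omega>\<in>space M. (\<forall>i\<le>n. X i \<omega> \<in> A i) \<and> X (Suc n) \<omega> \<in> B}
        = (\<integral>\<omega>. indicator {\<omega>\<in>space M. \<forall>i\<le>n. X i \<omega> \<in> A i} \<omega> * measure (Q (X n \<omega>)) B \<partial>M))"

definition banach_fun_space :: "'a measure \<Rightarrow> ('a \<Rightarrow> complex) set \<Rightarrow> (('a \<Rightarrow> complex) \<Rightarrow> real) \<Rightarrow> bool" where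
  "banach_fun_space E B N \<longleftrightarrow>
     (\<forall>f\<in>B. f \<in> borel_measurable E) \<and>
     (\<lambda>x. 0) \<in> B \<and> (\<forall>f\<in>B. \<forall>g\<in>B. (\<lambda>x. f x + g x) \<in> B) \<and> (\<forall>c. \<forall>f\<in>B. (\<lambda>x. c * f x) \<in> B) \<and>
     (\<forall>f\<in>B. N f \<ge> 0 \<and> (N f = 0 \<longleftrightarrow> f = (\<lambda>x. 0))) \<and>
     (\<forall>f\<in>B. \<forall>g\<in>B. N (\<lambda>x. f x + g x) \<le> N f + N g) \<and>
     (\<forall>c. \<forall>f\<in>B. N (\<lambda>x. c * f x) = norm c * N f) \<and>
     (\<forall>u. (\<forall>n. u n \<in> B) \<longrightarrow> (\<forall>e>0. \<exists>K. \<forall>m\<ge>K. \<forall>n\<ge>K. N (\<lambda>x. u m x - u n x) < e) \<longrightarrow>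
          (\<exists>g\<in>B. (\<lambda>n. N (\<lambda>x. u n x - g x)) \<longlonglongrightarrow> 0))"

text \<open>Bounded (linear) operators, compact operators, operator norm, essential norm,
  essential spectral radius (spectral radius in the Calkin algebra, via Gelfand's formula).\<close>

definition bounded_op :: "('a \<Rightarrow> complex) set \<Rightarrow> (('a \<Rightarrow> complex) \<Rightarrow> real) \<Rightarrow> (('a \<Rightarrow> complex) \<Rightarrow> ('a \<Rightarrow> complex)) \<Rightarrow> bool" where
  "bounded_op B N T \<longleftrightarrow>
     (\<forall>f\<in>B. T f \<in> B) \<and>
     (\<forall>f\<in>B. \<forall>g\<in>B. T (\<lambda>x. f x + g x) = (\<lambda>x. T f x + T g x)) \<and>
     (\<forall>c. \<forall>f\<in>B. T (\<lambda>x. c * f x) = (\<lambda>x. c * T f x)) \<and>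
     (\<exists>C. \<forall>f\<in>B. N (T f) \<le> C * N f)"

definition compact_op :: "('a \<Rightarrow> complex) set \<Rightarrow> (('a \<Rightarrow> complex) \<Rightarrow> real) \<Rightarrow> (('a \<Rightarrow> complex) \<Rightarrow> ('a \<Rightarrow> complex)) \<Rightarrow> bool" where
  "compact_op B N K \<longleftrightarrow> bounded_op B N K \<and>
     (\<forall>u. (\<forall>n. u n \<in> B \<and> N (u n) \<le> 1) \<longrightarrow>
        (\<exists>(r :: nat \<Rightarrow> nat) g. strict_mono r \<and> g \<in> B \<and> (\<lambda>n. N (\<lambda>x. K (u (r n)) x - g x)) \<longlonglongrightarrow> 0))"

definition op_norm :: "('a \<Rightarrow> complex) set \<Rightarrow> (('a \<Rightarrow> complex) \<Rightarrow> real) \<Rightarrow> (('a \<Rightarrow> complex) \<Rightarrow> ('a \<Rightarrow> complex)) \<Rightarrow> real" where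
  "op_norm B N T = Sup {N (T f) | f. f \<in> B \<and> N f \<le> 1}"

definition ess_norm :: "('a \<Rightarrow> complex) set \<Rightarrow> (('a \<Rightarrow> complex) \<Rightarrow> real) \<Rightarrow> (('a \<Rightarrow> complex) \<Rightarrow> ('a \<Rightarrow> complex)) \<Rightarrow> real" where
  "ess_norm B N T = Inf {op_norm B N (\<lambda>f x. T f x - K f x) | K. compact_op B N K}"

definition ess_spectral_radius :: "('a \<Rightarrow> complex) set \<Rightarrow> (('a \<Rightarrow> complex) \<Rightarrow> real) \<Rightarrow> (('a \<Rightarrow> complex) \<Rightarrow> ('a \<Rightarrow> complex)) \<Rightarrow> real" where
  "ess_spectral_radius B N T = Inf {ess_norm B N (T ^^ n) powr (1 / real n) | n. n \<ge> 1}"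

definition geom_ergodic :: "'a measure \<Rightarrow> ('a \<Rightarrow> 'a measure) \<Rightarrow> 'a measure \<Rightarrow> ('a \<Rightarrow> complex) set \<Rightarrow> (('a \<Rightarrow> complex) \<Rightarrow> real) \<Rightarrow> bool" where
  "geom_ergodic E Q \<nu> B N \<longleftrightarrow>
     (\<lambda>x. 1) \<in> B \<and>
     (\<forall>f\<in>B. integrable \<nu> f) \<and> (\<exists>C. \<forall>f\<in>B. (\<integral>x. norm (f x) \<partial>\<nu>) \<le> C * N f) \<and>
     bounded_op B N (Qop Q) \<and>
     (\<exists>\<kappa>0 C. \<kappa>0 < 1 \<and> C \<ge> 0 \<and>
        (\<forall>n\<ge>1. \<forall>f\<in>B. N (\<lambda>x. (Qop Q ^^ n) f x - (\<integral>y. f y \<partial>\<nu>)) \<le> C * \<kappa>0 ^ n * N f))"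

definition xi_check :: "('a \<Rightarrow> 'a measure) \<Rightarrow> ('a \<Rightarrow> complex) set \<Rightarrow> (('a \<Rightarrow> complex) \<Rightarrow> real) \<Rightarrow> ('a \<Rightarrow> real) \<Rightarrow> ('a \<Rightarrow> complex)" where
  "xi_check Q B N \<xi> = (THE g. g \<in> B \<and>
     (\<lambda>n. N (\<lambda>x. (\<Sum>k<n. (Qop Q ^^ k) (\<lambda>y. complex_of_real (\<xi> y)) x) - g x)) \<longlonglongrightarrow> 0)"

definition sigma2 :: "('a \<Rightarrow> 'a measure) \<Rightarrow> 'a measure \<Rightarrow> ('a \<Rightarrow> complex) set \<Rightarrow> (('a \<Rightarrow> complex) \<Rightarrow> real) \<Rightarrow> ('a \<Rightarrow> real) \<Rightarrow> complex" where
  "sigma2 Q \<nu> B N \<xi> = (\<integral>x. (xi_check Q B N \<xi> x)\<^sup>2 \<partial>\<nu>) - (\<integral>x. (Qop Q (xi_check Q B N \<xi>) x)\<^sup>2 \<partial>\<nu>)"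

definition psi_fun :: "('a \<Rightarrow> 'a measure) \<Rightarrow> 'a measure \<Rightarrow> ('a \<Rightarrow> complex) set \<Rightarrow> (('a \<Rightarrow> complex) \<Rightarrow> real) \<Rightarrow> ('a \<Rightarrow> real) \<Rightarrow> ('a \<Rightarrow> complex)" where
  "psi_fun Q \<nu> B N \<xi> = (\<lambda>x. Qop Q (\<lambda>y. (xi_check Q B N \<xi> y)\<^sup>2) x - (Qop Q (xi_check Q B N \<xi>) x)\<^sup>2
       - sigma2 Q \<nu> B N \<xi>)"

definition hyp_H :: "'a measure \<Rightarrow> ('a \<Rightarrow> 'a measure) \<Rightarrow> 'a measure \<Rightarrow> ('a \<Rightarrow> real) \<Rightarrow> ('a \<Rightarrow> complex) set \<Rightarrow> (('a \<Rightarrow> complex) \<Rightarrow> real) \<Rightarrow> bool" where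
  "hyp_H E Q \<nu> \<xi> B N \<longleftrightarrow>
     banach_fun_space E B N \<and>
     (\<forall>f\<in>B. integrable \<nu> (\<lambda>x. norm (f x) ^ 3)) \<and>
     (\<lambda>x. complex_of_real (\<xi> x)) \<in> B \<and>
     \<comment> \<open>(H1)\<close>
     geom_ergodic E Q \<nu> B N \<and>
     \<comment> \<open>(H2)\<close>
     summable (\<lambda>p. (\<integral>x. norm ((Qop Q ^^ p) (psi_fun Q \<nu> B N \<xi>) x) powr (3/2) \<partial>\<nu>) powr (2/3)) \<and>
     \<comment> \<open>(H3)\<close>
     (\<exists>C \<delta>. \<delta> > 0 \<and> (\<forall>t. \<bar>t\<bar> < \<delta> \<longrightarrow> (\<forall>f\<in>B. N f \<le> 1 \<longrightarrow>
         (\<integral>x. norm (exp (\<i> * complex_of_real (t * \<xi> x)) - 1) * norm (f x) \<partial>\<nu>) \<le> C * \<bar>t\<bar>))) \<and>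
     \<comment> \<open>(H4)\<close>
     (\<exists>a b. a < 0 \<and> 0 < b \<and>
        (\<forall>t\<in>{a<..<b}. bounded_op B N (Qfourier Q \<xi> t)) \<and>
        (\<exists>\<kappa> C. \<kappa> < 1 \<and> C \<ge> 0 \<and>
           (\<forall>n\<ge>1. \<forall>t\<in>{a<..<b}. \<forall>f\<in>B.
              N ((Qfourier Q \<xi> t ^^ n) f) \<le> C * \<kappa> ^ n * N f + C * (\<integral>x. norm (f x) \<partial>\<nu>)) \<and>
           (\<forall>t\<in>{a<..<b}. ess_spectral_radius B N (Qfourier Q \<xi> t) \<le> \<kappa>)))"

end

theory Submission
  imports Defs
begin

text \<open>
  Write \<open>T\<close> for the Fourier kernel at \<open>t\<close> and \<open>\<phi> n = \<nu> (T\<^sup>n 1)\<close> for the characteristic function of \<open>S\<^sub>n\<close>.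
  No spectral theory is used.  By (H1), (H3) and the inequality in (H4), some fixed power of \<open>T\<close> contracts the
  kernel of \<open>\<nu>\<close> uniformly for small \<open>t\<close>, so the normalised iterates \<open>T\<^sup>n 1 / \<phi> n\<close> converge geometrically, and by (H3)
  the quotients \<open>\<phi> (n + 1) / \<phi> n\<close> converge to some \<open>l\<close> with error \<open>O(\<bar>t\<bar> \<rho>\<^sup>n)\<close>.  Hence \<open>\<phi> n = l\<^sup>n (1 + O(t))\<close>.
  On the other hand, Gordin's martingale decomposition and (H2) give \<open>\<phi> n = exp (- n \<sigma>\<^sup>2 t\<^sup>2 / 2) + O(t)\<close>
  as long as \<open>n t\<^sup>2 \<le> 1\<close>.  Comparing the two yields \<open>l = exp (- \<sigma>\<^sup>2 t\<^sup>2 / 2) + O(t\<^sup>3)\<close>,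
  and Esseen's inequality concludes, even with the exponent \<open>\<tau> = 1\<close>.
\<close>

section \<open>Kernels and the Markov property\<close>

text \<open>The obstacle is that \<open>T\<close> is not assumed continuous in \<open>t\<close> for
  the norm of \<open>B\<close>: (H3) makes it \<open>O(t)\<close>-close to \<open>Q\<close> only as
  a map from \<open>B\<close> to \<open>L^1\<close>. The two estimates have complementary defects.
  The operator side gives an exact power \<open>l^n\<close> up to a relative error
  \<open>O(t)\<close>, uniformly in \<open>n\<close>, but hardly locates \<open>l\<close>. The
  martingale side knows the Gaussian limit but loses \<open>O(t^3)\<close> at each step, so it is
  sharp only for \<open>n\<close> up to about \<open>1/t^2\<close>. At that time the total
  discrepancy is still \<open>O(t)\<close>; spread over the steps, it leaves \<open>O(t^3)\<close>
  for \<open>l\<close> itself. Powers of \<open>l\<close> are then controlled for all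
  \<open>n\<close>, with a factor \<open>exp (- n \<sigma>^2 t^2 / 4)\<close> that makes the
  integral in Esseen's inequality of order \<open>n^(-1/2)\<close>. The cubic loss per step rests on
  (H2). Conditional variances of the martingale increments fluctuate by \<open>\<psi>\<close>, and
  the correlation of this fluctuation with the past is pushed back in time, at a summable cost, to
  time 0, where it vanishes by stationarity.\<close>

lemma
  fixes f :: "'b \<Rightarrow> 'c::{banach, second_countable_topology}"
  assumes K: "K \<in> measurable N (subprob_algebra L)" and ne: "space N \<noteq> {}"
    and f: "integrable (N \<bind> K) f"
  shows AE_integrable_kernel: "AE x in N. integrable (K x) f"
    and integrable_kernel_integral: "integrable N (\<lambda>x. \<integral>y. f y \<partial>K x)"
proof -
  note K[measurable]
  have [simp, measurable_cong]: "sets (N \<bind> K) = sets L"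
    using ne sets_kernel[OF K] by (intro sets_bind) auto
  have setsK: "sets (K x) = sets L" if "x \<in> space N" for x
    by (rule sets_kernel[OF K that])
  have fm [measurable]: "f \<in> borel_measurable L"
    using f by (auto simp: integrable_iff_bounded cong: measurable_cong_sets)
  have fin: "(\<integral>\<^sup>+x. \<integral>\<^sup>+y. norm (f y) \<partial>K x \<partial>N) < \<infinity>"
    using f by (subst nn_integral_bind[symmetric, OF _ K]) (auto simp: integrable_iff_bounded)
  have "AE x in N. (\<integral>\<^sup>+y. norm (f y) \<partial>K x) \<noteq> \<infinity>"
    using fin by (intro nn_integral_PInf_AE) auto
  then show ae: "AE x in N. integrable (K x) f"
    by (rule AE_mp) (auto simp: integrable_iff_bounded top.not_eq_extremum setsK cong: measurable_cong_sets)
  have m: "(\<lambda>x. \<integral>y. f y \<partial>K x) \<in> borel_measurable N"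
    using K integral_measurable_subprob_algebra[OF fm] by (rule measurable_compose)
  have "(\<integral>\<^sup>+x. norm (\<integral>y. f y \<partial>K x) \<partial>N) \<le> (\<integral>\<^sup>+x. \<integral>\<^sup>+y. norm (f y) \<partial>K x \<partial>N)"
    using ae by (intro nn_integral_mono_AE, eventually_elim) (auto intro: integral_norm_bound_ennreal)
  with fin m show "integrable N (\<lambda>x. \<integral>y. f y \<partial>K x)"
    by (auto simp: integrable_iff_bounded)
qed

text \<open>Fubini for a kernel and a merely integrable \<open>f\<close>. On an
  \<open>N\<close>-null set of \<open>x\<close> the function \<open>f\<close> may fail to be
  integrable for \<open>K x\<close>, so additivity and limits of the inner integral hold only almost
  everywhere; the dominating function of the outer limit is the inner integral of
  \<open>2 * norm (f y)\<close>.\<close>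

lemma integral_bind_kernel:
  fixes f :: "'b \<Rightarrow> 'c::{banach, second_countable_topology}"
  assumes K: "K \<in> measurable N (subprob_algebra L)" and ne: "space N \<noteq> {}"
    and f: "integrable (N \<bind> K) f"
  shows "(\<integral>y. f y \<partial>(N \<bind> K)) = (\<integral>x. \<integral>y. f y \<partial>K x \<partial>N)"
proof -
  note ae = AE_integrable_kernel[OF K ne] and int = integrable_kernel_integral[OF K ne]
  have [simp, measurable_cong]: "sets (N \<bind> K) = sets L"
    using ne sets_kernel[OF K] by (intro sets_bind) auto
  have setsK: "sets (K x) = sets L" if "x \<in> space N" for x
    by (rule sets_kernel[OF K that])
  have subK: "subprob_space (K x)" if "x \<in> space N" for x
    using K that by (auto dest!: measurable_space simp: space_subprob_algebra)
  show ?thesis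
    using f
  proof (induction rule: integrable_induct)
    case (base A c)
    then have A [measurable]: "A \<in> sets L" by simp
    have "(\<integral>y. indicator A y *\<^sub>R c \<partial>K x) = measure (K x) A *\<^sub>R c" if "x \<in> space N" for x
      using A setsK[OF that] finite_measure.emeasure_finite[OF subprob_space.axioms(1)[OF subK[OF that]], of A]
      by (simp add: top.not_eq_extremum)
    then have "(\<integral>x. \<integral>y. indicator A y *\<^sub>R c \<partial>K x \<partial>N) = (\<integral>x. measure (K x) A *\<^sub>R c \<partial>N)"
      by (intro Bochner_Integration.integral_cong) auto
    moreover have eq: "(\<integral>\<^sup>+x. ennreal (measure (K x) A) \<partial>N) = ennreal (measure (N \<bind> K) A)"
    proof -
      have "(\<integral>\<^sup>+x. ennreal (measure (K x) A) \<partial>N) = (\<integral>\<^sup>+x. emeasure (K x) A \<partial>N)"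
        by (intro nn_integral_cong finite_measure.emeasure_eq_measure[symmetric]
            subprob_space.axioms(1) subK)
      also have "\<dots> = emeasure (N \<bind> K) A"
        using ne K A by (simp add: emeasure_bind)
      finally show ?thesis
        using base by (simp add: emeasure_eq_ennreal_measure top.not_eq_extremum)
    qed
    moreover have "has_bochner_integral N (\<lambda>x. measure (K x) A) (measure (N \<bind> K) A)"
      using eq K by (intro has_bochner_integral_nn_integral)
        (auto intro!: measurable_compose[OF K measurable_measure_subprob_algebra])
    ultimately show ?case
      using base by (simp add: has_bochner_integral_iff)
  next
    case (add f g)
    have "AE x in N. (\<integral>y. f y + g y \<partial>K x) = (\<integral>y. f y \<partial>K x) + (\<integral>y. g y \<partial>K x)"
      using ae[OF add(1)] ae[OF add(2)] by eventually_elim simp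
    then have "(\<integral>x. \<integral>y. f y + g y \<partial>K x \<partial>N) = (\<integral>x. (\<integral>y. f y \<partial>K x) + (\<integral>y. g y \<partial>K x) \<partial>N)"
      using int[OF add(1)] int[OF add(2)] int[OF Bochner_Integration.integrable_add[OF add(1,2)]]
      by (intro integral_cong_AE) auto
    then show ?case
      using add int[OF add(1)] int[OF add(2)] by simp
  next
    case (lim f s)
    have bd: "norm (s i x) \<le> 2 * norm (f x)" if "x \<in> space L" for i x
      using lim(3) that sets_eq_imp_space_eq[OF \<open>sets (N \<bind> K) = sets L\<close>] by auto
    have cv: "(\<lambda>i. s i x) \<longlonglongrightarrow> f x" if "x \<in> space L" for x
      using lim(2) that sets_eq_imp_space_eq[OF \<open>sets (N \<bind> K) = sets L\<close>] by auto
    have n: "integrable (N \<bind> K) (\<lambda>x. 2 * norm (f x))"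
      using lim(4) by auto
    have fm [measurable]: "f \<in> borel_measurable L" "\<And>i. s i \<in> borel_measurable L"
      using lim(1,4) by (auto simp: integrable_iff_bounded cong: measurable_cong_sets)
    have lim1: "(\<lambda>i. \<integral>y. s i y \<partial>(N \<bind> K)) \<longlonglongrightarrow> (\<integral>y. f y \<partial>(N \<bind> K))"
      using lim n by (intro integral_dominated_convergence[where w="\<lambda>x. 2 * norm (f x)"]) auto
    have "AE x in N. integrable (K x) (\<lambda>x. 2 * norm (f x))"
      using ae[OF n] .
    then have AE2: "AE x in N. (\<forall>i. norm (\<integral>y. s i y \<partial>K x) \<le> (\<integral>y. 2 * norm (f y) \<partial>K x))
        \<and> (\<lambda>i. \<integral>y. s i y \<partial>K x) \<longlonglongrightarrow> (\<integral>y. f y \<partial>K x)"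
    proof (rule AE_mp, intro AE_I2 impI conjI allI)
      fix x i assume x: "x \<in> space N" and i: "integrable (K x) (\<lambda>x. 2 * norm (f x))"
      have [simp]: "space (K x) = space L" and [measurable_cong]: "sets (K x) = sets L"
        using setsK[OF x] sets_eq_imp_space_eq by auto
      show "(\<lambda>i. \<integral>y. s i y \<partial>K x) \<longlonglongrightarrow> (\<integral>y. f y \<partial>K x)"
        using bd cv i by (intro integral_dominated_convergence[where w="\<lambda>x. 2 * norm (f x)"]) auto
      have "norm (\<integral>y. s i y \<partial>K x) \<le> (\<integral>y. norm (s i y) \<partial>K x)"
        by (rule integral_norm_bound)
      also have "\<dots> \<le> (\<integral>y. 2 * norm (f y) \<partial>K x)"
        using bd i by (intro integral_mono' ) auto
      finally show "norm (\<integral>y. s i y \<partial>K x) \<le> (\<integral>y. 2 * norm (f y) \<partial>K x)" .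
    qed
    have "(\<lambda>i. \<integral>x. \<integral>y. s i y \<partial>K x \<partial>N) \<longlonglongrightarrow> (\<integral>x. \<integral>y. f y \<partial>K x \<partial>N)"
      using AE2 int[OF lim(1)] int[OF lim(4)] int[OF n]
      by (intro integral_dominated_convergence[where w="\<lambda>x. \<integral>y. 2 * norm (f y) \<partial>K x"])
        (auto simp: AE_all_countable)
    with lim1 lim(5) show ?case
      by (simp add: LIMSEQ_unique)
  qed
qed

text \<open>The sigma-algebra generated by \<open>X 0, ..., X n\<close>. The generator consists of
  cylinders because \<open>markov_chain\<close> speaks about exactly these sets and because they are
  closed under intersection.\<close>

definition past :: "'w measure \<Rightarrow> 'a measure \<Rightarrow> (nat \<Rightarrow> 'w \<Rightarrow> 'a) \<Rightarrow> nat \<Rightarrow> 'w measure" where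
  "past M E X n = sigma (space M) {{\<omega>\<in>space M. \<forall>i\<le>n. X i \<omega> \<in> A i} |A. \<forall>i\<le>n. A i \<in> sets E}"

lemma space_past [simp]: "space (past M E X n) = space M"
  by (auto simp: past_def space_measure_of_conv)

lemma sets_past: "sets (past M E X n) =
    sigma_sets (space M) {{\<omega>\<in>space M. \<forall>i\<le>n. X i \<omega> \<in> A i} |A. \<forall>i\<le>n. A i \<in> sets E}"
  unfolding past_def by (rule sets_measure_of) auto

lemma measurable_past:
  assumes "i \<le> n" "\<And>i. X i \<in> measurable M E"
  shows "X i \<in> measurable (past M E X n) E"
proof (rule measurableI)
  show "X i \<omega> \<in> space E" if "\<omega> \<in> space (past M E X n)" for \<omega>
    using that assms(2)[THEN measurable_space] by simp
  fix A assume A: "A \<in> sets E"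
  have "X i -` A \<inter> space (past M E X n) = {\<omega>\<in>space M. \<forall>j\<le>n. X j \<omega> \<in> (if j = i then A else space E)}"
    using assms(1) assms(2)[THEN measurable_space] by (auto split: if_splits)
  also have "\<dots> \<in> sets (past M E X n)"
    unfolding sets_past using A
    by (intro sigma_sets.Basic CollectI exI[of _ "\<lambda>j. if j = i then A else space E"]) auto
  finally show "X i -` A \<inter> space (past M E X n) \<in> sets (past M E X n)" .
qed

lemma past_le:
  assumes X: "\<And>i. X i \<in> measurable M E"
  shows "(\<lambda>\<omega>. \<omega>) \<in> measurable M (past M E X n)"
proof -
  have "{\<omega>\<in>space M. \<forall>i\<le>n. X i \<omega> \<in> A i} \<in> sets M" if A: "\<And>i. i \<le> n \<Longrightarrow> A i \<in> sets E" for A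
  proof -
    have "{\<omega>\<in>space M. \<forall>i\<le>n. X i \<omega> \<in> A i} = (\<Inter>i\<in>{..n}. X i -` A i \<inter> space M)"
      by auto
    then show ?thesis
      using A X by (auto intro!: sets.finite_INT measurable_sets)
  qed
  then have le: "sets (past M E X n) \<subseteq> sets M"
    unfolding sets_past by (intro sets.sigma_sets_subset) blast
  show ?thesis
  proof (rule measurableI)
    fix A assume "A \<in> sets (past M E X n)"
    then have A: "A \<in> sets M" using le by blast
    have "(\<lambda>\<omega>. \<omega>) -` A \<inter> space M = A"
      using sets.sets_into_space[OF A] by blast
    with A show "(\<lambda>\<omega>. \<omega>) -` A \<inter> space M \<in> sets M"
      by simp
  qed simp
qed

section \<open>Stationary chains and their Markov property\<close>

locale stationary_chain =
  fixes E :: "'a measure" and Q :: "'a \<Rightarrow> 'a measure" and \<nu> :: "'a measure"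
    and M :: "'w measure" and X :: "nat \<Rightarrow> 'w \<Rightarrow> 'a"
  assumes Q_kernel: "Q \<in> measurable E (prob_algebra E)"
    and \<nu>_prob: "prob_space \<nu>" and \<nu>_sets: "sets \<nu> = sets E"
    and \<nu>_inv: "bind \<nu> Q = \<nu>"
    and chain: "markov_chain M E Q \<nu> X"
begin

sublocale M: prob_space M
  using chain by (simp add: markov_chain_def)

sublocale \<nu>: prob_space \<nu>
  by (rule \<nu>_prob)

declare \<nu>_sets [measurable_cong]

lemma space_\<nu>: "space \<nu> = space E"
  using \<nu>_sets by (rule sets_eq_imp_space_eq)

lemma X_measurable [measurable]: "X n \<in> measurable M E"
  using chain by (simp add: markov_chain_def)

lemma X_space: "\<omega> \<in> space M \<Longrightarrow> X n \<omega> \<in> space E"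
  using X_measurable by (rule measurable_space)

lemma chain_cylinder:
  assumes "\<And>i. i \<le> n \<Longrightarrow> A i \<in> sets E" "B \<in> sets E"
  shows "measure M {\<omega>\<in>space M. (\<forall>i\<le>n. X i \<omega> \<in> A i) \<and> X (Suc n) \<omega> \<in> B}
     = (\<integral>\<omega>. indicator {\<omega>\<in>space M. \<forall>i\<le>n. X i \<omega> \<in> A i} \<omega> * measure (Q (X n \<omega>)) B \<partial>M)"
proof -
  have "\<forall>n (A :: nat \<Rightarrow> 'a set) B. (\<forall>i\<le>n. A i \<in> sets E) \<longrightarrow> B \<in> sets E \<longrightarrow>
        measure M {\<omega>\<in>space M. (\<forall>i\<le>n. X i \<omega> \<in> A i) \<and> X (Suc n) \<omega> \<in> B}
        = (\<integral>\<omega>. indicator {\<omega>\<in>space M. \<forall>i\<le>n. X i \<omega> \<in> A i} \<omega> * measure (Q (X n \<omega>)) B \<partial>M)"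
    using chain unfolding markov_chain_def by (elim conjE)
  with assms show ?thesis
    by simp
qed

lemma Q_subprob [measurable]: "Q \<in> measurable E (subprob_algebra E)"
  using Q_kernel by (rule measurable_prob_algebraD)

lemma measurable_Q_measure [measurable]: "B \<in> sets E \<Longrightarrow> (\<lambda>x. measure (Q x) B) \<in> borel_measurable E"
  by (rule measurable_compose[OF Q_subprob measurable_measure_subprob_algebra])

lemma Q_prob: "x \<in> space E \<Longrightarrow> prob_space (Q x)"
  using Q_kernel by (auto dest!: measurable_space simp: space_prob_algebra)

lemma Q_sets: "x \<in> space E \<Longrightarrow> sets (Q x) = sets E"
  using Q_kernel by (auto dest!: measurable_space simp: space_prob_algebra)

text \<open>Both measures agree on products of a cylinder and a set in \<open>E\<close>, which is
  the defining identity of the chain, and these products form an intersection-stable generator. The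
  identity extends the Markov property from cylinders to arbitrary functions of the past and the
  next state, with no conditional expectations involved.\<close>

lemma joint_law:
  "distr M (past M E X n \<Otimes>\<^sub>M E) (\<lambda>\<omega>. (\<omega>, X (Suc n) \<omega>)) =
   M \<bind> (\<lambda>\<omega>. distr (Q (X n \<omega>)) (past M E X n \<Otimes>\<^sub>M E) (Pair \<omega>))"
  (is "?J1 = ?J2")
proof -
  let ?F = "past M E X n"
  define C where "C = {{\<omega>\<in>space M. \<forall>i\<le>n. X i \<omega> \<in> A i} |A. \<forall>i\<le>n. A i \<in> sets E}"
  define G where "G = {c \<times> b |c b. c \<in> C \<and> b \<in> sets E}"
  have CI: "{\<omega>\<in>space M. \<forall>i\<le>n. X i \<omega> \<in> A i} \<in> C" if "\<forall>i\<le>n. A i \<in> sets E" for A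
    using that unfolding C_def by blast
  have GE: "\<exists>A B. Y = {\<omega>\<in>space M. \<forall>i\<le>n. X i \<omega> \<in> A i} \<times> B \<and> (\<forall>i\<le>n. A i \<in> sets E) \<and> B \<in> sets E"
    if "Y \<in> G" for Y
    using that unfolding G_def C_def by blast
  have C_Pow: "C \<subseteq> Pow (space M)"
    unfolding C_def by blast
  note [measurable] = past_le[OF X_measurable]
  have K: "(\<lambda>\<omega>. distr (Q (X n \<omega>)) (?F \<Otimes>\<^sub>M E) (Pair \<omega>)) \<in> measurable M (subprob_algebra (?F \<Otimes>\<^sub>M E))"
    by (rule measurable_distr2[where M=E]) measurable
  have "{\<omega>\<in>space M. \<forall>i\<le>n. X i \<omega> \<in> space E} = space M"
    by (auto simp: X_space)
  then have top: "space M \<in> C"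
    using CI[of "\<lambda>_. space E"] by simp
  \<comment> \<open>The whole space is itself a cylinder and thus serves as the countable cover
    needed to generate a product sigma-algebra from generators.\<close>
  have "sets (?F \<Otimes>\<^sub>M E) = sets (sigma (space ?F \<times> space E) {a \<times> b |a b. a \<in> C \<and> b \<in> sets E})"
  proof (rule sets_pair_eq[where Ca="{space M}" and Cb="{space E}"])
    show "sets ?F = sigma_sets (space ?F) C"
      by (simp add: sets_past C_def)
    show "sets E = sigma_sets (space E) (sets E)"
      by (simp add: sets.sigma_sets_eq)
  qed (use top C_Pow sets.space_closed[of E] in auto)
  also have "\<dots> = sets (sigma (space M \<times> space E) G)"
    by (simp add: G_def)
  also have "\<dots> = sigma_sets (space M \<times> space E) G"
    using C_Pow sets.space_closed[of E] by (intro sets_measure_of) (auto simp: G_def)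
  finally have setsP: "sets (?F \<Otimes>\<^sub>M E) = sigma_sets (space M \<times> space E) G" .
  show ?thesis
  proof (rule measure_eqI_generator_eq[where E="G" and \<Omega>="space M \<times> space E" and A="\<lambda>_. space M \<times> space E"])
    show "Int_stable G"
    proof (rule Int_stableI)
      fix a b assume "a \<in> G" "b \<in> G"
      obtain A B where a: "a = {\<omega>\<in>space M. \<forall>i\<le>n. X i \<omega> \<in> A i} \<times> B"
        and sa: "\<forall>i\<le>n. A i \<in> sets E" "B \<in> sets E"
        using GE[OF \<open>a \<in> G\<close>] by (elim exE conjE)
      obtain A' B' where b: "b = {\<omega>\<in>space M. \<forall>i\<le>n. X i \<omega> \<in> A' i} \<times> B'"
        and sb: "\<forall>i\<le>n. A' i \<in> sets E" "B' \<in> sets E"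
        using GE[OF \<open>b \<in> G\<close>] by (elim exE conjE)
      have "a \<inter> b = {\<omega>\<in>space M. \<forall>i\<le>n. X i \<omega> \<in> A i \<inter> A' i} \<times> (B \<inter> B')"
        unfolding a b by auto
      moreover have "{\<omega>\<in>space M. \<forall>i\<le>n. X i \<omega> \<in> A i \<inter> A' i} \<in> C"
        using sa sb by (intro CI) auto
      moreover have "B \<inter> B' \<in> sets E"
        using sa sb by auto
      ultimately show "a \<inter> b \<in> G"
        unfolding G_def by blast
    qed
    show "G \<subseteq> Pow (space M \<times> space E)"
      using C_Pow sets.space_closed[of E] by (auto simp: G_def)
    show "sets ?J1 = sigma_sets (space M \<times> space E) G"
      by (simp add: setsP)
    show "sets ?J2 = sigma_sets (space M \<times> space E) G"
      using setsP sets_bind[OF sets_kernel[OF K] M.not_empty] by simp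
    show "range (\<lambda>_. space M \<times> space E) \<subseteq> G"
      using top sets.top[of E] by (auto simp: G_def)
    show "emeasure ?J1 (space M \<times> space E) \<noteq> \<infinity>"
    proof -
      have "(\<lambda>\<omega>. (\<omega>, X (Suc n) \<omega>)) \<in> measurable M (?F \<Otimes>\<^sub>M E)"
        by measurable
      from M.finite_measure_distr[OF this] show ?thesis
        by (simp add: finite_measure.emeasure_finite)
    qed
    fix Y assume "Y \<in> G"
    obtain A B where Y: "Y = {\<omega>\<in>space M. \<forall>i\<le>n. X i \<omega> \<in> A i} \<times> B"
      and A: "\<forall>i\<le>n. A i \<in> sets E" and B [measurable]: "B \<in> sets E"
      using GE[OF \<open>Y \<in> G\<close>] by (elim exE conjE)
    define D where "D = {\<omega>\<in>space M. \<forall>i\<le>n. X i \<omega> \<in> A i}"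
    have DF: "D \<in> sets ?F"
      using CI[OF A] unfolding sets_past C_def D_def by (rule sigma_sets.Basic)
    have "(\<lambda>\<omega>. \<omega>) -` D \<inter> space M \<in> sets M"
      by (rule measurable_sets[OF past_le[OF X_measurable] DF])
    also have "(\<lambda>\<omega>. \<omega>) -` D \<inter> space M = D"
      unfolding D_def by blast
    finally have DM [measurable]: "D \<in> sets M" .
    have YD: "Y = D \<times> B"
      unfolding Y D_def ..
    have Ys: "Y \<in> sets (?F \<Otimes>\<^sub>M E)"
      unfolding YD using DF B by (rule pair_measureI)
    have pq: "prob_space (Q (X n \<omega>))" if "\<omega> \<in> space M" for \<omega>
      using that by (intro Q_prob X_space)
    have "emeasure ?J1 Y = emeasure M ((\<lambda>\<omega>. (\<omega>, X (Suc n) \<omega>)) -` Y \<inter> space M)"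
      using Ys by (intro emeasure_distr) measurable
    also have "(\<lambda>\<omega>. (\<omega>, X (Suc n) \<omega>)) -` Y \<inter> space M = {\<omega>\<in>space M. (\<forall>i\<le>n. X i \<omega> \<in> A i) \<and> X (Suc n) \<omega> \<in> B}"
      unfolding Y by auto
    also have "emeasure M {\<omega>\<in>space M. (\<forall>i\<le>n. X i \<omega> \<in> A i) \<and> X (Suc n) \<omega> \<in> B} = ennreal (measure M {\<omega>\<in>space M. (\<forall>i\<le>n. X i \<omega> \<in> A i) \<and> X (Suc n) \<omega> \<in> B})"
      by (rule M.emeasure_eq_measure)
    also have "\<dots> = ennreal (\<integral>\<omega>. indicator D \<omega> * measure (Q (X n \<omega>)) B \<partial>M)"
      using A B unfolding D_def by (subst chain_cylinder) simp_all
    also have "\<dots> = (\<integral>\<^sup>+\<omega>. ennreal (indicator D \<omega> * measure (Q (X n \<omega>)) B) \<partial>M)"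
    proof (intro nn_integral_eq_integral[symmetric] M.integrable_const_bound[where B=1] AE_I2)
      show "norm (indicator D \<omega> * measure (Q (X n \<omega>)) B) \<le> 1" if "\<omega> \<in> space M" for \<omega>
        using prob_space.prob_le_1[OF pq[OF that], of B] by (simp split: split_indicator)
    qed simp_all
    also have "\<dots> = (\<integral>\<^sup>+\<omega>. emeasure (distr (Q (X n \<omega>)) (?F \<Otimes>\<^sub>M E) (Pair \<omega>)) Y \<partial>M)"
    proof (rule nn_integral_cong)
      fix \<omega> assume w: "\<omega> \<in> space M"
      have setsQ: "sets (Q (X n \<omega>)) = sets E"
        using w by (intro Q_sets X_space)
      have P: "Pair \<omega> \<in> measurable (Q (X n \<omega>)) (?F \<Otimes>\<^sub>M E)"
        using w by (subst measurable_cong_sets[OF setsQ refl]) (simp add: measurable_Pair1')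
      have "emeasure (distr (Q (X n \<omega>)) (?F \<Otimes>\<^sub>M E) (Pair \<omega>)) Y = emeasure (Q (X n \<omega>)) (Pair \<omega> -` Y \<inter> space (Q (X n \<omega>)))"
        using Ys P by (intro emeasure_distr)
      also have "Pair \<omega> -` Y \<inter> space (Q (X n \<omega>)) = (if \<omega> \<in> D then B else {})"
        using w B[THEN sets.sets_into_space] sets_eq_imp_space_eq[OF setsQ] unfolding YD by auto
      also have "emeasure (Q (X n \<omega>)) \<dots> = ennreal (indicator D \<omega> * measure (Q (X n \<omega>)) B)"
        using prob_space.finite_measure[OF pq[OF w]] by (auto simp: finite_measure.emeasure_eq_measure)
      finally show "ennreal (indicator D \<omega> * measure (Q (X n \<omega>)) B) = emeasure (distr (Q (X n \<omega>)) (?F \<Otimes>\<^sub>M E) (Pair \<omega>)) Y" ..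
    qed
    also have "\<dots> = emeasure ?J2 Y"
      using Ys by (simp add: emeasure_bind[OF M.not_empty K])
    finally show "emeasure ?J1 Y = emeasure ?J2 Y" .
  qed auto
qed

text \<open>Takes the place of conditioning on the past. In \<open>joint_law\<close> the first
  coordinate is the entire sample point, so that \<open>W\<close> and \<open>X n\<close> are both
  functions of it; only integrability of the product is required.\<close>

lemma markov_property:
  fixes W :: "'w \<Rightarrow> complex" and G :: "'a \<times> 'a \<Rightarrow> complex"
  assumes W [measurable]: "W \<in> borel_measurable (past M E X n)"
    and G [measurable]: "G \<in> borel_measurable (E \<Otimes>\<^sub>M E)"
    and int: "integrable M (\<lambda>\<omega>. W \<omega> * G (X n \<omega>, X (Suc n) \<omega>))"
  shows "(\<integral>\<omega>. W \<omega> * G (X n \<omega>, X (Suc n) \<omega>) \<partial>M) = (\<integral>\<omega>. W \<omega> * (\<integral>y. G (X n \<omega>, y) \<partial>Q (X n \<omega>)) \<partial>M)"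
proof -
  let ?F = "past M E X n"
  let ?J1 = "distr M (?F \<Otimes>\<^sub>M E) (\<lambda>\<omega>. (\<omega>, X (Suc n) \<omega>))"
  let ?H = "\<lambda>p. W (fst p) * G (X n (fst p), snd p)"
  note [measurable] = past_le[OF X_measurable] measurable_past[OF order_refl X_measurable]
  have K: "(\<lambda>\<omega>. distr (Q (X n \<omega>)) (?F \<Otimes>\<^sub>M E) (Pair \<omega>)) \<in> measurable M (subprob_algebra (?F \<Otimes>\<^sub>M E))"
    by (rule measurable_distr2[where M=E]) measurable
  have "integrable ?J1 ?H"
    using int by (subst integrable_distr_eq) auto
  then have 1: "(\<integral>p. ?H p \<partial>?J1) = (\<integral>\<omega>. \<integral>p. ?H p \<partial>distr (Q (X n \<omega>)) (?F \<Otimes>\<^sub>M E) (Pair \<omega>) \<partial>M)"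
    unfolding joint_law by (rule integral_bind_kernel[OF K M.not_empty])
  have 2: "(\<integral>p. ?H p \<partial>distr (Q (X n \<omega>)) (?F \<Otimes>\<^sub>M E) (Pair \<omega>)) = W \<omega> * (\<integral>y. G (X n \<omega>, y) \<partial>Q (X n \<omega>))"
    if w: "\<omega> \<in> space M" for \<omega>
  proof -
    have setsQ: "sets (Q (X n \<omega>)) = sets E"
      using w by (intro Q_sets X_space)
    have P: "Pair \<omega> \<in> measurable (Q (X n \<omega>)) (?F \<Otimes>\<^sub>M E)"
      using w by (subst measurable_cong_sets[OF setsQ refl]) (simp add: measurable_Pair1')
    show ?thesis
      by (subst integral_distr[OF P]) auto
  qed
  have "(\<integral>\<omega>. W \<omega> * G (X n \<omega>, X (Suc n) \<omega>) \<partial>M) = (\<integral>p. ?H p \<partial>?J1)"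
    by (subst integral_distr) auto
  also have "\<dots> = (\<integral>\<omega>. W \<omega> * (\<integral>y. G (X n \<omega>, y) \<partial>Q (X n \<omega>)) \<partial>M)"
    unfolding 1 by (intro Bochner_Integration.integral_cong refl 2)
  finally show ?thesis .
qed

text \<open>Taking every \<open>A i\<close> to be the whole space turns the cylinder identity into a
  relation between two consecutive laws, which invariance of \<open>\<nu>\<close> closes.\<close>

lemma distr_X: "distr M E (X n) = \<nu>"
proof (induction n)
  case 0
  show ?case using chain by (simp add: markov_chain_def)
next
  case (Suc n)
  show ?case
  proof (rule measure_eqI)
    fix B assume "B \<in> sets (distr M E (X (Suc n)))"
    then have B [measurable]: "B \<in> sets E" by simp
    have ne: "space \<nu> \<noteq> {}" by (rule \<nu>.not_empty)
    have "emeasure (distr M E (X (Suc n))) B = emeasure M (X (Suc n) -` B \<inter> space M)"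
      by (intro emeasure_distr) simp_all
    also have "X (Suc n) -` B \<inter> space M = {\<omega>\<in>space M. (\<forall>i\<le>n. X i \<omega> \<in> space E) \<and> X (Suc n) \<omega> \<in> B}"
      by (auto simp: X_space)
    also have "emeasure M {\<omega>\<in>space M. (\<forall>i\<le>n. X i \<omega> \<in> space E) \<and> X (Suc n) \<omega> \<in> B} =
        ennreal (measure M {\<omega>\<in>space M. (\<forall>i\<le>n. X i \<omega> \<in> space E) \<and> X (Suc n) \<omega> \<in> B})"
      by (rule M.emeasure_eq_measure)
    also have "\<dots> = (\<integral>\<omega>. indicator {\<omega>\<in>space M. \<forall>i\<le>n. X i \<omega> \<in> space E} \<omega> * measure (Q (X n \<omega>)) B \<partial>M)"
      using B by (subst chain_cylinder) simp_all
    also have "\<dots> = (\<integral>\<omega>. measure (Q (X n \<omega>)) B \<partial>M)"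
      by (intro arg_cong[where f=ennreal] Bochner_Integration.integral_cong) (auto simp: X_space)
    also have "\<dots> = (\<integral>x. measure (Q x) B \<partial>\<nu>)"
      unfolding Suc.IH[symmetric] by (subst integral_distr) auto
    also have "\<dots> = (\<integral>\<^sup>+x. ennreal (measure (Q x) B) \<partial>\<nu>)"
      using Q_prob by (intro nn_integral_eq_integral[symmetric] \<nu>.integrable_const_bound[where B=1] AE_I2)
        (auto simp: space_\<nu> intro!: prob_space.prob_le_1)
    also have "\<dots> = (\<integral>\<^sup>+x. emeasure (Q x) B \<partial>\<nu>)"
      using prob_space.finite_measure[OF Q_prob]
      by (intro nn_integral_cong) (auto simp: space_\<nu> finite_measure.emeasure_eq_measure)
    also have "\<dots> = emeasure (\<nu> \<bind> Q) B"
      by (subst emeasure_bind[OF ne _ B]) auto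
    finally show "emeasure (distr M E (X (Suc n))) B = emeasure \<nu> B"
      unfolding \<nu>_inv .
  qed (simp add: \<nu>_sets)
qed

end

section \<open>Martingale approximation\<close>

lemma norm_integral_le_integral:
  fixes f :: "'b \<Rightarrow> 'c::{banach, second_countable_topology}"
  assumes "integrable N f" "integrable N h" "\<And>x. norm (f x) \<le> h x"
  shows "norm (\<integral>x. f x \<partial>N) \<le> (\<integral>x. h x \<partial>N)"
  using assms by (intro order_trans[OF integral_norm_bound] integral_mono) auto

text \<open>Young's inequality for the exponents 3 and 3/2, from
  \<open>(a - d)^2 * (a + 2 * d) \<ge> 0\<close> at \<open>d = sqrt (b / \<beta>)\<close>. The
  scaling by \<open>\<beta>\<close> makes it act as Hoelder's inequality after integration: if
  \<open>b\<close> has \<open>L^(3/2)\<close> norm at most \<open>\<beta>\<close>, the integrated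
  right side is \<open>\<beta>\<close> times a constant that depends on the third moment of
  \<open>a\<close>.\<close>

lemma young_three_halves:
  fixes a b \<beta> :: real
  assumes "0 \<le> a" "0 \<le> b" "0 < \<beta>"
  shows "a * b \<le> \<beta> * (a ^ 3 / 3 + 2/3 * (b powr (3/2) / \<beta> powr (3/2)))"
proof -
  define d where "d = sqrt (b / \<beta>)"
  have d: "0 \<le> d" "d\<^sup>2 = b / \<beta>"
    using assms by (auto simp: d_def)
  have "d ^ 3 = (b / \<beta>) powr (3/2)"
  proof (cases "b = 0")
    case False
    then have "d = (b / \<beta>) powr (1/2)"
      using assms by (simp add: d_def powr_half_sqrt)
    then show ?thesis
      using False assms by (simp add: powr_realpow[symmetric] powr_powr)
  qed (simp add: d_def)
  then have d3: "d ^ 3 = b powr (3/2) / \<beta> powr (3/2)"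
    using assms by (simp add: powr_divide)
  have "0 \<le> (a - d)\<^sup>2 * (a + 2 * d)"
    using assms d by simp
  then have "a * d\<^sup>2 \<le> a ^ 3 / 3 + 2/3 * d ^ 3"
    by (simp add: power2_eq_square power3_eq_cube algebra_simps)
  then have "\<beta> * (a * d\<^sup>2) \<le> \<beta> * (a ^ 3 / 3 + 2/3 * d ^ 3)"
    using assms by (intro mult_left_mono) auto
  then show ?thesis
    using assms by (simp add: d d3)
qed

lemma cube_diff_le:
  fixes a b :: real
  shows "\<bar>a - b\<bar> ^ 3 \<le> 4 * (\<bar>a\<bar> ^ 3 + \<bar>b\<bar> ^ 3)"
proof -
  have "\<bar>a - b\<bar> ^ 3 \<le> (\<bar>a\<bar> + \<bar>b\<bar>) ^ 3"
    by (intro power_mono abs_triangle_ineq4) auto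
  also have "\<dots> \<le> 4 * (\<bar>a\<bar> ^ 3 + \<bar>b\<bar> ^ 3)"
  proof -
    have "(u + v) ^ 3 \<le> 4 * (u ^ 3 + v ^ 3)" if "0 \<le> u" "0 \<le> v" for u v :: real
    proof -
      have "0 \<le> 3 * (u + v) * (u - v)\<^sup>2" using that by simp
      then show ?thesis
        by (simp add: power2_eq_square power3_eq_cube algebra_simps)
    qed
    then show ?thesis by simp
  qed
  finally show ?thesis .
qed

lemma le_one_plus_cube:
  fixes a :: real
  assumes "0 \<le> a"
  shows "a \<le> 1 + a ^ 3" "a\<^sup>2 \<le> 1 + a ^ 3"
proof -
  have "a \<le> 1 + a ^ 3 \<and> a\<^sup>2 \<le> 1 + a ^ 3"
  proof (cases "a \<le> 1")
    case True
    then show ?thesis using assms by (auto intro: order_trans[OF power_le_one] simp: add_increasing2)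
  next
    case False
    then have "a ^ 1 \<le> a ^ 3" "a ^ 2 \<le> a ^ 3" by (intro power_increasing; simp)+
    then show ?thesis by auto
  qed
  then show "a \<le> 1 + a ^ 3" "a\<^sup>2 \<le> 1 + a ^ 3" by auto
qed

lemma le_one_plus_powr_three_halves: "0 \<le> (a::real) \<Longrightarrow> a \<le> 1 + a powr (3/2)"
proof (cases "a \<le> 1")
  case False
  then have "a powr 1 \<le> a powr (3/2)" by (intro powr_mono) auto
  with False show ?thesis by simp
qed (simp add: add_increasing2)

lemma exp_minus_linear_bound:
  fixes y :: real
  assumes "0 \<le> y"
  shows "\<bar>exp (- y) - (1 - y)\<bar> \<le> y\<^sup>2 / 2"
proof -
  let ?f = "\<lambda>y::real. 1 - y + y\<^sup>2 / 2 - exp (- y)"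
  have "?f 0 \<le> ?f y"
  proof (rule DERIV_nonneg_imp_nondecreasing[OF assms])
    fix x :: real assume "0 \<le> x"
    show "\<exists>d. (?f has_real_derivative d) (at x) \<and> 0 \<le> d"
      using exp_ge_add_one_self[of "- x"]
      by (intro exI[of _ "x - 1 + exp (- x)"]) (auto intro!: derivative_eq_intros)
  qed
  then show ?thesis
    using exp_ge_add_one_self[of "- y"] by simp
qed

lemma iexp_second_order: "norm (iexp u - (1 + \<i> * u - u\<^sup>2 / 2)) \<le> \<bar>u\<bar> ^ 3 / 6"
  using iexp_approx1[of u 2] by (simp add: eval_nat_numeral algebra_simps)

lemma iexp_first_order: "norm (iexp u - iexp v) \<le> \<bar>u - v\<bar>"
proof -
  have "iexp u - iexp v = iexp v * (iexp (u - v) - 1)"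
    by (simp add: algebra_simps mult_exp_exp)
  also have "norm \<dots> = norm (iexp (u - v) - 1)"
    by (simp add: norm_mult)
  also have "\<dots> \<le> \<bar>u - v\<bar>"
    using iexp_approx1[of "u - v" 0] by simp
  finally show ?thesis .
qed

section \<open>Integration along the stationary chain\<close>

context stationary_chain
begin

lemma
  fixes f :: "'a \<Rightarrow> 'c::{banach, second_countable_topology}"
  assumes "integrable \<nu> f"
  shows AE_integrable_Q: "AE x in \<nu>. integrable (Q x) f"
    and integrable_Q_integral: "integrable \<nu> (\<lambda>x. \<integral>y. f y \<partial>Q x)"
    and integral_Q_integral: "(\<integral>x. \<integral>y. f y \<partial>Q x \<partial>\<nu>) = (\<integral>x. f x \<partial>\<nu>)"
proof -
  have Q: "Q \<in> measurable \<nu> (subprob_algebra E)" by measurable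
  note * = Q \<nu>.not_empty
  show "AE x in \<nu>. integrable (Q x) f" "integrable \<nu> (\<lambda>x. \<integral>y. f y \<partial>Q x)"
    using AE_integrable_kernel[OF *, of f] integrable_kernel_integral[OF *, of f] assms by (auto simp: \<nu>_inv)
  show "(\<integral>x. \<integral>y. f y \<partial>Q x \<partial>\<nu>) = (\<integral>x. f x \<partial>\<nu>)"
    using integral_bind_kernel[OF *, of f] assms by (simp add: \<nu>_inv)
qed

lemma
  fixes f :: "'a \<Rightarrow> 'c::{banach, second_countable_topology}"
  assumes "integrable \<nu> f"
  shows integrable_X: "integrable M (\<lambda>\<omega>. f (X n \<omega>))"
    and integral_X: "(\<integral>\<omega>. f (X n \<omega>) \<partial>M) = (\<integral>x. f x \<partial>\<nu>)"
proof -
  have [measurable]: "f \<in> borel_measurable E"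
    using borel_measurable_integrable[OF assms] by simp
  show "integrable M (\<lambda>\<omega>. f (X n \<omega>))"
    using assms unfolding distr_X[of n, symmetric] by (subst (asm) integrable_distr_eq) auto
  show "(\<integral>\<omega>. f (X n \<omega>) \<partial>M) = (\<integral>x. f x \<partial>\<nu>)"
    unfolding distr_X[of n, symmetric] by (subst integral_distr) auto
qed

lemma AE_X:
  assumes "AE x in \<nu>. P x"
  shows "AE \<omega> in M. P (X n \<omega>)"
  using assms unfolding distr_X[of n, symmetric] by (rule AE_distrD[OF X_measurable])

lemma Q_integral_measurable [measurable]:
  fixes f :: "'a \<Rightarrow> 'c::{banach, second_countable_topology}"
  assumes "f \<in> borel_measurable E"
  shows "(\<lambda>x. \<integral>y. f y \<partial>Q x) \<in> borel_measurable E"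
  by (rule measurable_compose[OF Q_subprob integral_measurable_subprob_algebra[OF assms]])

lemma integrable_of_powr_three_halves:
  fixes f :: "'a \<Rightarrow> complex"
  assumes [measurable]: "f \<in> borel_measurable E" and f: "integrable \<nu> (\<lambda>x. norm (f x) powr (3/2))"
  shows "integrable \<nu> f"
proof (rule Bochner_Integration.integrable_bound)
  show "integrable \<nu> (\<lambda>x. 1 + norm (f x) powr (3/2))"
    using f by simp
  show "AE x in \<nu>. norm (f x) \<le> norm (1 + norm (f x) powr (3/2))"
    using le_one_plus_powr_three_halves[of "norm (f x)" for x] by (intro AE_I2) (simp add: abs_of_nonneg)
qed measurable

end

text \<open>The data of Gordin's method: \<open>\<zeta>\<close> solves the Poisson equation for
  \<open>\<xi>\<close>, \<open>\<theta>\<close> is \<open>Q \<zeta>\<close>, \<open>g p\<close> is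
  \<open>Q^p \<psi>\<close>, and \<open>\<beta> p\<close> majorises the \<open>L^(3/2)\<close> norm
  of \<open>g p\<close>. Real functions are used here, while \<open>B\<close> contains complex ones,
  so the identities are required only almost everywhere; \<open>\<beta> p\<close> is strictly
  positive because Young's inequality divides by it.\<close>

locale martingale_approximation = stationary_chain E Q \<nu> M X
  for E :: "'a measure" and Q :: "'a \<Rightarrow> 'a measure" and \<nu> :: "'a measure"
    and M :: "'w measure" and X :: "nat \<Rightarrow> 'w \<Rightarrow> 'a" +
  fixes \<xi> \<zeta> \<theta> :: "'a \<Rightarrow> real" and s2 :: real and g :: "nat \<Rightarrow> 'a \<Rightarrow> complex" and \<beta> :: "nat \<Rightarrow> real"
  assumes meas [measurable]: "\<xi> \<in> borel_measurable E" "\<zeta> \<in> borel_measurable E" "\<theta> \<in> borel_measurable E"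
      "g p \<in> borel_measurable E"
    and \<theta>_eq: "AE x in \<nu>. \<theta> x = (\<integral>y. \<zeta> y \<partial>Q x)"
    and poisson: "AE x in \<nu>. \<xi> x = \<zeta> x - \<theta> x"
    and \<zeta>3: "integrable \<nu> (\<lambda>x. \<bar>\<zeta> x\<bar> ^ 3)" and \<theta>3: "integrable \<nu> (\<lambda>x. \<bar>\<theta> x\<bar> ^ 3)"
    and g_0: "AE x in \<nu>. g 0 x = of_real ((\<integral>y. (\<zeta> y)\<^sup>2 \<partial>Q x) - (\<theta> x)\<^sup>2 - s2)"
    and g_Suc: "g (Suc p) x = (\<integral>y. g p y \<partial>Q x)"
    and g_integrable: "integrable \<nu> (\<lambda>x. norm (g p x) powr (3/2))"
    and g_le: "(\<integral>x. norm (g p x) powr (3/2) \<partial>\<nu>) \<le> \<beta> p powr (3/2)"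
    and \<beta>_pos: "0 < \<beta> p" and \<beta>_summable: "summable \<beta>"
    and g_centered: "(\<integral>x. g 0 x \<partial>\<nu>) = 0"
    and s2_nonneg: "0 \<le> s2"
begin

definition D :: "nat \<Rightarrow> 'w \<Rightarrow> real" where
  "D n \<omega> = (\<Sum>k<n. \<zeta> (X (Suc k) \<omega>) - \<theta> (X k \<omega>))"

definition W :: "real \<Rightarrow> nat \<Rightarrow> 'w \<Rightarrow> complex" where
  "W t n \<omega> = iexp (t * D n \<omega>)"

lemma W_past [measurable]: "W t n \<in> borel_measurable (past M E X n)"
proof -
  have [measurable]: "X i \<in> measurable (past M E X n) E" if "i \<le> n" for i
    by (rule measurable_past[OF that X_measurable])
  have "(\<lambda>\<omega>. \<Sum>k<n. \<zeta> (X (Suc k) \<omega>) - \<theta> (X k \<omega>)) \<in> borel_measurable (past M E X n)"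
  proof (rule borel_measurable_sum)
    fix k assume "k \<in> {..<n}"
    then have [measurable]: "X k \<in> measurable (past M E X n) E" "X (Suc k) \<in> measurable (past M E X n) E"
      by (auto intro!: measurable_past X_measurable)
    show "(\<lambda>\<omega>. \<zeta> (X (Suc k) \<omega>) - \<theta> (X k \<omega>)) \<in> borel_measurable (past M E X n)"
      by measurable
  qed
  then show ?thesis
    unfolding W_def [abs_def] D_def by measurable
qed

lemma W_measurable [measurable]: "W t n \<in> borel_measurable M"
  unfolding W_def [abs_def] D_def by measurable

lemma norm_W [simp]: "norm (W t n \<omega>) = 1"
  by (simp add: W_def)

lemma W_0 [simp]: "W t 0 \<omega> = 1"
  by (simp add: W_def D_def)

lemma W_Suc: "W t (Suc n) \<omega> = W t n \<omega> * iexp (t * (\<zeta> (X (Suc n) \<omega>) - \<theta> (X n \<omega>)))"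
  by (simp add: W_def D_def mult_exp_exp algebra_simps)

lemma integrable_W_mult: "integrable M f \<Longrightarrow> integrable M (\<lambda>\<omega>. W t n \<omega> * f \<omega>)"
  by (rule Bochner_Integration.integrable_bound[of M f]) (auto simp: norm_mult)

lemma integrable_g: "integrable \<nu> (g p)"
  by (rule integrable_of_powr_three_halves[OF meas(4) g_integrable])

section \<open>Correlation of the variance fluctuation with the past\<close>

definition "CU = (\<integral>x. \<bar>\<zeta> x\<bar> ^ 3 \<partial>\<nu>) + (\<integral>x. \<bar>\<theta> x\<bar> ^ 3 \<partial>\<nu>)"

lemma CU_nonneg: "0 \<le> CU"
  by (simp add: CU_def)

text \<open>Only \<open>p = 0\<close> enters the one-step expansion; general \<open>p\<close> is
  carried along because each step back in time applies \<open>Q\<close> once more.\<close>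

definition "corr t k p = (\<integral>\<omega>. W t k \<omega> * g p (X k \<omega>) \<partial>M)"

lemma corr_0: "corr t 0 p = 0"
proof -
  have "(\<integral>x. g p x \<partial>\<nu>) = 0"
    by (induction p) (simp_all add: g_centered g_Suc integral_Q_integral[OF integrable_g])
  then show ?thesis
    using integral_X[OF integrable_g] by (simp add: corr_def)
qed

text \<open>Replacing \<open>W t (Suc k)\<close> by \<open>W t k\<close> costs
  \<open>\<bar>t\<bar>\<close> times the martingale increment; afterwards the Markov property turns
  \<open>g p (X (Suc k))\<close> into \<open>g (Suc p) (X k)\<close>. The product of the increment
  and \<open>g p\<close> is integrated by the scaled Young inequality, and \<open>4 * CU\<close>
  bounds the third moment of the increment.\<close>

lemma corr_step: "norm (corr t (Suc k) p - corr t k (Suc p)) \<le> \<bar>t\<bar> * (\<beta> p * (4/3 * CU + 2/3))"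
proof -
  let ?U = "\<lambda>\<omega>. \<zeta> (X (Suc k) \<omega>) - \<theta> (X k \<omega>)"
  have i1: "integrable M (\<lambda>\<omega>. W t k \<omega> * g p (X (Suc k) \<omega>))"
    by (intro integrable_W_mult integrable_X integrable_g)
  have i2: "integrable M (\<lambda>\<omega>. W t (Suc k) \<omega> * g p (X (Suc k) \<omega>))"
    by (intro integrable_W_mult integrable_X integrable_g)
  have "corr t k (Suc p) = (\<integral>\<omega>. W t k \<omega> * (\<integral>y. (\<lambda>z. g p (snd z)) (X k \<omega>, y) \<partial>Q (X k \<omega>)) \<partial>M)"
    by (simp add: corr_def g_Suc)
  also have "\<dots> = (\<integral>\<omega>. W t k \<omega> * g p (X (Suc k) \<omega>) \<partial>M)"
    using i1 by (subst markov_property[symmetric]) (simp_all)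
  finally have "corr t (Suc k) p - corr t k (Suc p) = (\<integral>\<omega>. W t (Suc k) \<omega> * g p (X (Suc k) \<omega>) - W t k \<omega> * g p (X (Suc k) \<omega>) \<partial>M)"
    using i1 i2 by (simp add: corr_def)
  then have "norm (corr t (Suc k) p - corr t k (Suc p)) = norm (\<integral>\<omega>. W t (Suc k) \<omega> * g p (X (Suc k) \<omega>) - W t k \<omega> * g p (X (Suc k) \<omega>) \<partial>M)"
    by simp
  also have "\<dots> \<le> (\<integral>\<omega>. \<bar>t\<bar> * (\<beta> p * ((4 * (\<bar>\<zeta> (X (Suc k) \<omega>)\<bar> ^ 3 + \<bar>\<theta> (X k \<omega>)\<bar> ^ 3)) / 3
      + 2/3 * (norm (g p (X (Suc k) \<omega>)) powr (3/2) / \<beta> p powr (3/2)))) \<partial>M)" (is "_ \<le> (\<integral>\<omega>. ?R \<omega> \<partial>M)")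
  proof (rule norm_integral_le_integral)
    show "integrable M (\<lambda>\<omega>. W t (Suc k) \<omega> * g p (X (Suc k) \<omega>) - W t k \<omega> * g p (X (Suc k) \<omega>))"
      by (intro Bochner_Integration.integrable_diff i1 i2)
    show "integrable M ?R"
      using integrable_X[OF \<zeta>3, of "Suc k"] integrable_X[OF \<theta>3, of k] integrable_X[OF g_integrable, of p "Suc k"]
      by (intro integrable_mult_right Bochner_Integration.integrable_add integrable_divide)
    fix \<omega>
    have "norm (W t (Suc k) \<omega> * g p (X (Suc k) \<omega>) - W t k \<omega> * g p (X (Suc k) \<omega>))
      = norm (W t (Suc k) \<omega> - W t k \<omega>) * norm (g p (X (Suc k) \<omega>))"
      by (simp add: norm_mult[symmetric] algebra_simps)
    also have "\<dots> \<le> \<bar>t * D (Suc k) \<omega> - t * D k \<omega>\<bar> * norm (g p (X (Suc k) \<omega>))"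
      unfolding W_def by (intro mult_right_mono iexp_first_order) auto
    also have "\<dots> = \<bar>t\<bar> * (\<bar>?U \<omega>\<bar> * norm (g p (X (Suc k) \<omega>)))"
      by (simp add: D_def abs_mult right_diff_distrib[symmetric])
    also have "\<dots> \<le> \<bar>t\<bar> * (\<beta> p * (\<bar>?U \<omega>\<bar> ^ 3 / 3 + 2/3 * (norm (g p (X (Suc k) \<omega>)) powr (3/2) / \<beta> p powr (3/2))))"
      by (intro mult_left_mono young_three_halves \<beta>_pos) auto
    also have "\<dots> \<le> ?R \<omega>"
      using \<beta>_pos[of p] by (intro mult_left_mono add_mono divide_right_mono cube_diff_le order_refl) auto
    finally show "norm (W t (Suc k) \<omega> * g p (X (Suc k) \<omega>) - W t k \<omega> * g p (X (Suc k) \<omega>)) \<le> ?R \<omega>" .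
  qed
  finally have le: "norm (corr t (Suc k) p - corr t k (Suc p)) \<le> (\<integral>\<omega>. ?R \<omega> \<partial>M)" .
  have "(\<integral>\<omega>. ?R \<omega> \<partial>M) = \<bar>t\<bar> * (\<beta> p * (4 * CU / 3 + 2/3 * ((\<integral>x. norm (g p x) powr (3/2) \<partial>\<nu>) / \<beta> p powr (3/2))))"
  proof (rule has_bochner_integral_integral_eq)
    have hb: "has_bochner_integral M (\<lambda>\<omega>. f (X n \<omega>)) (\<integral>x. f x \<partial>\<nu>)" if "integrable \<nu> f" for f :: "'a \<Rightarrow> real" and n
      using integrable_X[OF that] integral_X[OF that] by (simp add: has_bochner_integral_iff)
    show "has_bochner_integral M ?R (\<bar>t\<bar> * (\<beta> p * (4 * CU / 3 + 2/3 * ((\<integral>x. norm (g p x) powr (3/2) \<partial>\<nu>) / \<beta> p powr (3/2)))))"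
      unfolding CU_def
      by (intro has_bochner_integral_mult_right has_bochner_integral_add has_bochner_integral_divide
          hb[OF \<zeta>3] hb[OF \<theta>3] hb[OF g_integrable])
  qed
  also have "\<dots> \<le> \<bar>t\<bar> * (\<beta> p * (4 * CU / 3 + 2/3 * 1))"
    using g_le[of p] \<beta>_pos[of p] by (intro mult_left_mono add_mono order_refl) (auto simp: divide_le_eq)
  also have "\<dots> = \<bar>t\<bar> * (\<beta> p * (4/3 * CU + 2/3))"
    by simp
  finally show ?thesis using le by linarith
qed

text \<open>Time decreases and \<open>p\<close> increases until time 0, where \<open>corr\<close>
  vanishes. The costs add up to a partial sum of \<open>\<beta>\<close>, which is how the
  summability in (H2) enters.\<close>

lemma corr_bound: "norm (corr t k p) \<le> \<bar>t\<bar> * ((\<Sum>j<k. \<beta> (p + j)) * (4/3 * CU + 2/3))"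
proof (induction k arbitrary: p)
  case 0
  show ?case by (simp add: corr_0)
next
  case (Suc k)
  have "norm (corr t (Suc k) p) \<le> norm (corr t (Suc k) p - corr t k (Suc p)) + norm (corr t k (Suc p))"
    using norm_triangle_ineq[of "corr t (Suc k) p - corr t k (Suc p)" "corr t k (Suc p)"] by simp
  also have "\<dots> \<le> \<bar>t\<bar> * (\<beta> p * (4/3 * CU + 2/3)) + \<bar>t\<bar> * ((\<Sum>j<k. \<beta> (Suc p + j)) * (4/3 * CU + 2/3))"
    by (intro add_mono corr_step Suc)
  also have "\<dots> = \<bar>t\<bar> * ((\<beta> p + (\<Sum>j<k. \<beta> (Suc p + j))) * (4/3 * CU + 2/3))"
    by (simp add: algebra_simps)
  also have "\<beta> p + (\<Sum>j<k. \<beta> (Suc p + j)) = (\<Sum>j<Suc k. \<beta> (p + j))"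
    by (subst sum.lessThan_Suc_shift) simp
  finally show ?case .
qed

section \<open>One-step expansion and the martingale estimate\<close>

definition "cond_char t x = (\<integral>y. iexp (t * (\<zeta> y - \<theta> x)) \<partial>Q x)"

text \<open>Second-order Taylor expansion under \<open>Q x\<close>. The linear term disappears
  because \<open>\<theta> x\<close> is the mean of \<open>\<zeta>\<close>, and the quadratic term is
  the conditional variance, equal to \<open>s2 + g 0 x\<close>. The factor \<open>2/3\<close> is
  \<open>1/6\<close> from Taylor times 4 from \<open>cube_diff_le\<close>.\<close>

lemma cond_char_approx:
  "AE x in \<nu>. norm (cond_char t x - (1 - complex_of_real (t\<^sup>2 / 2) * (s2 + g 0 x))) \<le> \<bar>t\<bar> ^ 3 * (2/3 * ((\<integral>y. \<bar>\<zeta> y\<bar> ^ 3 \<partial>Q x) + \<bar>\<theta> x\<bar> ^ 3))"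
  using AE_integrable_Q[OF \<zeta>3] \<theta>_eq g_0 AE_space
proof eventually_elim
  case (elim x)
  then have x: "x \<in> space E" by (simp add: space_\<nu>)
  interpret Qx: prob_space "Q x" by (rule Q_prob[OF x])
  have mQ [measurable]: "\<zeta> \<in> borel_measurable (Q x)"
    by (subst measurable_cong_sets[OF Q_sets[OF x] refl]) simp
  let ?U = "\<lambda>y. \<zeta> y - \<theta> x"
  have i1: "integrable (Q x) \<zeta>" and i2: "integrable (Q x) (\<lambda>y. (\<zeta> y)\<^sup>2)"
  proof -
    have b: "integrable (Q x) (\<lambda>y. 1 + \<bar>\<zeta> y\<bar> ^ 3)" using elim(1) by simp
    show "integrable (Q x) \<zeta>"
      by (rule Bochner_Integration.integrable_bound[OF b]) (auto simp: le_one_plus_cube intro!: AE_I2)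
    show "integrable (Q x) (\<lambda>y. (\<zeta> y)\<^sup>2)"
      using le_one_plus_cube(2)[of "\<bar>\<zeta> y\<bar>" for y]
      by (intro Bochner_Integration.integrable_bound[OF b]) (auto intro!: AE_I2)
  qed
  have U1: "integrable (Q x) ?U" "(\<integral>y. ?U y \<partial>Q x) = 0"
    using i1 elim(2) Qx.prob_space by auto
  have U2: "integrable (Q x) (\<lambda>y. (?U y)\<^sup>2)" "(\<integral>y. (?U y)\<^sup>2 \<partial>Q x) = (\<integral>y. (\<zeta> y)\<^sup>2 \<partial>Q x) - (\<theta> x)\<^sup>2"
    unfolding power2_diff using i1 i2 elim(2)[symmetric] Qx.prob_space by (auto simp: power2_eq_square)
  have i3: "integrable (Q x) (\<lambda>y. iexp (t * ?U y))"
    by (intro Qx.integrable_const_bound[where B=1]) auto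
  have j1: "integrable (Q x) (\<lambda>y. 1 :: complex)" by simp
  have j2: "integrable (Q x) (\<lambda>y. \<i> * complex_of_real (t * ?U y))"
    by (rule integrable_mult_right[OF integrable_of_real[OF integrable_mult_right[OF U1(1)]]])
  have j3: "integrable (Q x) (\<lambda>y. complex_of_real ((t * ?U y)\<^sup>2) / 2)"
    using U2(1) unfolding power_mult_distrib by (intro integrable_divide integrable_of_real integrable_mult_right)
  have i4: "integrable (Q x) (\<lambda>y. 1 + \<i> * complex_of_real (t * ?U y) - complex_of_real ((t * ?U y)\<^sup>2) / 2)"
    by (rule Bochner_Integration.integrable_diff[OF Bochner_Integration.integrable_add[OF j1 j2] j3])
  have "(\<integral>y. 1 + \<i> * complex_of_real (t * ?U y) - complex_of_real ((t * ?U y)\<^sup>2) / 2 \<partial>Q x)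
      = 1 + \<i> * complex_of_real (t * (\<integral>y. ?U y \<partial>Q x)) - complex_of_real (t\<^sup>2 * (\<integral>y. (?U y)\<^sup>2 \<partial>Q x)) / 2"
    unfolding Bochner_Integration.integral_diff[OF Bochner_Integration.integrable_add[OF j1 j2] j3]
      Bochner_Integration.integral_add[OF j1 j2]
    unfolding power_mult_distrib integral_mult_right_zero integral_divide_zero integral_complex_of_real
    using Qx.prob_space by simp
  also have "\<dots> = 1 - complex_of_real (t\<^sup>2 / 2) * (s2 + g 0 x)"
    unfolding U1 U2 elim(3) by simp
  finally have "cond_char t x - (1 - complex_of_real (t\<^sup>2 / 2) * (s2 + g 0 x))
    = (\<integral>y. iexp (t * ?U y) - (1 + \<i> * complex_of_real (t * ?U y) - complex_of_real ((t * ?U y)\<^sup>2) / 2) \<partial>Q x)"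
    using i3 i4 by (simp add: cond_char_def)
  also have "norm \<dots> \<le> (\<integral>y. \<bar>t\<bar> ^ 3 * (2/3 * (\<bar>\<zeta> y\<bar> ^ 3 + \<bar>\<theta> x\<bar> ^ 3)) \<partial>Q x)"
  proof (rule norm_integral_le_integral)
    show "integrable (Q x) (\<lambda>y. \<bar>t\<bar> ^ 3 * (2/3 * (\<bar>\<zeta> y\<bar> ^ 3 + \<bar>\<theta> x\<bar> ^ 3)))"
      using elim(1) by simp
    fix y
    have "norm (iexp (t * ?U y) - (1 + \<i> * complex_of_real (t * ?U y) - complex_of_real ((t * ?U y)\<^sup>2) / 2)) \<le> \<bar>t * ?U y\<bar> ^ 3 / 6"
      using iexp_second_order[of "t * ?U y"] by simp
    also have "\<dots> = \<bar>t\<bar> ^ 3 * (1/6 * \<bar>?U y\<bar> ^ 3)"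
      by (simp add: abs_mult power_mult_distrib)
    also have "\<dots> \<le> \<bar>t\<bar> ^ 3 * (1/6 * (4 * (\<bar>\<zeta> y\<bar> ^ 3 + \<bar>\<theta> x\<bar> ^ 3)))"
      by (intro mult_left_mono cube_diff_le) auto
    also have "\<dots> = \<bar>t\<bar> ^ 3 * (2/3 * (\<bar>\<zeta> y\<bar> ^ 3 + \<bar>\<theta> x\<bar> ^ 3))"
      by simp
    finally show "norm (iexp (t * ?U y) - (1 + \<i> * complex_of_real (t * ?U y) - complex_of_real ((t * ?U y)\<^sup>2) / 2))
        \<le> \<bar>t\<bar> ^ 3 * (2/3 * (\<bar>\<zeta> y\<bar> ^ 3 + \<bar>\<theta> x\<bar> ^ 3))" .
  qed (intro Bochner_Integration.integrable_diff i3 i4)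
  also have "\<dots> = \<bar>t\<bar> ^ 3 * (2/3 * ((\<integral>y. \<bar>\<zeta> y\<bar> ^ 3 \<partial>Q x) + \<bar>\<theta> x\<bar> ^ 3))"
    using elim(1) Qx.prob_space by simp
  finally show ?case .
qed

definition "B0 = (\<Sum>p. \<beta> p) * (4/3 * CU + 2/3)"

text \<open>In order: the Taylor remainder, the correlation term
  \<open>t^2 / 2 * corr t k 0\<close>, and the replacement of \<open>1 - s2 * t^2 / 2\<close> by the
  exponential.\<close>

definition "KW = 2/3 * CU + B0 / 2 + s2\<^sup>2 / 8"

lemma B0_nonneg: "0 \<le> B0"
  unfolding B0_def using CU_nonneg \<beta>_summable \<beta>_pos by (intro mult_nonneg_nonneg suminf_nonneg less_imp_le) auto

text \<open>Multiplying the expectation by the Gaussian factor is correct up to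
  \<open>O(t^3)\<close>: the random part of the conditional variance appears with
  \<open>t^2 / 2\<close> in front, and \<open>corr_bound\<close> supplies the missing power of
  \<open>t\<close>.\<close>

lemma W_step:
  assumes t: "\<bar>t\<bar> \<le> 1"
  shows "norm ((\<integral>\<omega>. W t (Suc k) \<omega> \<partial>M) - exp (- s2 * t\<^sup>2 / 2) * (\<integral>\<omega>. W t k \<omega> \<partial>M)) \<le> KW * \<bar>t\<bar> ^ 3"
proof -
  let ?\<gamma> = "complex_of_real (exp (- s2 * t\<^sup>2 / 2))"
  have tri: "norm (u + v - w) \<le> norm u + norm v + norm w" for u v w :: complex
    using norm_triangle_ineq4[of "u + v" w] norm_triangle_ineq[of u v] by linarith
  have [measurable]: "cond_char t \<in> borel_measurable E"
  proof -
    have "cond_char t = (\<lambda>x. iexp (- (t * \<theta> x)) * (\<integral>y. iexp (t * \<zeta> y) \<partial>Q x))"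
      unfolding cond_char_def integral_mult_right_zero[symmetric]
      by (intro ext Bochner_Integration.integral_cong refl) (simp add: mult_exp_exp algebra_simps)
    then show ?thesis by simp
  qed
  have iW: "integrable M (W t n)" for n
    by (intro M.integrable_const_bound[where B=1]) auto
  have cX: "AE \<omega> in M. norm (cond_char t (X k \<omega>) - (1 - complex_of_real (t\<^sup>2 / 2) * (s2 + g 0 (X k \<omega>))))
       \<le> \<bar>t\<bar> ^ 3 * (2/3 * ((\<integral>y. \<bar>\<zeta> y\<bar> ^ 3 \<partial>Q (X k \<omega>)) + \<bar>\<theta> (X k \<omega>)\<bar> ^ 3))"
    by (rule AE_X[OF cond_char_approx])
  let ?R = "\<lambda>x. \<bar>t\<bar> ^ 3 * (2/3 * ((\<integral>y. \<bar>\<zeta> y\<bar> ^ 3 \<partial>Q x) + \<bar>\<theta> x\<bar> ^ 3))"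
  have R: "integrable \<nu> ?R" "(\<integral>x. ?R x \<partial>\<nu>) = \<bar>t\<bar> ^ 3 * (2/3 * CU)"
    using integrable_Q_integral[OF \<zeta>3] \<theta>3 integral_Q_integral[OF \<zeta>3] by (auto simp: CU_def)
  let ?d = "\<lambda>\<omega>. cond_char t (X k \<omega>) - (1 - complex_of_real (t\<^sup>2 / 2) * (s2 + g 0 (X k \<omega>)))"
  have id: "integrable M ?d"
    by (rule Bochner_Integration.integrable_bound[OF integrable_X[OF R(1)]])
      (use cX in \<open>auto elim!: eventually_mono intro: order_trans[OF _ abs_ge_self]\<close>)
  have "(\<integral>\<omega>. W t (Suc k) \<omega> \<partial>M) = (\<integral>\<omega>. W t k \<omega> * (\<lambda>z. iexp (t * (\<zeta> (snd z) - \<theta> (fst z)))) (X k \<omega>, X (Suc k) \<omega>) \<partial>M)"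
    by (simp add: W_Suc)
  also have "\<dots> = (\<integral>\<omega>. W t k \<omega> * cond_char t (X k \<omega>) \<partial>M)"
  proof (subst markov_property)
    show "integrable M (\<lambda>\<omega>. W t k \<omega> * iexp (t * (\<zeta> (snd (X k \<omega>, X (Suc k) \<omega>)) - \<theta> (fst (X k \<omega>, X (Suc k) \<omega>)))))"
      using iW[of "Suc k"] unfolding W_Suc [abs_def] by simp
  qed (simp_all add: cond_char_def)
  \<comment> \<open>The integrand is split into the Taylor error, the deterministic part of the
    conditional variance, and its centred fluctuation.\<close>
  also have "\<dots> = (\<integral>\<omega>. W t k \<omega> * ?d \<omega> + complex_of_real (1 - t\<^sup>2 / 2 * s2) * W t k \<omega> - complex_of_real (t\<^sup>2 / 2) * (W t k \<omega> * g 0 (X k \<omega>)) \<partial>M)"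
    by (intro Bochner_Integration.integral_cong refl) (simp add: algebra_simps)
  also have "\<dots> = (\<integral>\<omega>. W t k \<omega> * ?d \<omega> \<partial>M) + complex_of_real (1 - t\<^sup>2 / 2 * s2) * (\<integral>\<omega>. W t k \<omega> \<partial>M) - complex_of_real (t\<^sup>2 / 2) * corr t k 0"
  proof -
    have j1: "integrable M (\<lambda>\<omega>. W t k \<omega> * ?d \<omega>)" by (rule integrable_W_mult[OF id])
    have j2: "integrable M (\<lambda>\<omega>. complex_of_real (1 - t\<^sup>2 / 2 * s2) * W t k \<omega>)" by (intro integrable_mult_right iW)
    have j3: "integrable M (\<lambda>\<omega>. complex_of_real (t\<^sup>2 / 2) * (W t k \<omega> * g 0 (X k \<omega>)))"
      by (intro integrable_mult_right integrable_W_mult integrable_X integrable_g)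
    show ?thesis
      unfolding Bochner_Integration.integral_diff[OF Bochner_Integration.integrable_add[OF j1 j2] j3]
        Bochner_Integration.integral_add[OF j1 j2] integral_mult_right_zero corr_def ..
  qed
  finally have W_eq: "(\<integral>\<omega>. W t (Suc k) \<omega> \<partial>M) = (\<integral>\<omega>. W t k \<omega> * ?d \<omega> \<partial>M)
     + complex_of_real (1 - t\<^sup>2 / 2 * s2) * (\<integral>\<omega>. W t k \<omega> \<partial>M) - complex_of_real (t\<^sup>2 / 2) * corr t k 0" .
  define A1 where "A1 = (\<integral>\<omega>. W t k \<omega> * ?d \<omega> \<partial>M)"
  define A2 where "A2 = complex_of_real (1 - t\<^sup>2 / 2 * s2 - exp (- s2 * t\<^sup>2 / 2)) * (\<integral>\<omega>. W t k \<omega> \<partial>M)"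
  define A3 where "A3 = complex_of_real (t\<^sup>2 / 2) * corr t k 0"
  have "(\<integral>\<omega>. W t (Suc k) \<omega> \<partial>M) - ?\<gamma> * (\<integral>\<omega>. W t k \<omega> \<partial>M) = A1 + A2 - A3"
    unfolding W_eq A1_def[symmetric] A3_def[symmetric] by (simp add: A2_def algebra_simps)
  then have W_le: "norm ((\<integral>\<omega>. W t (Suc k) \<omega> \<partial>M) - ?\<gamma> * (\<integral>\<omega>. W t k \<omega> \<partial>M)) \<le> norm A1 + norm A2 + norm A3"
    by (simp only: tri)
  have A_le: "norm A1 + norm A2 + norm A3 \<le> \<bar>t\<bar> ^ 3 * (2/3 * CU) + s2\<^sup>2 / 8 * \<bar>t\<bar> ^ 3 + \<bar>t\<bar> ^ 3 * (B0 / 2)"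
  proof (intro add_mono)
    have "norm A1 \<le> (\<integral>\<omega>. norm (W t k \<omega> * ?d \<omega>) \<partial>M)"
      unfolding A1_def by (rule integral_norm_bound)
    also have "\<dots> \<le> (\<integral>\<omega>. ?R (X k \<omega>) \<partial>M)"
    proof (intro integral_mono_AE integrable_norm integrable_W_mult[OF id] integrable_X[OF R(1)])
      show "AE \<omega> in M. norm (W t k \<omega> * ?d \<omega>) \<le> ?R (X k \<omega>)"
        using cX by eventually_elim (simp add: norm_mult)
    qed
    also have "\<dots> = \<bar>t\<bar> ^ 3 * (2/3 * CU)"
      by (rule trans[OF integral_X[OF R(1)] R(2)])
    finally show "norm A1 \<le> \<bar>t\<bar> ^ 3 * (2/3 * CU)" .
  next
    have W1: "norm (\<integral>\<omega>. W t k \<omega> \<partial>M) \<le> 1"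
      using integral_norm_bound[of M "W t k"] M.prob_space by simp
    have "\<bar>1 - t\<^sup>2 / 2 * s2 - exp (- s2 * t\<^sup>2 / 2)\<bar> \<le> (s2 * t\<^sup>2 / 2)\<^sup>2 / 2"
      using exp_minus_linear_bound[of "s2 * t\<^sup>2 / 2"] s2_nonneg by (simp add: abs_minus_commute mult.commute)
    also have "\<dots> = s2\<^sup>2 / 8 * \<bar>t\<bar> ^ 4"
      by (simp add: power_mult_distrib power_divide power2_eq_square power4_eq_xxxx)
    \<comment> \<open>The natural order here is \<open>t^4\<close>; since
      \<open>\<bar>t\<bar> \<le> 1\<close>, one power is given up to match the other two
      errors.\<close>
    also have "\<dots> \<le> s2\<^sup>2 / 8 * \<bar>t\<bar> ^ 3"
      using t by (intro mult_left_mono power_decreasing) auto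
    finally show "norm A2 \<le> s2\<^sup>2 / 8 * \<bar>t\<bar> ^ 3"
      unfolding A2_def norm_mult norm_of_real using W1 mult_mono[of _ "s2\<^sup>2 / 8 * \<bar>t\<bar> ^ 3" "norm (\<integral>\<omega>. W t k \<omega> \<partial>M)" 1] by simp
  next
    have "norm (corr t k 0) \<le> \<bar>t\<bar> * B0"
    proof (rule order_trans[OF corr_bound])
      show "\<bar>t\<bar> * ((\<Sum>j<k. \<beta> (0 + j)) * (4 / 3 * CU + 2 / 3)) \<le> \<bar>t\<bar> * B0"
      proof -
        have "(\<Sum>j<k. \<beta> (0 + j)) \<le> (\<Sum>p. \<beta> p)"
          unfolding add_0 using \<beta>_pos by (intro sum_le_suminf \<beta>_summable less_imp_le) auto
        then show ?thesis
          unfolding B0_def using CU_nonneg by (intro mult_left_mono mult_right_mono) auto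
      qed
    qed
    then have "t\<^sup>2 / 2 * norm (corr t k 0) \<le> t\<^sup>2 / 2 * (\<bar>t\<bar> * B0)"
      by (intro mult_left_mono) auto
    also have "\<dots> = \<bar>t\<bar> ^ 3 * (B0 / 2)"
      unfolding power2_abs[of t, symmetric] by (simp add: power2_eq_square power3_eq_cube del: abs_mult_self_eq)
    finally show "norm A3 \<le> \<bar>t\<bar> ^ 3 * (B0 / 2)"
      by (simp add: A3_def norm_mult norm_power norm_divide)
  qed
  have "\<bar>t\<bar> ^ 3 * (2/3 * CU) + s2\<^sup>2 / 8 * \<bar>t\<bar> ^ 3 + \<bar>t\<bar> ^ 3 * (B0 / 2) = KW * \<bar>t\<bar> ^ 3"
    by (simp add: KW_def algebra_simps)
  with order_trans[OF W_le A_le] show ?thesis by simp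
qed

lemma W_near_gaussian:
  assumes t: "\<bar>t\<bar> \<le> 1"
  shows "norm ((\<integral>\<omega>. W t n \<omega> \<partial>M) - exp (- s2 * t\<^sup>2 / 2) ^ n) \<le> real n * (KW * \<bar>t\<bar> ^ 3)"
proof (induction n)
  case 0
  show ?case using M.prob_space by simp
next
  case (Suc n)
  let ?\<gamma> = "exp (- s2 * t\<^sup>2 / 2)"
  let ?w = "\<lambda>n. (\<integral>\<omega>. W t n \<omega> \<partial>M)"
  have "?w (Suc n) - complex_of_real (?\<gamma> ^ Suc n) = (?w (Suc n) - ?\<gamma> * ?w n) + ?\<gamma> * (?w n - complex_of_real (?\<gamma> ^ n))"
    by (simp add: algebra_simps)
  also have "norm \<dots> \<le> norm (?w (Suc n) - ?\<gamma> * ?w n) + ?\<gamma> * norm (?w n - complex_of_real (?\<gamma> ^ n))"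
    by (rule order_trans[OF norm_triangle_ineq]) (simp add: norm_mult)
  also have "\<dots> \<le> KW * \<bar>t\<bar> ^ 3 + 1 * (real n * (KW * \<bar>t\<bar> ^ 3))"
    using s2_nonneg Suc by (intro add_mono W_step t mult_mono) (auto simp: mult_nonneg_nonneg)
  finally show ?case by (simp add: algebra_simps)
qed

definition "KM = KW + 2 * (\<integral>x. \<bar>\<theta> x\<bar> \<partial>\<nu>)"

text \<open>The sum differs from the martingale by the telescoping boundary term
  \<open>\<theta> (X 0) - \<theta> (X n)\<close>, which costs \<open>O(t)\<close> by stationarity
  whatever \<open>n\<close> is. The error carries no factor decaying in \<open>n * t^2\<close>; the
  operator estimate will provide it.\<close>

theorem char_near_gaussian:
  assumes t: "\<bar>t\<bar> \<le> 1"
  shows "norm ((\<integral>\<omega>. iexp (t * (\<Sum>k=1..n. \<xi> (X k \<omega>))) \<partial>M) - exp (- s2 * t\<^sup>2 / 2) ^ n) \<le> KM * (\<bar>t\<bar> + real n * \<bar>t\<bar> ^ 3)"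
proof -
  let ?S = "\<lambda>\<omega>. \<Sum>k=1..n. \<xi> (X k \<omega>)"
  have \<theta>1: "integrable \<nu> (\<lambda>x. \<bar>\<theta> x\<bar>)"
  proof (rule Bochner_Integration.integrable_bound)
    show "integrable \<nu> (\<lambda>x. 1 + \<bar>\<theta> x\<bar> ^ 3)" using \<theta>3 by simp
  qed (auto simp: le_one_plus_cube intro!: AE_I2)
  have i1: "integrable M (\<lambda>\<omega>. iexp (t * ?S \<omega>))" and i2: "integrable M (W t n)"
    by (intro M.integrable_const_bound[where B=1]; simp)+
  have "AE \<omega> in M. \<forall>k. \<xi> (X k \<omega>) = \<zeta> (X k \<omega>) - \<theta> (X k \<omega>)"
    unfolding AE_all_countable using AE_X[OF poisson] by simp
  then have ae: "AE \<omega> in M. norm (iexp (t * ?S \<omega>) - W t n \<omega>) \<le> \<bar>t\<bar> * (\<bar>\<theta> (X 0 \<omega>)\<bar> + \<bar>\<theta> (X n \<omega>)\<bar>)"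
  proof eventually_elim
    case (elim \<omega>)
    have "?S \<omega> = (\<Sum>k<n. \<xi> (X (Suc k) \<omega>))"
      by (simp add: sum.atLeast1_atMost_eq)
    also have "\<dots> = D n \<omega> - (\<Sum>k<n. \<theta> (X (Suc k) \<omega>) - \<theta> (X k \<omega>))"
      by (simp add: D_def elim sum_subtractf)
    also have "\<dots> = D n \<omega> + \<theta> (X 0 \<omega>) - \<theta> (X n \<omega>)"
      using sum_lessThan_telescope[of "\<lambda>k. \<theta> (X k \<omega>)" n] by simp
    finally have S: "?S \<omega> = D n \<omega> + \<theta> (X 0 \<omega>) - \<theta> (X n \<omega>)" .
    have "norm (iexp (t * ?S \<omega>) - W t n \<omega>) \<le> \<bar>t * ?S \<omega> - t * D n \<omega>\<bar>"
      unfolding W_def by (rule iexp_first_order)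
    also have "\<dots> = \<bar>t\<bar> * \<bar>\<theta> (X 0 \<omega>) - \<theta> (X n \<omega>)\<bar>"
      unfolding S by (simp add: abs_mult right_diff_distrib[symmetric])
    also have "\<dots> \<le> \<bar>t\<bar> * (\<bar>\<theta> (X 0 \<omega>)\<bar> + \<bar>\<theta> (X n \<omega>)\<bar>)"
      by (intro mult_left_mono abs_triangle_ineq4) auto
    finally show ?case .
  qed
  have "norm ((\<integral>\<omega>. iexp (t * ?S \<omega>) \<partial>M) - (\<integral>\<omega>. W t n \<omega> \<partial>M)) = norm (\<integral>\<omega>. iexp (t * ?S \<omega>) - W t n \<omega> \<partial>M)"
    using i1 i2 by simp
  also have "\<dots> \<le> (\<integral>\<omega>. norm (iexp (t * ?S \<omega>) - W t n \<omega>) \<partial>M)"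
    by (rule integral_norm_bound)
  also have "\<dots> \<le> (\<integral>\<omega>. \<bar>t\<bar> * (\<bar>\<theta> (X 0 \<omega>)\<bar> + \<bar>\<theta> (X n \<omega>)\<bar>) \<partial>M)"
    using ae i1 i2 integrable_X[OF \<theta>1]
    by (intro integral_mono_AE integrable_norm Bochner_Integration.integrable_diff integrable_mult_right Bochner_Integration.integrable_add) auto
  also have "\<dots> = 2 * (\<integral>x. \<bar>\<theta> x\<bar> \<partial>\<nu>) * \<bar>t\<bar>"
    using integrable_X[OF \<theta>1] integral_X[OF \<theta>1] by simp
  finally have d: "norm ((\<integral>\<omega>. iexp (t * ?S \<omega>) \<partial>M) - (\<integral>\<omega>. W t n \<omega> \<partial>M)) \<le> 2 * (\<integral>x. \<bar>\<theta> x\<bar> \<partial>\<nu>) * \<bar>t\<bar>" .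
  have "norm ((\<integral>\<omega>. iexp (t * ?S \<omega>) \<partial>M) - exp (- s2 * t\<^sup>2 / 2) ^ n)
     \<le> 2 * (\<integral>x. \<bar>\<theta> x\<bar> \<partial>\<nu>) * \<bar>t\<bar> + real n * (KW * \<bar>t\<bar> ^ 3)"
    using norm_triangle_mono[OF d W_near_gaussian[OF t, of n]] by simp
  also have "\<dots> \<le> KM * \<bar>t\<bar> + KM * (real n * \<bar>t\<bar> ^ 3)"
  proof (intro add_mono)
    have "0 \<le> KW" using CU_nonneg B0_nonneg by (simp add: KW_def)
    then show "2 * (\<integral>x. \<bar>\<theta> x\<bar> \<partial>\<nu>) * \<bar>t\<bar> \<le> KM * \<bar>t\<bar>"
      by (intro mult_right_mono) (auto simp: KM_def)
    have "KW * (real n * \<bar>t\<bar> ^ 3) \<le> KM * (real n * \<bar>t\<bar> ^ 3)"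
      by (intro mult_right_mono) (auto simp: KM_def)
    then show "real n * (KW * \<bar>t\<bar> ^ 3) \<le> KM * (real n * \<bar>t\<bar> ^ 3)"
      by (simp add: mult_ac)
  qed
  finally show ?thesis by (simp add: algebra_simps)
qed

end

section \<open>Perturbation of an operator in a weak norm\<close>

lemma geometric_partial_sum_le:
  fixes \<rho> :: real
  assumes "0 \<le> \<rho>" "\<rho> < 1"
  shows "(\<Sum>j<k. \<rho> ^ j) \<le> 1 / (1 - \<rho>)"
proof -
  have "(\<Sum>j<k. \<rho> ^ j) \<le> (\<Sum>j. \<rho> ^ j)"
    using assms by (intro sum_le_suminf summable_geometric) auto
  also have "(\<Sum>j. \<rho> ^ j) = 1 / (1 - \<rho>)"
    using assms by (intro suminf_geometric) auto
  finally show ?thesis .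
qed

lemma geometric_increments_limit:
  fixes r :: "nat \<Rightarrow> complex"
  assumes r: "\<And>n. norm (r (Suc n) - r n) \<le> c * \<rho> ^ n" and \<rho>: "0 \<le> \<rho>" "\<rho> < 1"
  obtains l where "r \<longlonglongrightarrow> l" "\<And>n. norm (r n - l) \<le> c * \<rho> ^ n / (1 - \<rho>)"
proof -
  have tail: "norm (r (n + k) - r n) \<le> c * \<rho> ^ n / (1 - \<rho>)" for n k
  proof -
    have c: "0 \<le> c" using order_trans[OF norm_ge_zero r[of 0]] by simp
    have "r (n + k) - r n = (\<Sum>j<k. r (Suc (n + j)) - r (n + j))"
      using sum_lessThan_telescope[of "\<lambda>j. r (n + j)" k] by simp
    also have "norm \<dots> \<le> (\<Sum>j<k. c * \<rho> ^ (n + j))"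
      by (intro sum_norm_le r)
    also have "\<dots> = c * \<rho> ^ n * (\<Sum>j<k. \<rho> ^ j)"
      by (simp add: sum_distrib_left power_add mult.assoc)
    also have "\<dots> \<le> c * \<rho> ^ n * (1 / (1 - \<rho>))"
      using c \<rho> geometric_partial_sum_le[OF \<rho>] by (intro mult_left_mono) auto
    finally show ?thesis by simp
  qed
  have "summable (\<lambda>n. r (Suc n) - r n)"
  proof (rule summable_comparison_test'[where N=0 and g="\<lambda>n. c * \<rho> ^ n"])
    show "summable (\<lambda>n. c * \<rho> ^ n)"
      using \<rho> by (intro summable_mult summable_geometric) simp
  qed (rule r)
  then have "convergent (\<lambda>n. \<Sum>k<n. r (Suc k) - r k)"
    by (simp add: summable_iff_convergent)
  then obtain s where "(\<lambda>n. \<Sum>k<n. r (Suc k) - r k) \<longlonglongrightarrow> s"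
    by (auto simp: convergent_def)
  then have "(\<lambda>n. r 0 + (r n - r 0)) \<longlonglongrightarrow> r 0 + s"
    by (intro tendsto_add tendsto_const) (simp add: sum_lessThan_telescope)
  then have lim: "r \<longlonglongrightarrow> r 0 + s" by simp
  have "norm (r n - (r 0 + s)) \<le> c * \<rho> ^ n / (1 - \<rho>)" for n
  proof -
    have "(\<lambda>k. norm (r (n + k) - r n)) \<longlonglongrightarrow> norm (r 0 + s - r n)"
      using LIMSEQ_ignore_initial_segment[OF lim, of n]
      by (intro tendsto_norm tendsto_diff tendsto_const) (simp add: add.commute)
    then have "norm (r 0 + s - r n) \<le> c * \<rho> ^ n / (1 - \<rho>)"
      by (rule LIMSEQ_le_const2) (simp add: tail)
    then show ?thesis by (simp add: norm_minus_commute)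
  qed
  with lim that show ?thesis by blast
qed

text \<open>With \<open>r k = l * (1 + e k)\<close> the sum of \<open>norm (e k)\<close> is at most
  \<open>x = c / (1 - \<rho>)\<close>, and the product of the \<open>1 + e k\<close> differs from 1
  by at most \<open>exp x - 1\<close>. The condition \<open>c \<le> 1 - \<rho>\<close> ensures
  \<open>x \<le> 1\<close>, where \<open>exp x - 1 \<le> 2 * x\<close>.\<close>

lemma prod_near_power:
  fixes r :: "nat \<Rightarrow> complex"
  assumes r: "\<And>k. norm (r k - l) \<le> c * \<rho> ^ k * norm l" and \<rho>: "0 \<le> \<rho>" "\<rho> < 1"
    and c: "0 \<le> c" "c \<le> 1 - \<rho>" and l: "l \<noteq> 0"
  shows "norm ((\<Prod>k<n. r k) - l ^ n) \<le> 2 * c / (1 - \<rho>) * norm l ^ n"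
proof -
  define e where "e k = r k / l - 1" for k
  have e: "norm (e k) \<le> c * \<rho> ^ k" for k
  proof -
    have "norm (e k) = norm (r k - l) / norm l"
      using l by (simp add: e_def norm_divide[symmetric] diff_divide_distrib)
    then show ?thesis
      using r[of k] l by (simp add: divide_le_eq)
  qed
  have "(\<Sum>k<n. norm (e k)) \<le> (\<Sum>k<n. c * \<rho> ^ k)"
    by (intro sum_mono e)
  also have "\<dots> = c * (\<Sum>k<n. \<rho> ^ k)"
    by (simp add: sum_distrib_left)
  also have "\<dots> \<le> c * (1 / (1 - \<rho>))"
    using c geometric_partial_sum_le[OF \<rho>] by (intro mult_left_mono) auto
  finally have s: "(\<Sum>k<n. norm (e k)) \<le> c / (1 - \<rho>)"
    by simp
  have "(\<Prod>k<n. r k) = l ^ n * (\<Prod>k<n. 1 + e k)"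
    using l by (simp add: e_def prod_dividef)
  then have "(\<Prod>k<n. r k) - l ^ n = l ^ n * ((\<Prod>k<n. 1 + e k) - 1)"
    by (simp add: algebra_simps)
  then have eq: "norm ((\<Prod>k<n. r k) - l ^ n) = norm l ^ n * norm ((\<Prod>k<n. 1 + e k) - 1)"
    by (simp add: norm_mult norm_power)
  have "norm ((\<Prod>k<n. 1 + e k) - 1) \<le> (\<Prod>k<n. 1 + norm (e k)) - 1"
    by (rule norm_prod_minus1_le_prod_minus1)
  also have "(\<Prod>k<n. 1 + norm (e k)) - 1 \<le> (1 + 2 * (c / (1 - \<rho>))) - 1"
  proof -
    have "(\<Prod>k<n. 1 + norm (e k)) \<le> (\<Prod>k<n. exp (norm (e k)))"
      by (intro prod_mono) auto
    also have "\<dots> = exp (\<Sum>k<n. norm (e k))"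
      by (simp add: exp_sum)
    also have "\<dots> \<le> exp (c / (1 - \<rho>))"
      using s by simp
    finally have le: "(\<Prod>k<n. 1 + norm (e k)) \<le> exp (c / (1 - \<rho>))" .
    have "0 \<le> c / (1 - \<rho>)" "c / (1 - \<rho>) \<le> 1"
      using c \<rho> by (auto simp: divide_simps)
    note le
    also have "exp (c / (1 - \<rho>)) \<le> 1 + c / (1 - \<rho>) + (c / (1 - \<rho>))\<^sup>2"
      using \<open>0 \<le> c / (1 - \<rho>)\<close> \<open>c / (1 - \<rho>) \<le> 1\<close> by (intro exp_bound) auto
    also have "(c / (1 - \<rho>))\<^sup>2 \<le> c / (1 - \<rho>)"
      using \<open>0 \<le> c / (1 - \<rho>)\<close> \<open>c / (1 - \<rho>) \<le> 1\<close> unfolding power2_eq_square by (rule mult_left_le[rotated])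
    finally show ?thesis by simp
  qed
  finally have "norm l ^ n * norm ((\<Prod>k<n. 1 + e k) - 1) \<le> norm l ^ n * (1 + 2 * (c / (1 - \<rho>)) - 1)"
    by (intro mult_left_mono) auto
  then show ?thesis
    unfolding eq by (simp add: mult_ac)
qed

text \<open>Halving over blocks of length \<open>p\<close> is decay at the rate
  \<open>\<rho>\<close> with \<open>\<rho>^p = 1/2\<close>; the factor 2 pays for the incomplete
  first block, on which \<open>\<rho>^n\<close> is at least \<open>1/2\<close>.\<close>

lemma block_geometric_decay:
  fixes x :: "nat \<Rightarrow> real"
  assumes p: "0 < p" and K: "\<And>n. x n \<le> K" "0 \<le> K" and half: "\<And>n. x (n + p) \<le> x n / 2"
    and \<rho>: "0 < \<rho>" "\<rho> < 1" "\<rho> ^ p = 1/2"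
  shows "x n \<le> 2 * K * \<rho> ^ n"
proof (induction n rule: less_induct)
  case (less n)
  show ?case
  proof (cases "n < p")
    case True
    have "1/2 \<le> \<rho> ^ n"
    proof -
      have "\<rho> ^ p \<le> \<rho> ^ n"
        using True \<rho> by (intro power_decreasing) auto
      with \<rho>(3) show ?thesis by simp
    qed
    then have "2 * K * (1/2) \<le> 2 * K * \<rho> ^ n"
      using K by (intro mult_left_mono) auto
    with K(1)[of n] show ?thesis by simp
  next
    case False
    define k where "k = n - p"
    have n: "n = k + p" "k < n"
      using False p by (auto simp: k_def)
    have "x n \<le> x k / 2"
      unfolding n(1) by (rule half)
    also have "\<dots> \<le> (2 * K * \<rho> ^ k) / 2"
      using less[OF n(2)] by simp
    also have "\<dots> = 2 * K * \<rho> ^ n"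
      by (simp add: n(1) power_add \<rho>(3))
    finally show ?thesis .
  qed
qed

section \<open>The abstract perturbation setting\<close>

definition linear_op :: "('a \<Rightarrow> complex) set \<Rightarrow> (('a \<Rightarrow> complex) \<Rightarrow> ('a \<Rightarrow> complex)) \<Rightarrow> bool" where
  "linear_op B T \<longleftrightarrow> (\<forall>f\<in>B. T f \<in> B) \<and>
     (\<forall>f\<in>B. \<forall>g\<in>B. T (\<lambda>x. f x + g x) = (\<lambda>x. T f x + T g x)) \<and>
     (\<forall>c. \<forall>f\<in>B. T (\<lambda>x. c * f x) = (\<lambda>x. c * T f x))"

text \<open>Here \<open>m\<close> and \<open>L\<close> stand for the integral and the \<open>L\<^sup>1\<close> seminorm, \<open>e\<close> for the constant function \<open>1\<close>,
  and \<open>P\<close> for the unperturbed operator.\<close>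

locale weak_perturbation =
  fixes B :: "('a \<Rightarrow> complex) set" and N L :: "('a \<Rightarrow> complex) \<Rightarrow> real" and m :: "('a \<Rightarrow> complex) \<Rightarrow> complex"
    and P :: "('a \<Rightarrow> complex) \<Rightarrow> ('a \<Rightarrow> complex)" and T :: "real \<Rightarrow> ('a \<Rightarrow> complex) \<Rightarrow> ('a \<Rightarrow> complex)"
    and e :: "'a \<Rightarrow> complex" and C C1 C3 \<kappa> \<delta>0 :: real
  assumes B_add: "f \<in> B \<Longrightarrow> g \<in> B \<Longrightarrow> (\<lambda>x. f x + g x) \<in> B"
    and B_scale: "f \<in> B \<Longrightarrow> (\<lambda>x. c * f x) \<in> B"
    and N_nonneg: "f \<in> B \<Longrightarrow> 0 \<le> N f"
    and N_add: "f \<in> B \<Longrightarrow> g \<in> B \<Longrightarrow> N (\<lambda>x. f x + g x) \<le> N f + N g"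
    and N_scale: "f \<in> B \<Longrightarrow> N (\<lambda>x. c * f x) = norm c * N f"
    and L_add: "f \<in> B \<Longrightarrow> g \<in> B \<Longrightarrow> L (\<lambda>x. f x + g x) \<le> L f + L g"
    and L_le: "f \<in> B \<Longrightarrow> L f \<le> C1 * N f"
    and m_add: "f \<in> B \<Longrightarrow> g \<in> B \<Longrightarrow> m (\<lambda>x. f x + g x) = m f + m g"
    and m_scale: "f \<in> B \<Longrightarrow> m (\<lambda>x. c * f x) = c * m f"
    and m_le: "f \<in> B \<Longrightarrow> norm (m f) \<le> L f"
    and e: "e \<in> B" "m e = 1"
    and P: "linear_op B P" and P_m: "f \<in> B \<Longrightarrow> m (P f) = m f" and P_L: "f \<in> B \<Longrightarrow> L (P f) \<le> L f"
    and P_N: "f \<in> B \<Longrightarrow> m f = 0 \<Longrightarrow> N ((P ^^ n) f) \<le> C * \<kappa> ^ n * N f"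
    and T: "\<bar>t\<bar> < \<delta>0 \<Longrightarrow> linear_op B (T t)"
    and T_N: "\<bar>t\<bar> < \<delta>0 \<Longrightarrow> f \<in> B \<Longrightarrow> N ((T t ^^ n) f) \<le> C * \<kappa> ^ n * N f + C * L f"
    and T_P: "\<bar>t\<bar> < \<delta>0 \<Longrightarrow> f \<in> B \<Longrightarrow> L (\<lambda>x. T t f x - P f x) \<le> C3 * \<bar>t\<bar> * N f"
    and const_bounds: "0 \<le> C" "0 \<le> C1" "0 \<le> C3" "0 \<le> \<kappa>" "\<kappa> < 1" "0 < \<delta>0"
begin

lemma B_diff: "f \<in> B \<Longrightarrow> g \<in> B \<Longrightarrow> (\<lambda>x. f x - g x) \<in> B"
  using B_add[OF _ B_scale[of g "-1"], of f] by simp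

lemma N_diff: "f \<in> B \<Longrightarrow> g \<in> B \<Longrightarrow> N (\<lambda>x. f x - g x) \<le> N f + N g"
  using N_add[OF _ B_scale[of g "-1"], of f] N_scale[of g "-1"] by simp

lemma m_diff: "f \<in> B \<Longrightarrow> g \<in> B \<Longrightarrow> m (\<lambda>x. f x - g x) = m f - m g"
  using m_add[OF _ B_scale[of g "-1"], of f] m_scale[of g "-1"] by simp

lemma linear_opD:
  assumes "linear_op B S" "f \<in> B"
  shows "S f \<in> B" "g \<in> B \<Longrightarrow> S (\<lambda>x. f x + g x) = (\<lambda>x. S f x + S g x)"
    "S (\<lambda>x. c * f x) = (\<lambda>x. c * S f x)" "g \<in> B \<Longrightarrow> S (\<lambda>x. f x - g x) = (\<lambda>x. S f x - S g x)"
proof -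
  show *: "S f \<in> B" "g \<in> B \<Longrightarrow> S (\<lambda>x. f x + g x) = (\<lambda>x. S f x + S g x)"
    "S (\<lambda>x. c * f x) = (\<lambda>x. c * S f x)" for g c
    using assms by (auto simp: linear_op_def)
  assume g: "g \<in> B"
  then have "S (\<lambda>x. f x + (-1) * g x) = (\<lambda>x. S f x + S (\<lambda>x. (-1) * g x) x)"
    using *(2)[OF B_scale[of g "-1"]] by simp
  also have "S (\<lambda>x. (-1) * g x) = (\<lambda>x. (-1) * S g x)"
    using assms g unfolding linear_op_def by blast
  finally show "S (\<lambda>x. f x - g x) = (\<lambda>x. S f x - S g x)"
    by simp
qed

lemma linear_op_funpow: "linear_op B S \<Longrightarrow> linear_op B (S ^^ n)"
  by (induction n) (auto simp: linear_op_def)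

lemma T_pow: "\<bar>t\<bar> < \<delta>0 \<Longrightarrow> linear_op B (T t ^^ n)"
  by (intro linear_op_funpow T)

lemma P_pow: "linear_op B (P ^^ n)"
  by (intro linear_op_funpow P)

definition "C0 = C + C * C1"

lemma C0_nonneg: "0 \<le> C0"
  using const_bounds by (simp add: C0_def)

lemma T_pow_bounded:
  assumes t: "\<bar>t\<bar> < \<delta>0" and f: "f \<in> B"
  shows "N ((T t ^^ n) f) \<le> C0 * N f"
proof -
  have "C * \<kappa> ^ n * N f \<le> C * N f"
    using const_bounds N_nonneg[OF f] by (intro mult_right_mono mult_left_le power_le_one) auto
  moreover have "C * L f \<le> C * (C1 * N f)"
    using const_bounds L_le[OF f] by (intro mult_left_mono)
  ultimately show ?thesis
    using T_N[OF t f, of n] by (simp add: C0_def algebra_simps)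
qed

text \<open>Telescoping of \<open>T^n - P^n\<close>, arranged so that powers of \<open>T\<close> act
  first and are bounded in the strong norm \<open>N\<close>, the difference \<open>T - P\<close>
  passes from \<open>N\<close> to \<open>L\<close>, and \<open>P\<close> acts last as a contraction
  for \<open>L\<close>. The growth is therefore only linear in \<open>n\<close>.\<close>

lemma L_T_P_pow:
  assumes t: "\<bar>t\<bar> < \<delta>0" and f: "f \<in> B"
  shows "L (\<lambda>x. (T t ^^ n) f x - (P ^^ n) f x) \<le> real n * (C3 * \<bar>t\<bar> * C0 * N f)"
proof (induction n)
  case 0
  have "L (\<lambda>x. f x - f x) \<le> C1 * N (\<lambda>x. f x - f x)"
    using f by (intro L_le B_diff)
  also have "N (\<lambda>x. f x - f x) = 0"
    using N_scale[OF f, of 0] by simp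
  finally show ?case by simp
next
  case (Suc n)
  let ?u = "(T t ^^ n) f" and ?v = "(P ^^ n) f"
  have u: "?u \<in> B" and v: "?v \<in> B"
    using linear_opD(1)[OF T_pow[OF t] f] linear_opD(1)[OF P_pow f] by auto
  have Tu: "T t ?u \<in> B" and Pu: "P ?u \<in> B" and Pv: "P ?v \<in> B"
    using linear_opD(1)[OF T[OF t]] linear_opD(1)[OF P] u v by auto
  have eq1: "(\<lambda>x. (T t ^^ Suc n) f x - (P ^^ Suc n) f x) = (\<lambda>x. (T t ?u x - P ?u x) + (P ?u x - P ?v x))"
    by auto
  have eq2: "(\<lambda>x. P ?u x - P ?v x) = P (\<lambda>x. ?u x - ?v x)"
    using linear_opD(4)[OF P u v] by simp
  have "L (\<lambda>x. (T t ^^ Suc n) f x - (P ^^ Suc n) f x) \<le> L (\<lambda>x. T t ?u x - P ?u x) + L (P (\<lambda>x. ?u x - ?v x))"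
    unfolding eq1 eq2[symmetric] by (intro L_add B_diff Tu Pu Pv)
  moreover have "L (P (\<lambda>x. ?u x - ?v x)) \<le> L (\<lambda>x. ?u x - ?v x)"
    by (intro P_L B_diff u v)
  moreover have "L (\<lambda>x. T t ?u x - P ?u x) \<le> C3 * \<bar>t\<bar> * N ?u"
    by (rule T_P[OF t u])
  moreover have "C3 * \<bar>t\<bar> * N ?u \<le> C3 * \<bar>t\<bar> * (C0 * N f)"
    using const_bounds by (intro mult_left_mono T_pow_bounded t f) auto
  ultimately show ?case
    using Suc by (simp add: algebra_simps)
qed

lemma m_P_pow: "f \<in> B \<Longrightarrow> m ((P ^^ n) f) = m f"
  using linear_opD(1)[OF P_pow] by (induction n) (auto simp: P_m)

lemma m_T_pow_close:
  assumes t: "\<bar>t\<bar> < \<delta>0" and f: "f \<in> B"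
  shows "norm (m ((T t ^^ n) f) - m f) \<le> real n * (C3 * \<bar>t\<bar> * C0 * N f)"
proof -
  have u: "(T t ^^ n) f \<in> B" and v: "(P ^^ n) f \<in> B"
    using linear_opD(1)[OF T_pow[OF t] f] linear_opD(1)[OF P_pow f] by auto
  have "m ((T t ^^ n) f) - m f = m (\<lambda>x. (T t ^^ n) f x - (P ^^ n) f x)"
    using m_diff[OF u v] m_P_pow[OF f] by simp
  with order_trans[OF m_le[OF B_diff[OF u v]] L_T_P_pow[OF t f]] show ?thesis
    by simp
qed

lemma m_T_close:
  assumes t: "\<bar>t\<bar> < \<delta>0" and f: "f \<in> B"
  shows "norm (m (T t f) - m f) \<le> C3 * \<bar>t\<bar> * N f"
proof -
  have u: "T t f \<in> B" and v: "P f \<in> B"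
    using linear_opD(1)[OF T[OF t] f] linear_opD(1)[OF P f] by auto
  have "m (T t f) - m f = m (\<lambda>x. T t f x - P f x)"
    using m_diff[OF u v] P_m[OF f] by simp
  with order_trans[OF m_le[OF B_diff[OF u v]] T_P[OF t f]] show ?thesis
    by simp
qed

text \<open>The two halves play different roles. After \<open>n\<close> steps the vector is small in
  \<open>L\<close>, being close there to \<open>(P ^^ n) d\<close>, which decays; the next
  \<open>n\<close> steps convert smallness in \<open>L\<close> into smallness in \<open>N\<close>
  through \<open>T_N\<close>.\<close>

lemma T_contraction:
  assumes t: "\<bar>t\<bar> < \<delta>0" and d: "d \<in> B" "m d = 0"
  shows "N ((T t ^^ (n + n)) d) \<le> ((C * C0 + C * C1 * C) * \<kappa> ^ n + \<bar>t\<bar> * (C * real n * C3 * C0)) * N d"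
proof -
  have u: "(T t ^^ n) d \<in> B" and v: "(P ^^ n) d \<in> B"
    using linear_opD(1)[OF T_pow[OF t] d(1)] linear_opD(1)[OF P_pow d(1)] by auto
  have "L ((T t ^^ n) d) \<le> L (\<lambda>x. (T t ^^ n) d x - (P ^^ n) d x) + L ((P ^^ n) d)"
    using L_add[OF B_diff[OF u v] v] by simp
  also have "\<dots> \<le> real n * (C3 * \<bar>t\<bar> * C0 * N d) + C1 * (C * \<kappa> ^ n * N d)"
    using const_bounds by (intro add_mono L_T_P_pow t d order_trans[OF L_le[OF v]] mult_left_mono P_N)
  finally have L: "L ((T t ^^ n) d) \<le> real n * (C3 * \<bar>t\<bar> * C0 * N d) + C1 * (C * \<kappa> ^ n * N d)" .
  have "N ((T t ^^ (n + n)) d) = N ((T t ^^ n) ((T t ^^ n) d))"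
    by (simp add: funpow_add)
  also have "\<dots> \<le> C * \<kappa> ^ n * N ((T t ^^ n) d) + C * L ((T t ^^ n) d)"
    by (rule T_N[OF t u])
  also have "\<dots> \<le> C * \<kappa> ^ n * (C0 * N d) + C * (real n * (C3 * \<bar>t\<bar> * C0 * N d) + C1 * (C * \<kappa> ^ n * N d))"
    using const_bounds by (intro add_mono mult_left_mono T_pow_bounded t d L) auto
  finally show ?thesis
    by (simp add: algebra_simps)
qed

lemma T_contraction_uniform:
  assumes "0 < \<theta>"
  obtains p \<delta> where "0 < p" "0 < \<delta>" "\<delta> \<le> \<delta>0"
    "\<And>t d. \<bar>t\<bar> < \<delta> \<Longrightarrow> d \<in> B \<Longrightarrow> m d = 0 \<Longrightarrow> N ((T t ^^ p) d) \<le> \<theta> * N d"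
proof -
  define a where "a = C * C0 + C * C1 * C"
  have "(\<lambda>n. a * \<kappa> ^ n) \<longlonglongrightarrow> a * 0"
    using const_bounds by (intro tendsto_mult tendsto_const LIMSEQ_realpow_zero) auto
  then have "eventually (\<lambda>n. a * \<kappa> ^ n < \<theta> / 2) sequentially"
    using assms by (intro order_tendstoD) auto
  then obtain n where n: "a * \<kappa> ^ n < \<theta> / 2" "0 < n"
    using eventually_gt_at_top[of 0] eventually_conj eventually_happens'[OF sequentially_bot] by blast
  define b where "b = C * real n * C3 * C0"
  have b: "0 \<le> b" using const_bounds C0_nonneg by (simp add: b_def)
  \<comment> \<open>\<open>n\<close> is fixed beforehand, so that the geometric part is at most half
    of \<open>\<theta>\<close>; only then can \<open>t\<close> be restricted, since \<open>b\<close>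
    grows with \<open>n\<close>.\<close>
  define \<delta> where "\<delta> = min \<delta>0 (\<theta> / (2 * (b + 1)))"
  show ?thesis
  proof (rule that[of "n + n" \<delta>])
    show "0 < n + n" "0 < \<delta>" "\<delta> \<le> \<delta>0"
      using n b assms const_bounds by (auto simp: \<delta>_def)
    fix t d assume t: "\<bar>t\<bar> < \<delta>" and d: "d \<in> B" "m d = 0"
    have "\<bar>t\<bar> * b \<le> \<bar>t\<bar> * (b + 1)"
      by (intro mult_left_mono) auto
    also have "\<dots> < \<theta> / 2"
      using t b by (simp add: \<delta>_def less_divide_eq algebra_simps)
    finally have "a * \<kappa> ^ n + \<bar>t\<bar> * b \<le> \<theta>"
      using n by simp
    then have "(a * \<kappa> ^ n + \<bar>t\<bar> * b) * N d \<le> \<theta> * N d"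
      using N_nonneg d by (intro mult_right_mono)
    moreover have "N ((T t ^^ (n + n)) d) \<le> (a * \<kappa> ^ n + \<bar>t\<bar> * b) * N d"
      using T_contraction[of t d n] t d by (simp add: \<delta>_def a_def b_def)
    ultimately show "N ((T t ^^ (n + n)) d) \<le> \<theta> * N d"
      by linarith
  qed
qed

definition "\<phi> t n = m ((T t ^^ n) e)"

text \<open>\<open>l\<close> plays the role of the dominant eigenvalue, but no eigenvector is
  constructed. Before the iterates can be normalised it must be known that \<open>\<phi> t n\<close>
  never vanishes; this comes from a cone argument, the iterates staying in the cone where
  \<open>N f \<le> A * norm (m f)\<close>.\<close>

theorem quasi_multiplicative:
  obtains K \<delta> where "0 \<le> K" "0 < \<delta>" "\<delta> \<le> \<delta>0"
    "\<And>t. \<bar>t\<bar> < \<delta> \<Longrightarrow> \<exists>l. l \<noteq> 0 \<and> (\<forall>n. norm (\<phi> t n - l ^ n) \<le> K * \<bar>t\<bar> * norm l ^ n)"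
proof -
  \<comment> \<open>The opening of the cone, large enough that
    \<open>2 * (C0 * N e + (A + N e) / 4) \<le> A\<close>, which is what one block of
    \<open>p\<close> steps requires for the cone to be preserved.\<close>
  define A where "A = 4 * (C0 + 1) * N e"
  have Ne: "0 \<le> N e" using N_nonneg e by simp
  have A: "0 \<le> A" using Ne C0_nonneg by (simp add: A_def)
  \<comment> \<open>Two demands on the contraction factor: \<open>1/4\<close> preserves the cone,
    and \<open>\<theta> * (2 + 2 * C1 * A) \<le> 1/2\<close> halves the increments of the normalised
    iterates, including the correction for renormalising.\<close>
  define \<theta> where "\<theta> = 1 / (4 * (1 + C1 * A))"
  have \<theta>: "0 < \<theta>" "\<theta> \<le> 1/4" "\<theta> * (2 + 2 * C1 * A) \<le> 1/2"
    using A const_bounds by (auto simp: \<theta>_def divide_simps add_pos_nonneg)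
  obtain p \<delta>1 where p: "0 < p" and \<delta>1: "0 < \<delta>1" "\<delta>1 \<le> \<delta>0"
    and contr: "\<And>t d. \<bar>t\<bar> < \<delta>1 \<Longrightarrow> d \<in> B \<Longrightarrow> m d = 0 \<Longrightarrow> N ((T t ^^ p) d) \<le> \<theta> * N d"
    using T_contraction_uniform[OF \<theta>(1)] by blast
  define \<rho> where "\<rho> = root p (1/2)"
  have \<rho>: "0 < \<rho>" "\<rho> < 1"
    using p by (auto simp: \<rho>_def)
  have "\<rho> ^ p = 1/2"
    using p by (simp add: \<rho>_def)
  \<comment> \<open>The limit error of the quotients relative to \<open>norm l\<close> and per unit
    of \<open>\<bar>t\<bar>\<close>: the factor \<open>4/3\<close> comes from
    \<open>norm l \<ge> 3/4\<close>.\<close>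
  define c where "c = C3 * (4 * A) / (1 - \<rho>) * (4/3)"
  have c: "0 \<le> c" using const_bounds A \<rho> by (simp add: c_def)
  \<comment> \<open>Collects every coefficient whose product with \<open>\<bar>t\<bar>\<close> has
    to be at most \<open>1/4\<close>: the drift of \<open>\<phi>\<close> over a block, the drift
    over the initial block, the distance of the quotients from 1, and the smallness condition of
    \<open>prod_near_power\<close>.\<close>
  define b where "b = real p * C3 * C0 * (A + N e) + C3 * A + c / (1 - \<rho>)"
  have b: "0 \<le> b" "real p * C3 * C0 * A \<le> b" "real p * C3 * C0 * N e \<le> b" "C3 * A \<le> b" "c / (1 - \<rho>) \<le> b"
  proof -
    have "0 \<le> real p * C3 * C0 * A" "0 \<le> real p * C3 * C0 * N e" "0 \<le> C3 * A" "0 \<le> c / (1 - \<rho>)"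
      using const_bounds C0_nonneg A Ne c \<rho> by auto
    then show "0 \<le> b" "real p * C3 * C0 * A \<le> b" "real p * C3 * C0 * N e \<le> b" "C3 * A \<le> b" "c / (1 - \<rho>) \<le> b"
      by (auto simp: b_def distrib_left)
  qed
  define \<delta> where "\<delta> = min \<delta>1 (1 / (4 * (b + 1)))"
  show ?thesis
  proof (rule that[of "2 * c / (1 - \<rho>)" \<delta>])
    show "0 \<le> 2 * c / (1 - \<rho>)" "0 < \<delta>" "\<delta> \<le> \<delta>0"
      using c \<rho> \<delta>1 b(1) by (auto simp: \<delta>_def)
    fix t :: real assume t': "\<bar>t\<bar> < \<delta>"
    then have t1: "\<bar>t\<bar> < \<delta>1" and t: "\<bar>t\<bar> < \<delta>0"
      using \<delta>1 by (auto simp: \<delta>_def)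
    have tb: "\<bar>t\<bar> * y \<le> 1/4" if "y \<le> b" for y
    proof -
      have "\<bar>t\<bar> * y \<le> \<bar>t\<bar> * (b + 1)"
        using that by (intro mult_left_mono) auto
      also have "\<dots> \<le> 1/4"
        using t' b(1) by (simp add: \<delta>_def less_divide_eq algebra_simps)
      finally show ?thesis .
    qed
    define f where "f n = (T t ^^ n) e" for n
    have fB: "f n \<in> B" for n
      unfolding f_def by (rule linear_opD(1)[OF T_pow[OF t] e(1)])
    have f_add: "f (n + k) = (T t ^^ k) (f n)" for n k
      by (simp add: f_def add.commute[of n] funpow_add)
    have \<phi>: "m (f n) = \<phi> t n" for n
      by (simp add: f_def \<phi>_def)
    have step: "norm (\<phi> t (n + k) - \<phi> t n) \<le> \<bar>t\<bar> * (real k * C3 * C0) * N (f n)" for n k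
      using m_T_pow_close[OF t fB[of n], of k] by (simp add: f_add[symmetric] \<phi> mult_ac)
    \<comment> \<open>Induction in blocks of length \<open>p\<close>. In a block
      \<open>\<phi>\<close> loses at most a factor 2, while the part of the iterate in the kernel of
      \<open>m\<close> is contracted by \<open>1/4\<close>.\<close>
    have bound: "N (f n) \<le> A * norm (\<phi> t n) \<and> \<phi> t n \<noteq> 0" for n
    proof (induction n rule: less_induct)
      case (less n)
      show ?case
      proof (cases "n < p")
        case True
        have "norm (\<phi> t n - 1) \<le> \<bar>t\<bar> * (real n * C3 * C0) * N e"
          using step[of 0 n] by (simp add: f_def \<phi>_def e)
        also have "\<dots> \<le> \<bar>t\<bar> * (real p * C3 * C0) * N e"
          using True const_bounds C0_nonneg Ne by (intro mult_mono) auto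
        also have "\<dots> \<le> 1/4"
          using tb[OF b(3)] by (simp add: mult_ac)
        finally have half: "1/2 \<le> norm (\<phi> t n)"
          using norm_triangle_ineq2[of 1 "1 - \<phi> t n"] by (simp add: norm_minus_commute)
        have "N (f n) \<le> C0 * N e"
          unfolding f_def by (rule T_pow_bounded[OF t e(1)])
        also have "\<dots> \<le> A * (1/2)"
          using Ne C0_nonneg by (simp add: A_def algebra_simps)
        also have "\<dots> \<le> A * norm (\<phi> t n)"
          using half A by (intro mult_left_mono)
        finally show ?thesis using half by auto
      next
        case False
        define k where "k = n - p"
        have n: "n = k + p" "k < n"
          using False p by (auto simp: k_def)
        note IH = less[OF n(2)]
        have "norm (\<phi> t n - \<phi> t k) \<le> \<bar>t\<bar> * (real p * C3 * C0) * N (f k)"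
          unfolding n(1) by (rule step)
        also have "\<dots> \<le> \<bar>t\<bar> * (real p * C3 * C0) * (A * norm (\<phi> t k))"
          using IH const_bounds C0_nonneg by (intro mult_left_mono) auto
        also have "\<dots> = (\<bar>t\<bar> * (real p * C3 * C0 * A)) * norm (\<phi> t k)"
          by simp
        also have "\<dots> \<le> 1/4 * norm (\<phi> t k)"
          by (intro mult_right_mono tb b) auto
        finally have half: "norm (\<phi> t k) \<le> 2 * norm (\<phi> t n)"
          using norm_triangle_ineq2[of "\<phi> t k" "\<phi> t n"] norm_ge_zero[of "\<phi> t k"]
            norm_minus_commute[of "\<phi> t k" "\<phi> t n"] by linarith
        \<comment> \<open>The component of \<open>f k\<close> in the kernel of \<open>m\<close>, the
          only part on which \<open>T\<close> contracts.\<close>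
        define d where "d = (\<lambda>x. f k x - \<phi> t k * e x)"
        have d: "d \<in> B" "m d = 0"
          unfolding d_def using fB e B_scale m_scale by (auto simp: m_diff \<phi> intro!: B_diff)
        have "N d \<le> N (f k) + norm (\<phi> t k) * N e"
          unfolding d_def using N_diff[OF fB[of k] B_scale[OF e(1), of "\<phi> t k"]] N_scale[OF e(1)] by simp
        also have "\<dots> \<le> (A + N e) * norm (\<phi> t k)"
          using IH by (simp add: algebra_simps)
        finally have Nd: "N d \<le> (A + N e) * norm (\<phi> t k)" .
        have "f n = (T t ^^ p) (\<lambda>x. \<phi> t k * e x + d x)"
          unfolding n(1) f_add by (simp add: d_def)
        also have "\<dots> = (\<lambda>x. \<phi> t k * (T t ^^ p) e x + (T t ^^ p) d x)"
          by (simp add: linear_opD(2)[OF T_pow[OF t] B_scale[OF e(1)] d(1)] linear_opD(3)[OF T_pow[OF t] e(1)])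
        finally have "N (f n) \<le> norm (\<phi> t k) * N ((T t ^^ p) e) + N ((T t ^^ p) d)"
          using N_add[OF B_scale[OF linear_opD(1)[OF T_pow[OF t] e(1)]] linear_opD(1)[OF T_pow[OF t] d(1)]]
            N_scale[OF linear_opD(1)[OF T_pow[OF t] e(1)]] by metis
        also have "\<dots> \<le> norm (\<phi> t k) * (C0 * N e) + 1/4 * ((A + N e) * norm (\<phi> t k))"
        proof (intro add_mono mult_left_mono T_pow_bounded t e)
          have "N ((T t ^^ p) d) \<le> \<theta> * N d"
            by (rule contr[OF t1 d])
          also have "\<dots> \<le> 1/4 * N d"
            using \<theta> N_nonneg[OF d(1)] by (intro mult_right_mono)
          finally show "N ((T t ^^ p) d) \<le> 1/4 * ((A + N e) * norm (\<phi> t k))"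
            using Nd by simp
        qed auto
        also have "\<dots> = (C0 * N e + (A + N e) / 4) * norm (\<phi> t k)"
          by (simp add: algebra_simps)
        also have "\<dots> \<le> (C0 * N e + (A + N e) / 4) * (2 * norm (\<phi> t n))"
          using C0_nonneg A Ne half by (intro mult_left_mono) auto
        also have "\<dots> \<le> A * norm (\<phi> t n)"
        proof -
          have "2 * (C0 * N e + (A + N e) / 4) \<le> A"
            using Ne by (simp add: A_def algebra_simps)
          then have "(2 * (C0 * N e + (A + N e) / 4)) * norm (\<phi> t n) \<le> A * norm (\<phi> t n)"
            by (rule mult_right_mono) simp
          moreover have "y * (2 * z) = (2 * y) * z" for y z :: real by simp
          ultimately show ?thesis by metis
        qed
        finally show ?thesis
          using half IH by auto
      qed
    qed
    have nz: "\<phi> t n \<noteq> 0" for n using bound by blast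
    define g where "g n = (\<lambda>x. (1 / \<phi> t n) * f n x)" for n
    have gB: "g n \<in> B" for n unfolding g_def by (intro B_scale fB)
    have mg: "m (g n) = 1" for n
      unfolding g_def m_scale[OF fB] using \<phi> nz by simp
    have Ng: "N (g n) \<le> A" for n
    proof -
      have "N (g n) = norm (1 / \<phi> t n) * N (f n)"
        unfolding g_def by (rule N_scale[OF fB])
      also have "\<dots> = N (f n) / norm (\<phi> t n)"
        by (simp add: norm_divide)
      finally show ?thesis
        using bound[of n] by (simp add: divide_le_eq)
    qed
    have Tg: "(T t ^^ k) (g n) = (\<lambda>x. (\<phi> t (n + k) / \<phi> t n) * g (n + k) x)" for n k
      unfolding g_def linear_opD(3)[OF T_pow[OF t] fB] using nz[of "n + k"] by (simp add: f_add)
    have mTg: "m ((T t ^^ k) (g n)) = \<phi> t (n + k) / \<phi> t n" for n k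
      unfolding Tg m_scale[OF gB] mg by simp
    define h where "h n = (\<lambda>x. g (Suc n) x - g n x)" for n
    have hB: "h n \<in> B" for n unfolding h_def by (intro B_diff gB)
    have mh: "m (h n) = 0" for n unfolding h_def using m_diff[OF gB gB] mg by simp
    have Nh: "N (h n) \<le> 2 * A" for n
      unfolding h_def using N_diff[OF gB[of "Suc n"] gB[of n]] Ng[of n] Ng[of "Suc n"] by simp
    have "N (h (n + p)) \<le> N (h n) / 2" for n
    proof -
      define a where "a = \<phi> t (n + p) / \<phi> t n"
      define a' where "a' = \<phi> t (Suc n + p) / \<phi> t (Suc n)"
      have "norm (a' - 1) = norm (m ((T t ^^ p) (g (Suc n))) - m (g (Suc n)))"
        by (simp only: mTg mg a'_def)
      also have "\<dots> \<le> real p * (C3 * \<bar>t\<bar> * C0 * N (g (Suc n)))"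
        by (rule m_T_pow_close[OF t gB])
      also have "\<dots> \<le> real p * (C3 * \<bar>t\<bar> * C0 * A)"
        using const_bounds C0_nonneg Ng by (intro mult_left_mono) auto
      also have "\<dots> \<le> 1/4"
        using tb[OF b(2)] by (simp add: mult_ac)
      finally have a': "1/2 \<le> norm a'"
        using norm_triangle_ineq2[of 1 "1 - a'"] by (simp add: norm_minus_commute)
      have Th: "(T t ^^ p) (h n) = (\<lambda>x. a' * g (Suc n + p) x - a * g (n + p) x)"
        unfolding h_def linear_opD(4)[OF T_pow[OF t] gB gB] Tg a_def a'_def by simp
      have ThB: "(T t ^^ p) (h n) \<in> B"
        by (rule linear_opD(1)[OF T_pow[OF t] hB])
      have NTh: "N ((T t ^^ p) (h n)) \<le> \<theta> * N (h n)"
        by (rule contr[OF t1 hB mh])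
      have "m ((T t ^^ p) (h n)) = a' - a"
        unfolding Th m_diff[OF B_scale[OF gB] B_scale[OF gB]] m_scale[OF gB] mg by simp
      then have "norm (a' - a) \<le> C1 * N ((T t ^^ p) (h n))"
        using order_trans[OF m_le[OF ThB] L_le[OF ThB]] by simp
      also have "\<dots> \<le> C1 * (\<theta> * N (h n))"
        using const_bounds NTh by (intro mult_left_mono)
      finally have aa: "norm (a' - a) \<le> C1 * \<theta> * N (h n)" by simp
      have a'0: "a' \<noteq> 0" using a' by auto
      \<comment> \<open>The two iterates forming \<open>h n\<close> are renormalised by different
        factors \<open>a'\<close> and \<open>a\<close>, so \<open>h (n + p)\<close> is not a
        multiple of the image of \<open>h n\<close>. The correction is harmless because
        \<open>a' - a\<close> is the value of \<open>m\<close> at that image and hence small as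
        well.\<close>
      have hp: "h (n + p) = (\<lambda>x. (1 / a') * (T t ^^ p) (h n) x - ((a' - a) / a') * g (n + p) x)"
        unfolding Th using a'0 by (auto simp: h_def fun_eq_iff field_simps)
      have "N (h (n + p)) \<le> norm (1 / a') * N ((T t ^^ p) (h n)) + norm ((a' - a) / a') * N (g (n + p))"
        unfolding hp by (rule order_trans[OF N_diff[OF B_scale[OF ThB] B_scale[OF gB]]])
          (simp only: N_scale[OF ThB] N_scale[OF gB] order_refl)
      also have "\<dots> \<le> 2 * (\<theta> * N (h n)) + (2 * (C1 * \<theta> * N (h n))) * A"
      proof (intro add_mono mult_mono NTh Ng)
        show ia: "norm (1 / a') \<le> 2"
          using a' a'0 by (simp add: norm_divide divide_le_eq)
        have "norm ((a' - a) / a') = norm (1 / a') * norm (a' - a)"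
          by (simp add: norm_divide)
        also have "\<dots> \<le> 2 * (C1 * \<theta> * N (h n))"
          by (intro mult_mono ia aa) auto
        finally show "norm ((a' - a) / a') \<le> 2 * (C1 * \<theta> * N (h n))" .
      qed (use N_nonneg[OF ThB] N_nonneg[OF gB] N_nonneg[OF hB] const_bounds \<theta> in auto)
      also have "\<dots> = \<theta> * (2 + 2 * C1 * A) * N (h n)"
        by (simp add: algebra_simps)
      also have "\<dots> \<le> 1/2 * N (h n)"
        using \<theta> N_nonneg[OF hB] by (intro mult_right_mono)
      finally show ?thesis by simp
    qed
    note h_half = this
    have Nh_decay: "N (h n) \<le> 4 * A * \<rho> ^ n" for n
      using block_geometric_decay[of p "\<lambda>n. N (h n)" "2 * A" \<rho> n] p Nh A h_half \<rho> \<open>\<rho> ^ p = 1/2\<close> by simp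
    define r where "r n = \<phi> t (Suc n) / \<phi> t n" for n
    have mr: "m (T t (g n)) = r n" for n
      using mTg[of 1 n] by (simp add: r_def)
    have r_step: "norm (r (Suc n) - r n) \<le> (\<bar>t\<bar> * C3 * (4 * A)) * \<rho> ^ n" for n
    proof -
      \<comment> \<open>Subtracting \<open>m (h n)\<close>, which is 0, exposes the difference of
        \<open>m\<close> after and before \<open>T\<close>; this yields the factor
        \<open>\<bar>t\<bar>\<close> in addition to the geometric decay of
        \<open>h n\<close>.\<close>
      have "r (Suc n) - r n = m (T t (h n)) - m (h n)"
        unfolding h_def linear_opD(4)[OF T[OF t] gB gB]
        using m_diff[OF linear_opD(1)[OF T[OF t] gB] linear_opD(1)[OF T[OF t] gB]] m_diff[OF gB gB] mg mr by simp
      also have "norm \<dots> \<le> C3 * \<bar>t\<bar> * N (h n)"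
        by (rule m_T_close[OF t hB])
      also have "\<dots> \<le> C3 * \<bar>t\<bar> * (4 * A * \<rho> ^ n)"
        using const_bounds Nh_decay by (intro mult_left_mono) auto
      finally show ?thesis by (simp add: mult_ac)
    qed
    obtain l where l: "r \<longlonglongrightarrow> l" "\<And>n. norm (r n - l) \<le> (\<bar>t\<bar> * C3 * (4 * A)) * \<rho> ^ n / (1 - \<rho>)"
      using geometric_increments_limit[OF r_step] \<rho> by auto
    have r1: "norm (r n - 1) \<le> 1/4" for n
    proof -
      have "norm (r n - 1) \<le> C3 * \<bar>t\<bar> * N (g n)"
        using m_T_close[OF t gB[of n]] by (simp add: mr mg)
      also have "\<dots> \<le> C3 * \<bar>t\<bar> * A"
        using const_bounds Ng by (intro mult_left_mono) auto
      also have "\<dots> \<le> 1/4"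
        using tb[OF b(4)] by (simp add: mult_ac)
      finally show ?thesis .
    qed
    have "norm (l - 1) \<le> 1/4"
      by (rule LIMSEQ_le_const2[OF tendsto_norm[OF tendsto_diff[OF l(1) tendsto_const]]]) (use r1 in auto)
    then have l34: "3/4 \<le> norm l"
      using norm_triangle_ineq2[of 1 "1 - l"] by (simp add: norm_minus_commute)
    have prod: "\<phi> t n = (\<Prod>k<n. r k)" for n
    proof (induction n)
      case 0
      show ?case by (simp add: \<phi>_def e)
    next
      case (Suc n)
      then have "(\<Prod>k<Suc n. r k) = \<phi> t n * r n" by simp
      also have "\<dots> = \<phi> t (Suc n)" using nz[of n] by (simp add: r_def)
      finally show ?case by simp
    qed
    have rl: "norm (r k - l) \<le> (\<bar>t\<bar> * c) * \<rho> ^ k * norm l" for k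
    proof -
      have "norm (r k - l) \<le> (\<bar>t\<bar> * C3 * (4 * A)) * \<rho> ^ k / (1 - \<rho>)"
        by (rule l)
      also have "\<dots> = (\<bar>t\<bar> * c) * \<rho> ^ k * (3/4)"
        using \<rho> by (simp add: c_def field_simps)
      also have "\<dots> \<le> (\<bar>t\<bar> * c) * \<rho> ^ k * norm l"
        using l34 c \<rho> by (intro mult_left_mono) auto
      finally show ?thesis .
    qed
    have "\<bar>t\<bar> * c \<le> 1 - \<rho>"
      using tb[OF b(5)] \<rho> by (simp add: field_simps)
    then have "norm (\<phi> t n - l ^ n) \<le> 2 * (\<bar>t\<bar> * c) / (1 - \<rho>) * norm l ^ n" for n
      unfolding prod using \<rho> c l34 by (intro prod_near_power rl) auto
    then show "\<exists>l. l \<noteq> 0 \<and> (\<forall>n. norm (\<phi> t n - l ^ n) \<le> 2 * c / (1 - \<rho>) * \<bar>t\<bar> * norm l ^ n)"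
      using l34 by (intro exI[of _ l]) (auto simp: mult_ac)
  qed
qed

end

section \<open>Consequences of hypothesis (H)\<close>

text \<open>The hypotheses bound the rate only from above, so \<open>\<kappa>\<close> may be
  negative and \<open>\<kappa>^n\<close> need not tend to 0. The lemma exchanges it for a rate in
  \<open>[0, 1)\<close>. The requirement \<open>1 \<le> C'\<close> later extends the estimates to
  exponent 0.\<close>

lemma nonnegative_rate:
  fixes a :: "nat \<Rightarrow> 'x \<Rightarrow> real"
  assumes \<kappa>: "\<kappa> < 1" and C: "0 \<le> C"
    and a: "\<And>n x. 1 \<le> n \<Longrightarrow> P x \<Longrightarrow> 0 \<le> a n x" "\<And>n x. 1 \<le> n \<Longrightarrow> P x \<Longrightarrow> a n x \<le> C * \<kappa> ^ n * u x + C * v x"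
    and uv: "\<And>x. P x \<Longrightarrow> 0 \<le> u x" "\<And>x. P x \<Longrightarrow> 0 \<le> v x"
  obtains C' \<kappa>' where "1 \<le> C'" "0 \<le> \<kappa>'" "\<kappa>' < 1" "\<And>n x. 1 \<le> n \<Longrightarrow> P x \<Longrightarrow> a n x \<le> C' * \<kappa>' ^ n * u x + C' * v x"
proof (cases "- 1 < \<kappa>")
  case True
  show ?thesis
  proof (rule that[of "max C 1" "\<bar>\<kappa>\<bar>"])
    fix n :: nat and x assume n: "1 \<le> n" and x: "P x"
    note a(2)[OF n x]
    also have "C * \<kappa> ^ n * u x \<le> max C 1 * \<bar>\<kappa>\<bar> ^ n * u x"
    proof (intro mult_right_mono uv x)
      have "C * \<kappa> ^ n \<le> C * \<bar>\<kappa>\<bar> ^ n"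
        using C abs_ge_self[of "\<kappa> ^ n"] by (intro mult_left_mono) (simp_all add: power_abs)
      also have "\<dots> \<le> max C 1 * \<bar>\<kappa>\<bar> ^ n"
        by (intro mult_right_mono) auto
      finally show "C * \<kappa> ^ n \<le> max C 1 * \<bar>\<kappa>\<bar> ^ n" .
    qed
    also have "C * v x \<le> max C 1 * v x"
      using uv(2)[OF x] by (intro mult_right_mono) auto
    finally show "a n x \<le> max C 1 * \<bar>\<kappa>\<bar> ^ n * u x + max C 1 * v x" by simp
  qed (use True \<kappa> in auto)
next
  case False
  \<comment> \<open>For \<open>\<kappa> \<le> - 1\<close> the hypothesis at odd exponents forces \<open>\<bar>\<kappa>\<bar> ^ n * u x \<le> v x\<close>.\<close>
  show ?thesis
  proof (rule that[of "max (2 * C) 1" 0])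
    fix n :: nat and x assume n: "1 \<le> n" and x: "P x"
    have odd: "C * (\<bar>\<kappa>\<bar> ^ k * u x) \<le> C * v x" if "odd k" for k
    proof -
      have k: "1 \<le> k" using that by (cases k) auto
      have "\<kappa> ^ k = - (\<bar>\<kappa>\<bar> ^ k)" using False that by (simp add: power_minus_odd)
      then show ?thesis
        using order_trans[OF a(1)[OF k x] a(2)[OF k x]] by simp
    qed
    have "C * \<kappa> ^ n * u x \<le> C * v x"
    proof (cases "odd n")
      case True
      then have "\<kappa> ^ n \<le> 0" using False by (auto intro: odd_power_less_zero less_imp_le)
      then have "C * \<kappa> ^ n * u x \<le> 0"
        using C uv(1)[OF x] by (intro mult_nonpos_nonneg mult_nonneg_nonpos)
      also have "0 \<le> C * v x" using C uv(2)[OF x] by simp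
      finally show ?thesis .
    next
      case even: False
      have "C * \<kappa> ^ n * u x = C * (\<bar>\<kappa>\<bar> ^ n * u x)" using even by (simp add: power_even_abs)
      also have "\<dots> \<le> C * (\<bar>\<kappa>\<bar> ^ Suc n * u x)"
        using C uv(1)[OF x] False by (intro mult_left_mono mult_right_mono power_increasing) auto
      also have "\<dots> \<le> C * v x" using even by (intro odd) auto
      finally show ?thesis .
    qed
    then have "a n x \<le> 2 * C * v x" using a(2)[OF n x] by simp
    also have "\<dots> \<le> max (2 * C) 1 * v x" using uv(2)[OF x] by (intro mult_right_mono) auto
    finally show "a n x \<le> max (2 * C) 1 * 0 ^ n * u x + max (2 * C) 1 * v x"
      using n by (simp add: power_0_left)
  qed auto
qed

lemma powr_add_three_halves_le:
  fixes u v :: real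
  assumes "0 \<le> u" "0 \<le> v"
  shows "(u + v) powr (3/2) \<le> 2 powr (3/2) * (u powr (3/2) + v powr (3/2))"
proof -
  have "(u + v) powr (3/2) \<le> (2 * max u v) powr (3/2)"
    using assms by (intro powr_mono2) auto
  also have "\<dots> = 2 powr (3/2) * max u v powr (3/2)"
    by (simp add: powr_mult)
  also have "\<dots> \<le> 2 powr (3/2) * (u powr (3/2) + v powr (3/2))"
    by (intro mult_left_mono) (auto simp: max_def)
  finally show ?thesis .
qed

lemma square_powr_three_halves:
  fixes x :: real
  assumes "0 \<le> x"
  shows "(x\<^sup>2) powr (3/2) = x ^ 3"
proof (cases "x = 0")
  case False
  then have "(x\<^sup>2) powr (3/2) = (x powr 2) powr (3/2)"
    using assms by (simp add: powr_numeral)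
  also have "\<dots> = x powr 3"
    unfolding powr_powr by simp
  also have "\<dots> = x ^ 3"
    using assms False by (simp add: powr_numeral)
  finally show ?thesis .
qed simp

context stationary_chain
begin

lemma AE_Q:
  assumes "Measurable.pred E P" "AE x in \<nu>. P x"
  shows "AE x in \<nu>. AE y in Q x. P y"
proof -
  have Q: "Q \<in> measurable \<nu> (subprob_algebra E)" by measurable
  show ?thesis
    using AE_bind[OF Q assms(1)] assms(2) unfolding \<nu>_inv by blast
qed

text \<open>Jensen's inequality for the power 3/2, obtained from Young's inequality: with
  \<open>c = norm (Q f)\<close> and \<open>s = sqrt c\<close>, both \<open>s * c\<close> and
  \<open>s^3\<close> equal the 3/2 power of \<open>c\<close>, so the term \<open>s^3 / 3\<close> can
  be absorbed on the left.\<close>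

lemma integrable_Q_powr_three_halves:
  fixes f :: "'a \<Rightarrow> complex"
  assumes f [measurable]: "f \<in> borel_measurable E" and int: "integrable \<nu> (\<lambda>x. norm (f x) powr (3/2))"
  shows "integrable \<nu> (\<lambda>x. norm (\<integral>y. f y \<partial>Q x) powr (3/2))"
proof (rule Bochner_Integration.integrable_bound[OF integrable_Q_integral[OF int]])
  have "AE x in \<nu>. integrable (Q x) f"
    by (intro AE_integrable_Q integrable_of_powr_three_halves f int)
  then show "AE x in \<nu>. norm (norm (\<integral>y. f y \<partial>Q x) powr (3/2)) \<le> norm (\<integral>y. norm (f y) powr (3/2) \<partial>Q x)"
    using AE_integrable_Q[OF int] AE_space
  proof eventually_elim
    case (elim x)
    interpret Qx: prob_space "Q x" using elim by (intro Q_prob) (simp add: space_\<nu>)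
    define c where "c = norm (\<integral>y. f y \<partial>Q x)"
    define s where "s = sqrt c"
    have c: "0 \<le> c" "0 \<le> s" "s * c = c powr (3/2)" "s ^ 3 = c powr (3/2)"
    proof -
      show "0 \<le> c" "0 \<le> s" by (auto simp: c_def s_def)
      have "s\<^sup>2 = c" by (simp add: s_def c_def)
      then show "s ^ 3 = c powr (3/2)" using square_powr_three_halves[of s] \<open>0 \<le> s\<close> by simp
      with \<open>s\<^sup>2 = c\<close> show "s * c = c powr (3/2)" by (simp add: power2_eq_square power3_eq_cube mult.commute)
    qed
    have "s * c \<le> s * (\<integral>y. norm (f y) \<partial>Q x)"
      using c unfolding c_def by (intro mult_left_mono integral_norm_bound)
    also have "\<dots> = (\<integral>y. s * norm (f y) \<partial>Q x)" by simp
    also have "\<dots> \<le> (\<integral>y. s ^ 3 / 3 + 2/3 * norm (f y) powr (3/2) \<partial>Q x)"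
    proof (rule integral_mono)
      show "integrable (Q x) (\<lambda>y. s * norm (f y))" "integrable (Q x) (\<lambda>y. s ^ 3 / 3 + 2/3 * norm (f y) powr (3/2))"
        using elim by auto
      show "s * norm (f y) \<le> s ^ 3 / 3 + 2/3 * norm (f y) powr (3/2)" for y
        using young_three_halves[of s "norm (f y)" 1] c by simp
    qed
    also have "\<dots> = s ^ 3 / 3 + 2/3 * (\<integral>y. norm (f y) powr (3/2) \<partial>Q x)"
      using elim Qx.prob_space by simp
    finally have "c powr (3/2) \<le> (\<integral>y. norm (f y) powr (3/2) \<partial>Q x)"
      unfolding c(3,4) by simp
    then show ?case by (simp add: c_def)
  qed
qed measurable

end

section \<open>Verification of the perturbation setting under (H)\<close>

locale hypothesis_H = stationary_chain E Q \<nu> M X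
  for E :: "'a measure" and Q :: "'a \<Rightarrow> 'a measure" and \<nu> :: "'a measure"
    and M :: "'w measure" and X :: "nat \<Rightarrow> 'w \<Rightarrow> 'a" +
  fixes \<xi> :: "'a \<Rightarrow> real" and B :: "('a \<Rightarrow> complex) set" and N :: "('a \<Rightarrow> complex) \<Rightarrow> real" and \<sigma> :: real
  assumes \<xi>_meas [measurable]: "\<xi> \<in> borel_measurable E"
    and \<xi>_centered: "(\<integral>x. \<xi> x \<partial>\<nu>) = 0"
    and H: "hyp_H E Q \<nu> \<xi> B N" and \<sigma>: "sigma2 Q \<nu> B N \<xi> = complex_of_real (\<sigma>\<^sup>2)"
begin

lemma banach: "banach_fun_space E B N"
  and cube: "f \<in> B \<Longrightarrow> integrable \<nu> (\<lambda>x. norm (f x) ^ 3)"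
  and \<xi>_B: "(\<lambda>x. complex_of_real (\<xi> x)) \<in> B"
  and geom: "geom_ergodic E Q \<nu> B N"
  and H2: "summable (\<lambda>p. (\<integral>x. norm ((Qop Q ^^ p) (psi_fun Q \<nu> B N \<xi>) x) powr (3/2) \<partial>\<nu>) powr (2/3))"
  and H3: "\<exists>C \<delta>. \<delta> > 0 \<and> (\<forall>t. \<bar>t\<bar> < \<delta> \<longrightarrow> (\<forall>f\<in>B. N f \<le> 1 \<longrightarrow>
         (\<integral>x. norm (exp (\<i> * complex_of_real (t * \<xi> x)) - 1) * norm (f x) \<partial>\<nu>) \<le> C * \<bar>t\<bar>))"
  and H4: "\<exists>a b. a < 0 \<and> 0 < b \<and>
        (\<forall>t\<in>{a<..<b}. bounded_op B N (Qfourier Q \<xi> t)) \<and>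
        (\<exists>\<kappa> C. \<kappa> < 1 \<and> C \<ge> 0 \<and>
           (\<forall>n\<ge>1. \<forall>t\<in>{a<..<b}. \<forall>f\<in>B.
              N ((Qfourier Q \<xi> t ^^ n) f) \<le> C * \<kappa> ^ n * N f + C * (\<integral>x. norm (f x) \<partial>\<nu>)))"
  using H unfolding hyp_H_def by (elim conjE exE; blast)+

lemma B_meas [measurable]: "f \<in> B \<Longrightarrow> f \<in> borel_measurable E"
  and B_zero: "(\<lambda>x. 0) \<in> B"
  and B_add: "f \<in> B \<Longrightarrow> h \<in> B \<Longrightarrow> (\<lambda>x. f x + h x) \<in> B"
  and B_scale: "f \<in> B \<Longrightarrow> (\<lambda>x. c * f x) \<in> B"
  and N_nonneg: "f \<in> B \<Longrightarrow> 0 \<le> N f"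
  and N_eq_0: "f \<in> B \<Longrightarrow> N f = 0 \<longleftrightarrow> f = (\<lambda>x. 0)"
  and N_add: "f \<in> B \<Longrightarrow> h \<in> B \<Longrightarrow> N (\<lambda>x. f x + h x) \<le> N f + N h"
  and N_scale: "f \<in> B \<Longrightarrow> N (\<lambda>x. c * f x) = norm c * N f"
  and B_complete: "(\<And>n. u n \<in> B) \<Longrightarrow> (\<forall>e>0. \<exists>K. \<forall>m\<ge>K. \<forall>n\<ge>K. N (\<lambda>x. u m x - u n x) < e) \<Longrightarrow>
          \<exists>h\<in>B. (\<lambda>n. N (\<lambda>x. u n x - h x)) \<longlonglongrightarrow> 0"
  using banach unfolding banach_fun_space_def by (elim conjE; blast)+

lemma one_B: "(\<lambda>x. 1) \<in> B"
  and B_integrable: "f \<in> B \<Longrightarrow> integrable \<nu> f"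
  and L1_le: "\<exists>C. \<forall>f\<in>B. (\<integral>x. norm (f x) \<partial>\<nu>) \<le> C * N f"
  and Q_bounded: "bounded_op B N (Qop Q)"
  and ergodic: "\<exists>\<kappa>0 C. \<kappa>0 < 1 \<and> C \<ge> 0 \<and>
        (\<forall>n\<ge>1. \<forall>f\<in>B. N (\<lambda>x. (Qop Q ^^ n) f x - (\<integral>y. f y \<partial>\<nu>)) \<le> C * \<kappa>0 ^ n * N f)"
  using geom unfolding geom_ergodic_def by (elim conjE; blast)+

lemma bounded_op_linear: "bounded_op B N T \<Longrightarrow> linear_op B T"
  by (simp add: bounded_op_def linear_op_def)

lemma linear_op_mem: "linear_op B T \<Longrightarrow> f \<in> B \<Longrightarrow> T f \<in> B"
  by (simp add: linear_op_def)

lemma linear_op_pow_mem: "linear_op B T \<Longrightarrow> f \<in> B \<Longrightarrow> (T ^^ n) f \<in> B"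
  by (induction n) (auto simp: linear_op_mem)

lemma Q_linear: "linear_op B (Qop Q)"
  by (rule bounded_op_linear[OF Q_bounded])

lemma B_minus: "f \<in> B \<Longrightarrow> h \<in> B \<Longrightarrow> (\<lambda>x. f x - h x) \<in> B"
  using B_add[OF _ B_scale[of h "-1"], of f] by simp

lemma N_minus: "f \<in> B \<Longrightarrow> h \<in> B \<Longrightarrow> N (\<lambda>x. f x - h x) \<le> N f + N h"
  using N_add[OF _ B_scale[of h "-1"], of f] N_scale[of h "-1"] by simp

text \<open>The link with (H3) is that \<open>norm (Q(t) f - Q f)\<close> is at most
  \<open>Q\<close> applied to \<open>norm (exp (i t \<xi>) - 1) * norm f\<close>, and invariance of
  \<open>\<nu>\<close> removes \<open>Q\<close> after integration.\<close>

lemma weak_perturbation_instance: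
  obtains C C1 C3 \<kappa> \<delta>0 where
    "weak_perturbation B N (\<lambda>f. \<integral>x. norm (f x) \<partial>\<nu>) (\<lambda>f. \<integral>x. f x \<partial>\<nu>) (Qop Q) (Qfourier Q \<xi>) (\<lambda>x. 1) C C1 C3 \<kappa> \<delta>0"
proof -
  obtain C1' where "\<forall>f\<in>B. (\<integral>x. norm (f x) \<partial>\<nu>) \<le> C1' * N f"
    using L1_le by blast
  define C1 where "C1 = max C1' 0"
  have C1: "(\<integral>x. norm (f x) \<partial>\<nu>) \<le> C1 * N f" if "f \<in> B" for f
  proof -
    have "C1' * N f \<le> C1 * N f" using N_nonneg[OF that] by (intro mult_right_mono) (auto simp: C1_def)
    with \<open>\<forall>f\<in>B. (\<integral>x. norm (f x) \<partial>\<nu>) \<le> C1' * N f\<close> that show ?thesis by fastforce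
  qed
  obtain \<kappa>0 Ca where a: "\<kappa>0 < 1" "0 \<le> Ca" "\<forall>n\<ge>1. \<forall>f\<in>B. N (\<lambda>x. (Qop Q ^^ n) f x - (\<integral>y. f y \<partial>\<nu>)) \<le> Ca * \<kappa>0 ^ n * N f"
    using ergodic by blast
  have const_B: "(\<lambda>x. c) \<in> B" for c
    using B_scale[OF one_B, of c] by simp
  obtain CP \<kappa>P where P: "1 \<le> CP" "0 \<le> \<kappa>P" "\<kappa>P < 1"
    "\<And>n f. 1 \<le> n \<Longrightarrow> f \<in> B \<Longrightarrow> N (\<lambda>x. (Qop Q ^^ n) f x - (\<integral>y. f y \<partial>\<nu>)) \<le> CP * \<kappa>P ^ n * N f + CP * 0"
  proof (rule nonnegative_rate[OF a(1,2), of "\<lambda>f. f \<in> B" "\<lambda>n f. N (\<lambda>x. (Qop Q ^^ n) f x - (\<integral>y. f y \<partial>\<nu>))" N "\<lambda>_. 0"])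
    show "0 \<le> N (\<lambda>x. (Qop Q ^^ n) f x - (\<integral>y. f y \<partial>\<nu>))" if "f \<in> B" for n f
      by (intro N_nonneg B_minus linear_op_pow_mem Q_linear that const_B)
  qed (use a N_nonneg in auto)
  obtain a b \<kappa>1 Cb where ab: "a < 0" "0 < b" and T_bd: "\<forall>t\<in>{a<..<b}. bounded_op B N (Qfourier Q \<xi> t)"
    and b: "\<kappa>1 < 1" "0 \<le> Cb" "\<forall>n\<ge>1. \<forall>t\<in>{a<..<b}. \<forall>f\<in>B.
              N ((Qfourier Q \<xi> t ^^ n) f) \<le> Cb * \<kappa>1 ^ n * N f + Cb * (\<integral>x. norm (f x) \<partial>\<nu>)"
    using H4 by blast
  have T_lin: "linear_op B (Qfourier Q \<xi> t)" if "t \<in> {a<..<b}" for t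
    using T_bd that by (intro bounded_op_linear) auto
  \<comment> \<open>The lemma on rates is applied to pairs of \<open>t\<close> and \<open>f\<close>,
    so that the new constants are uniform in \<open>t\<close>.\<close>
  obtain CT \<kappa>T where T: "1 \<le> CT" "0 \<le> \<kappa>T" "\<kappa>T < 1"
    "\<And>n z. 1 \<le> n \<Longrightarrow> fst z \<in> {a<..<b} \<and> snd z \<in> B \<Longrightarrow>
       N ((Qfourier Q \<xi> (fst z) ^^ n) (snd z)) \<le> CT * \<kappa>T ^ n * N (snd z) + CT * (\<integral>x. norm (snd z x) \<partial>\<nu>)"
  proof (rule nonnegative_rate[OF b(1,2), of "\<lambda>z. fst z \<in> {a<..<b} \<and> snd z \<in> B"
        "\<lambda>n z. N ((Qfourier Q \<xi> (fst z) ^^ n) (snd z))" "\<lambda>z. N (snd z)" "\<lambda>z. \<integral>x. norm (snd z x) \<partial>\<nu>"])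
    show "0 \<le> N ((Qfourier Q \<xi> (fst z) ^^ n) (snd z))" if "fst z \<in> {a<..<b} \<and> snd z \<in> B" for n z
      using that by (intro N_nonneg linear_op_pow_mem T_lin) auto
  qed (use b N_nonneg in auto)
  obtain C3' \<delta> where \<delta>: "0 < \<delta>" and C3': "\<And>t f. \<bar>t\<bar> < \<delta> \<Longrightarrow> f \<in> B \<Longrightarrow> N f \<le> 1 \<Longrightarrow>
         (\<integral>x. norm (exp (\<i> * complex_of_real (t * \<xi> x)) - 1) * norm (f x) \<partial>\<nu>) \<le> C3' * \<bar>t\<bar>"
    using H3 by blast
  define C3 where "C3 = max C3' 0"
  \<comment> \<open>(H3) is stated on the unit ball; homogeneity extends it, with
    \<open>N f = 0\<close> set apart because of the division.\<close>
  have C3: "(\<integral>x. norm (iexp (t * \<xi> x) - 1) * norm (f x) \<partial>\<nu>) \<le> C3 * \<bar>t\<bar> * N f" if t: "\<bar>t\<bar> < \<delta>" and f: "f \<in> B" for t f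
  proof (cases "N f = 0")
    case True
    then have "f = (\<lambda>x. 0)" using N_eq_0[OF f] by simp
    with True show ?thesis by simp
  next
    case False
    then have Nf: "0 < N f" using N_nonneg[OF f] by simp
    define h where "h = (\<lambda>x. complex_of_real (1 / N f) * f x)"
    have h: "h \<in> B" "N h \<le> 1"
    proof -
      show "h \<in> B" unfolding h_def by (rule B_scale[OF f])
      show "N h \<le> 1" unfolding h_def N_scale[OF f] using Nf by (simp add: norm_divide)
    qed
    have "(\<integral>x. norm (iexp (t * \<xi> x) - 1) * norm (f x) \<partial>\<nu>) = (\<integral>x. N f * (norm (iexp (t * \<xi> x) - 1) * norm (h x)) \<partial>\<nu>)"
      using Nf by (intro Bochner_Integration.integral_cong) (auto simp: h_def norm_mult norm_divide)
    also have "\<dots> = N f * (\<integral>x. norm (iexp (t * \<xi> x) - 1) * norm (h x) \<partial>\<nu>)" by simp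
    also have "\<dots> \<le> N f * (C3' * \<bar>t\<bar>)"
      using Nf by (intro mult_left_mono C3'[OF t h]) auto
    also have "\<dots> \<le> N f * (C3 * \<bar>t\<bar>)"
      using Nf by (intro mult_left_mono mult_right_mono) (auto simp: C3_def)
    finally show ?thesis by (simp add: mult_ac)
  qed
  define C where "C = max CP CT"
  define \<kappa> where "\<kappa> = max \<kappa>P \<kappa>T"
  define \<delta>0 where "\<delta>0 = min \<delta> (min (- a) b)"
  have \<delta>0: "0 < \<delta>0" "\<bar>t\<bar> < \<delta>0 \<Longrightarrow> t \<in> {a<..<b}" "\<bar>t\<bar> < \<delta>0 \<Longrightarrow> \<bar>t\<bar> < \<delta>" for t
    using \<delta> ab by (auto simp: \<delta>0_def)
  have \<kappa>: "0 \<le> \<kappa>" "\<kappa> < 1" using P T by (auto simp: \<kappa>_def)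
  have C: "1 \<le> C" using P by (auto simp: C_def)
  have rate: "C' * \<kappa>' ^ n * N f \<le> C * \<kappa> ^ n * N f" if "0 \<le> C'" "C' \<le> C" "0 \<le> \<kappa>'" "\<kappa>' \<le> \<kappa>" "f \<in> B" for C' \<kappa>' n f
    using that N_nonneg by (intro mult_right_mono mult_mono power_mono) auto
  have "weak_perturbation B N (\<lambda>f. \<integral>x. norm (f x) \<partial>\<nu>) (\<lambda>f. \<integral>x. f x \<partial>\<nu>) (Qop Q) (Qfourier Q \<xi>) (\<lambda>x. 1) C C1 C3 \<kappa> \<delta>0"
  proof
    fix f h :: "'a \<Rightarrow> complex" and c :: complex and t :: real and n :: nat
    show "f \<in> B \<Longrightarrow> h \<in> B \<Longrightarrow> (\<lambda>x. f x + h x) \<in> B" by (rule B_add)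
    show "f \<in> B \<Longrightarrow> (\<lambda>x. c * f x) \<in> B" by (rule B_scale)
    show "f \<in> B \<Longrightarrow> 0 \<le> N f" by (rule N_nonneg)
    show "f \<in> B \<Longrightarrow> h \<in> B \<Longrightarrow> N (\<lambda>x. f x + h x) \<le> N f + N h" by (rule N_add)
    show "f \<in> B \<Longrightarrow> N (\<lambda>x. c * f x) = norm c * N f" by (rule N_scale)
    show "(\<integral>x. norm (f x + h x) \<partial>\<nu>) \<le> (\<integral>x. norm (f x) \<partial>\<nu>) + (\<integral>x. norm (h x) \<partial>\<nu>)" if "f \<in> B" "h \<in> B"
    proof -
      have "(\<integral>x. norm (f x + h x) \<partial>\<nu>) \<le> (\<integral>x. norm (f x) + norm (h x) \<partial>\<nu>)"
        using B_integrable that by (intro integral_mono norm_triangle_ineq) auto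
      then show ?thesis using B_integrable that by simp
    qed
    show "f \<in> B \<Longrightarrow> (\<integral>x. norm (f x) \<partial>\<nu>) \<le> C1 * N f" by (rule C1)
    show "f \<in> B \<Longrightarrow> h \<in> B \<Longrightarrow> (\<integral>x. f x + h x \<partial>\<nu>) = (\<integral>x. f x \<partial>\<nu>) + (\<integral>x. h x \<partial>\<nu>)"
      using B_integrable by simp
    show "(\<integral>x. c * f x \<partial>\<nu>) = c * (\<integral>x. f x \<partial>\<nu>)" by simp
    show "norm (\<integral>x. f x \<partial>\<nu>) \<le> (\<integral>x. norm (f x) \<partial>\<nu>)" by (rule integral_norm_bound)
    show "(\<lambda>x. 1) \<in> B" by (rule one_B)
    show "(\<integral>x. 1 \<partial>\<nu>) = (1 :: complex)" using \<nu>.prob_space by simp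
    show "linear_op B (Qop Q)" by (rule Q_linear)
    show "(\<integral>x. Qop Q f x \<partial>\<nu>) = (\<integral>x. f x \<partial>\<nu>)" if "f \<in> B"
      using integral_Q_integral[OF B_integrable[OF that]] by (simp add: Qop_def)
    show "(\<integral>x. norm (Qop Q f x) \<partial>\<nu>) \<le> (\<integral>x. norm (f x) \<partial>\<nu>)" if f: "f \<in> B"
    proof -
      have n: "integrable \<nu> (\<lambda>x. norm (f x))" using B_integrable[OF f] by simp
      have "(\<integral>x. norm (Qop Q f x) \<partial>\<nu>) \<le> (\<integral>x. \<integral>y. norm (f y) \<partial>Q x \<partial>\<nu>)"
        unfolding Qop_def using integrable_Q_integral[OF n] integrable_Q_integral[OF B_integrable[OF f]]
        by (intro integral_mono integral_norm_bound) auto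
      also have "\<dots> = (\<integral>x. norm (f x) \<partial>\<nu>)" by (rule integral_Q_integral[OF n])
      finally show ?thesis .
    qed
    \<comment> \<open>The abstract setting includes exponent 0, the hypothesis starts at 1; the
      missing case is \<open>1 \<le> C\<close>.\<close>
    show "N ((Qop Q ^^ n) f) \<le> C * \<kappa> ^ n * N f" if f: "f \<in> B" and f0: "(\<integral>x. f x \<partial>\<nu>) = 0"
    proof (cases "n = 0")
      case True
      then show ?thesis using C N_nonneg[OF f] mult_right_mono[of 1 C "N f"] by simp
    next
      case False
      then have "N ((Qop Q ^^ n) f) \<le> CP * \<kappa>P ^ n * N f"
        using P(4)[of n f] f f0 by simp
      also have "\<dots> \<le> C * \<kappa> ^ n * N f"
        using P f by (intro rate) (auto simp: C_def \<kappa>_def)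
      finally show ?thesis .
    qed
    show "linear_op B (Qfourier Q \<xi> t)" if "\<bar>t\<bar> < \<delta>0" using \<delta>0(2)[OF that] by (rule T_lin)
    show "N ((Qfourier Q \<xi> t ^^ n) f) \<le> C * \<kappa> ^ n * N f + C * (\<integral>x. norm (f x) \<partial>\<nu>)" if t: "\<bar>t\<bar> < \<delta>0" and f: "f \<in> B"
    proof (cases "n = 0")
      case True
      have "0 \<le> C * (\<integral>x. norm (f x) \<partial>\<nu>)" using C by (intro mult_nonneg_nonneg) auto
      moreover have "N f \<le> C * N f"
        using C N_nonneg[OF f] mult_right_mono[of 1 C "N f"] by simp
      ultimately show ?thesis
        unfolding True funpow_0 power_0 mult_1_right by linarith
    next
      case False
      then have "N ((Qfourier Q \<xi> t ^^ n) f) \<le> CT * \<kappa>T ^ n * N f + CT * (\<integral>x. norm (f x) \<partial>\<nu>)"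
        using T(4)[of n "(t, f)"] f \<delta>0(2)[OF t] by simp
      also have "\<dots> \<le> C * \<kappa> ^ n * N f + C * (\<integral>x. norm (f x) \<partial>\<nu>)"
        using T f by (intro add_mono rate mult_right_mono) (auto simp: C_def \<kappa>_def)
      finally show ?thesis .
    qed
    show "(\<integral>x. norm (Qfourier Q \<xi> t f x - Qop Q f x) \<partial>\<nu>) \<le> C3 * \<bar>t\<bar> * N f" if t: "\<bar>t\<bar> < \<delta>0" and f: "f \<in> B"
    proof -
      let ?k = "\<lambda>x. norm (iexp (t * \<xi> x) - 1) * norm (f x)"
      note [measurable] = B_meas[OF f]
      have k: "integrable \<nu> ?k"
      proof (rule Bochner_Integration.integrable_bound)
        show "integrable \<nu> (\<lambda>x. 2 * norm (f x))" using B_integrable[OF f] by simp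
        have "norm (iexp (t * \<xi> x) - 1) \<le> 2" for x
          using norm_triangle_ineq4[of "iexp (t * \<xi> x)" 1] by simp
        then show "AE x in \<nu>. norm (?k x) \<le> norm (2 * norm (f x))"
          by (intro AE_I2) (simp add: abs_mult mult_right_mono)
      qed measurable
      \<comment> \<open>Subtracting the two integrals is legitimate only where \<open>f\<close> is
        integrable for \<open>Q x\<close>, which holds for almost every \<open>x\<close>.\<close>
      have "AE x in \<nu>. norm (Qfourier Q \<xi> t f x - Qop Q f x) \<le> (\<integral>y. ?k y \<partial>Q x)"
        using AE_integrable_Q[OF B_integrable[OF f]] AE_space
      proof eventually_elim
        case (elim x)
        then have x: "x \<in> space E" by (simp add: space_\<nu>)
        have [measurable]: "\<xi> \<in> borel_measurable (Q x)" "f \<in> borel_measurable (Q x)"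
          by (subst measurable_cong_sets[OF Q_sets[OF x] refl], measurable)+
        have i: "integrable (Q x) (\<lambda>y. iexp (t * \<xi> y) * f y)"
          by (rule Bochner_Integration.integrable_bound[OF elim(1)]) (auto simp: norm_mult intro!: AE_I2)
        have "Qfourier Q \<xi> t f x - Qop Q f x = (\<integral>y. (iexp (t * \<xi> y) - 1) * f y \<partial>Q x)"
          unfolding Qfourier_def Qop_def left_diff_distrib using i elim(1) by simp
        also have "norm \<dots> \<le> (\<integral>y. norm ((iexp (t * \<xi> y) - 1) * f y) \<partial>Q x)"
          by (rule integral_norm_bound)
        finally show ?case by (simp add: norm_mult)
      qed
      then have "(\<integral>x. norm (Qfourier Q \<xi> t f x - Qop Q f x) \<partial>\<nu>) \<le> (\<integral>x. \<integral>y. ?k y \<partial>Q x \<partial>\<nu>)"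
        using integrable_Q_integral[OF k]
        by (intro integral_mono_AE integrable_norm B_integrable B_minus linear_op_mem[OF T_lin[OF \<delta>0(2)[OF t]] f] linear_op_mem[OF Q_linear f])
      also have "\<dots> = (\<integral>x. ?k x \<partial>\<nu>)" by (rule integral_Q_integral[OF k])
      also have "\<dots> \<le> C3 * \<bar>t\<bar> * N f" by (rule C3[OF \<delta>0(3)[OF t] f])
      finally show ?thesis .
    qed
  qed (use C \<kappa> \<delta>0(1) in \<open>auto simp: C1_def C3_def\<close>)
  then show thesis by (rule that)
qed

text \<open>The general test function \<open>f\<close> is needed for the induction: integrating out
  the last step replaces \<open>f\<close> by \<open>Qfourier Q \<xi> t f\<close> and lowers
  \<open>n\<close> by one. The case \<open>f = 1\<close> is the characteristic function.\<close>

lemma char_eq_operator: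
  assumes T: "linear_op B (Qfourier Q \<xi> t)" and f: "f \<in> B"
  shows "(\<integral>\<omega>. iexp (t * (\<Sum>k=1..n. \<xi> (X k \<omega>))) * f (X n \<omega>) \<partial>M) = (\<integral>x. (Qfourier Q \<xi> t ^^ n) f x \<partial>\<nu>)"
  using f
proof (induction n arbitrary: f)
  case 0
  then show ?case using integral_X[OF B_integrable] by simp
next
  case (Suc n)
  let ?W = "\<lambda>\<omega>. iexp (t * (\<Sum>k=1..n. \<xi> (X k \<omega>)))"
  note [measurable] = B_meas[OF Suc.prems]
  have "(\<lambda>\<omega>. \<Sum>k=1..n. \<xi> (X k \<omega>)) \<in> borel_measurable (past M E X n)"
  proof (rule borel_measurable_sum)
    fix k assume "k \<in> {1..n}"
    then have [measurable]: "X k \<in> measurable (past M E X n) E"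
      by (auto intro!: measurable_past X_measurable)
    show "(\<lambda>\<omega>. \<xi> (X k \<omega>)) \<in> borel_measurable (past M E X n)" by measurable
  qed
  then have W: "?W \<in> borel_measurable (past M E X n)" by measurable
  have int: "integrable M (\<lambda>\<omega>. ?W \<omega> * (\<lambda>z. iexp (t * \<xi> (snd z)) * f (snd z)) (X n \<omega>, X (Suc n) \<omega>))"
    using integrable_X[OF B_integrable[OF Suc.prems], of "Suc n"]
    by (rule Bochner_Integration.integrable_bound) (auto simp: norm_mult)
  have "(\<integral>\<omega>. iexp (t * (\<Sum>k=1..Suc n. \<xi> (X k \<omega>))) * f (X (Suc n) \<omega>) \<partial>M)
     = (\<integral>\<omega>. ?W \<omega> * (\<lambda>z. iexp (t * \<xi> (snd z)) * f (snd z)) (X n \<omega>, X (Suc n) \<omega>) \<partial>M)"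
    by (intro Bochner_Integration.integral_cong refl) (simp add: distrib_left exp_add mult_ac)
  also have "\<dots> = (\<integral>\<omega>. ?W \<omega> * (\<integral>y. (\<lambda>z. iexp (t * \<xi> (snd z)) * f (snd z)) (X n \<omega>, y) \<partial>Q (X n \<omega>)) \<partial>M)"
    by (rule markov_property[OF W _ int]) measurable
  also have "\<dots> = (\<integral>\<omega>. ?W \<omega> * Qfourier Q \<xi> t f (X n \<omega>) \<partial>M)"
    by (simp add: Qfourier_def)
  also have "\<dots> = (\<integral>x. (Qfourier Q \<xi> t ^^ n) (Qfourier Q \<xi> t f) x \<partial>\<nu>)"
    by (intro Suc.IH linear_op_mem[OF T Suc.prems])
  finally show ?case by (simp add: funpow_swap1)
qed

end

section \<open>Esseen's smoothing inequality\<close>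

lemma (in pair_sigma_finite) integrable_pair_bound:
  fixes f :: "'a \<times> 'b \<Rightarrow> 'c::{banach, second_countable_topology}" and g :: "'a \<Rightarrow> real" and h :: "'b \<Rightarrow> real"
  assumes f [measurable]: "f \<in> borel_measurable (M1 \<Otimes>\<^sub>M M2)" and g: "integrable M1 g" and h: "integrable M2 h"
    and le: "\<And>x y. x \<in> space M1 \<Longrightarrow> y \<in> space M2 \<Longrightarrow> norm (f (x, y)) \<le> g x * h y"
  shows "integrable (M1 \<Otimes>\<^sub>M M2) f"
proof -
  have [measurable]: "g \<in> borel_measurable M1" "h \<in> borel_measurable M2"
    using g h by auto
  have "integrable (M1 \<Otimes>\<^sub>M M2) (\<lambda>(x, y). g x * h y)"
  proof (rule Fubini_integrable)
    have "integrable M1 (\<lambda>x. norm (g x) * (\<integral>y. norm (h y) \<partial>M2))"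
      using g by (intro integrable_mult_left integrable_norm)
    then show "integrable M1 (\<lambda>x. \<integral>y. norm (case (x, y) of (x, y) \<Rightarrow> g x * h y) \<partial>M2)"
      by (simp add: abs_mult)
    show "AE x in M1. integrable M2 (\<lambda>y. case (x, y) of (x, y) \<Rightarrow> g x * h y)"
      using h by (intro AE_I2) simp
  qed measurable
  then show ?thesis
    by (rule Bochner_Integration.integrable_bound)
      (use le in \<open>auto simp: space_pair_measure intro!: AE_I2 order_trans[OF le]\<close>)
qed

section \<open>The Fejer kernel\<close>

definition triangle :: "real \<Rightarrow> real" where
  "triangle t = max 0 (1 - \<bar>t\<bar>)"

text \<open>The Fejer kernel \<open>(sin (x / 2) / (x / 2))^2\<close>, given as the Fourier
  transform of \<open>triangle\<close>. It is nonnegative and integrable, and since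
  \<open>triangle\<close> is supported in \<open>[-1, 1]\<close>, smoothing at scale
  \<open>1/T\<close> sees characteristic functions only on \<open>[-T, T]\<close>.\<close>

definition fejer :: "real \<Rightarrow> real" where
  "fejer x = (\<integral>t. triangle t * cos (t * x) \<partial>lborel)"

lemma triangle_measurable [measurable]: "triangle \<in> borel_measurable borel"
  unfolding triangle_def [abs_def] by measurable

lemma triangle_bounds: "0 \<le> triangle t" "triangle t \<le> indicator {-1..1} t"
  by (auto simp: triangle_def split: split_indicator)

lemma integrable_indicator_interval [simp, intro]: "integrable lborel (indicator {a..b::real} :: real \<Rightarrow> real)"
  by (simp add: integrable_indicator_iff emeasure_lborel_Icc_eq)

lemma integrable_triangle: "integrable lborel triangle"
  using triangle_bounds by (intro Bochner_Integration.integrable_bound[of lborel "indicator {-1..1} :: real \<Rightarrow> real" triangle]) auto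

lemma fejer_measurable [measurable]: "fejer \<in> borel_measurable borel"
  unfolding fejer_def [abs_def] by measurable

lemma integrable_triangle_cos: "integrable lborel (\<lambda>t. triangle t * cos (t * x))"
  by (rule Bochner_Integration.integrable_bound[OF integrable_triangle])
    (auto intro!: AE_I2 simp: abs_mult mult_left_le)

text \<open>Integration by parts on each half of the triangle. The case \<open>x = 0\<close> must be
  excluded: there the integral is 1 but the quotient is 0 by convention.\<close>

lemma fejer_eq:
  assumes x: "x \<noteq> 0"
  shows "fejer x = 2 * (1 - cos x) / x\<^sup>2"
proof -
  have 1: "(\<integral>t. indicator {0..1} t *\<^sub>R ((1 - t) * cos (t * x)) \<partial>lborel) = (1 - cos x) / x\<^sup>2"
  proof -
    have "(\<integral>t. indicator {0..1} t *\<^sub>R ((1 - t) * cos (t * x)) \<partial>lborel) =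
      ((1 - 1) * sin (1 * x) / x - cos (1 * x) / x\<^sup>2) - ((1 - 0) * sin (0 * x) / x - cos (0 * x) / x\<^sup>2)"
    proof (rule integral_FTC_atLeastAtMost)
      show "((\<lambda>t. (1 - t) * sin (t * x) / x - cos (t * x) / x\<^sup>2) has_vector_derivative (1 - t) * cos (t * x))
          (at t within {0..1})" for t
        unfolding has_real_derivative_iff_has_vector_derivative[symmetric] using x
        by (auto intro!: derivative_eq_intros simp: field_simps power2_eq_square)
    qed (auto intro!: continuous_intros)
    then show ?thesis by (simp add: diff_divide_distrib)
  qed
  have 2: "(\<integral>t. indicator {-1..0} t *\<^sub>R ((1 + t) * cos (t * x)) \<partial>lborel) = (1 - cos x) / x\<^sup>2"
  proof -
    have "(\<integral>t. indicator {-1..0} t *\<^sub>R ((1 + t) * cos (t * x)) \<partial>lborel) =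
      ((1 + 0) * sin (0 * x) / x + cos (0 * x) / x\<^sup>2) - ((1 + -1) * sin (-1 * x) / x + cos (-1 * x) / x\<^sup>2)"
    proof (rule integral_FTC_atLeastAtMost)
      show "((\<lambda>t. (1 + t) * sin (t * x) / x + cos (t * x) / x\<^sup>2) has_vector_derivative (1 + t) * cos (t * x))
          (at t within {-1..0})" for t
        unfolding has_real_derivative_iff_has_vector_derivative[symmetric] using x
        by (auto intro!: derivative_eq_intros simp: field_simps power2_eq_square)
    qed (auto intro!: continuous_intros)
    then show ?thesis by (simp add: diff_divide_distrib)
  qed
  have i1: "integrable lborel (\<lambda>t. indicator {0..1} t *\<^sub>R ((1 - t) * cos (t * x)))"
    and i2: "integrable lborel (\<lambda>t. indicator {-1..0} t *\<^sub>R ((1 + t) * cos (t * x)))"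
    by (intro borel_integrable_compact continuous_intros compact_Icc)+
  have "fejer x = (\<integral>t. indicator {0..1} t *\<^sub>R ((1 - t) * cos (t * x)) + indicator {-1..0} t *\<^sub>R ((1 + t) * cos (t * x)) \<partial>lborel)"
    unfolding fejer_def
  proof (rule integral_cong_AE)
    show "AE t in lborel. triangle t * cos (t * x) =
        indicator {0..1} t *\<^sub>R ((1 - t) * cos (t * x)) + indicator {-1..0} t *\<^sub>R ((1 + t) * cos (t * x))"
      using AE_lborel_singleton[of 0]
      by eventually_elim (auto simp: triangle_def split: split_indicator)
  qed measurable
  also have "\<dots> = 2 * (1 - cos x) / x\<^sup>2"
    unfolding Bochner_Integration.integral_add[OF i1 i2] 1 2 by (simp add: add_divide_distrib[symmetric])
  finally show ?thesis .
qed

lemma fejer_nonneg: "0 \<le> fejer x"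
proof (cases "x = 0")
  case True
  then show ?thesis
    using triangle_bounds by (auto simp: fejer_def intro!: Bochner_Integration.integral_nonneg)
next
  case False
  then show ?thesis by (simp add: fejer_eq)
qed

lemma fejer_le: "x \<noteq> 0 \<Longrightarrow> fejer x \<le> 4 / x\<^sup>2"
  by (simp add: fejer_eq divide_right_mono) (smt (verit) cos_ge_minus_one divide_right_mono zero_le_power2)

lemma cos_ge_half:
  fixes y :: real assumes "\<bar>y\<bar> \<le> 1" shows "1/2 \<le> cos y"
proof -
  have "cos (pi/3) \<le> cos \<bar>y\<bar>"
    using assms pi_gt3 by (intro cos_monotone_0_pi_le) auto
  then show ?thesis by (simp add: cos_60)
qed

lemma fejer_le_2: "fejer x \<le> 2"
proof -
  have "fejer x \<le> (\<integral>t. indicator {-1..1::real} t \<partial>lborel)"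
    unfolding fejer_def
  proof (intro integral_mono integrable_triangle_cos integrable_indicator_interval)
    fix t :: real
    have "triangle t * cos (t * x) \<le> triangle t * 1"
      by (intro mult_left_mono triangle_bounds) auto
    with triangle_bounds(2)[of t] show "triangle t * cos (t * x) \<le> indicator {-1..1} t" by simp
  qed
  then show ?thesis by simp
qed

text \<open>The value \<open>1/4\<close> is crude: on \<open>[-1/2, 1/2]\<close>, an interval of
  length 1, both the triangle and the cosine are at least \<open>1/2\<close>.\<close>

lemma fejer_ge:
  assumes "\<bar>x\<bar> \<le> 1"
  shows "1/4 \<le> fejer x"
proof -
  have "(1/4 :: real) = (\<integral>t. indicator {-1/2..1/2::real} t * (1/4) \<partial>lborel)"
    by simp
  also have "\<dots> \<le> fejer x"
    unfolding fejer_def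
  proof (rule integral_mono[OF _ integrable_triangle_cos])
    fix t :: real
    show "indicator {-1/2..1/2} t * (1/4) \<le> triangle t * cos (t * x)"
    proof (cases "\<bar>t\<bar> \<le> 1")
      case True
      then have c: "1/2 \<le> cos (t * x)"
        using assms by (intro cos_ge_half) (simp add: abs_mult mult_le_one)
      have "indicator {-1/2..1/2} t * (1/4) \<le> triangle t * (1/2)"
        by (auto simp: triangle_def split: split_indicator)
      also have "\<dots> \<le> triangle t * cos (t * x)"
        by (intro mult_left_mono c triangle_bounds)
      finally show ?thesis .
    next
      case False
      then show ?thesis by (auto simp: triangle_def split: split_indicator)
    qed
  qed (intro integrable_mult_left integrable_indicator_interval)
  finally show ?thesis .
qed

lemma has_bochner_integral_inverse_square_tail:
  fixes h :: real assumes h: "0 < h"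
  shows "has_bochner_integral lborel (\<lambda>y::real. indicator {y. h \<le> \<bar>y\<bar>} y / y\<^sup>2) (2 / h :: real)"
proof -
  have eq: "(\<integral>\<^sup>+y. ennreal (1 / y\<^sup>2) * indicator {h..} y \<partial>lborel) = ennreal (0 - (- 1 / h))"
  proof (rule nn_integral_FTC_atLeast)
    show "DERIV (\<lambda>y. - 1 / y) y :> 1 / y\<^sup>2" if "h \<le> y" for y
      using that h by (auto intro!: derivative_eq_intros simp: power2_eq_square)
    show "((\<lambda>y::real. - 1 / y) \<longlongrightarrow> 0) at_top"
      by (intro tendsto_divide_0[OF tendsto_const] filterlim_at_top_imp_at_infinity filterlim_ident)
  qed auto
  have pos: "has_bochner_integral lborel (\<lambda>y::real. indicator {h..} y / y\<^sup>2) (1 / h :: real)"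
  proof (rule has_bochner_integral_nn_integral)
    have "(\<integral>\<^sup>+y. ennreal (indicator {h..} y / y\<^sup>2) \<partial>lborel) = (\<integral>\<^sup>+y. ennreal (1 / y\<^sup>2) * indicator {h..} y \<partial>lborel)"
      by (intro nn_integral_cong) (simp split: split_indicator)
    then show "(\<integral>\<^sup>+y. ennreal (indicator {h..} y / y\<^sup>2) \<partial>lborel) = ennreal (1 / h)"
      using eq by simp
  qed (use h in auto)
  have neg: "has_bochner_integral lborel (\<lambda>y::real. indicator {..-h} y / y\<^sup>2) (1 / h :: real)"
  proof -
    have "has_bochner_integral lborel (\<lambda>y. indicator {h..} (0 + (-1) * y) / (0 + (-1) * y)\<^sup>2) ((1 / h :: real) /\<^sub>R \<bar>-1\<bar>)"
      by (rule lborel_has_bochner_integral_real_affine_iff[THEN iffD1, OF _ pos]) simp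
    moreover have "(\<lambda>y. indicator {h..} (0 + (-1) * y) / (0 + (-1) * y)\<^sup>2) = (\<lambda>y. indicator {..-h} y / y\<^sup>2 :: real)"
      by (auto simp: fun_eq_iff split: split_indicator)
    ultimately show ?thesis by simp
  qed
  have "(\<lambda>y. indicator {y. h \<le> \<bar>y\<bar>} y / y\<^sup>2) = (\<lambda>y. indicator {h..} y / y\<^sup>2 + indicator {..-h} y / y\<^sup>2 :: real)"
    using h by (auto simp: fun_eq_iff split: split_indicator)
  then show ?thesis
    using has_bochner_integral_add[OF pos neg] by simp
qed

lemma integrable_fejer: "integrable lborel fejer"
proof (rule Bochner_Integration.integrable_bound)
  show "integrable lborel (\<lambda>y. 2 * indicator {-1..1} y + 4 * (indicator {y. 1 \<le> \<bar>y\<bar>} y / y\<^sup>2) :: real)"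
    by (intro Bochner_Integration.integrable_add integrable_mult_right integrable_indicator_interval
        integrable.intros[OF has_bochner_integral_inverse_square_tail]) simp
  show "AE y in lborel. norm (fejer y) \<le> norm (2 * indicator {-1..1} y + 4 * (indicator {y. 1 \<le> \<bar>y\<bar>} y / y\<^sup>2) :: real)"
  proof (intro AE_I2)
    fix y :: real
    show "norm (fejer y) \<le> norm (2 * indicator {-1..1} y + 4 * (indicator {y. 1 \<le> \<bar>y\<bar>} y / y\<^sup>2) :: real)"
    proof (cases "\<bar>y\<bar> \<le> 1")
      case True
      then have "indicator {-1..1} y = (1::real)" by (simp add: abs_le_iff)
      then show ?thesis
        using fejer_nonneg[of y] fejer_le_2[of y] order_trans[OF fejer_le_2[of y], of "2 + 4 / y\<^sup>2"]
        by (auto split: split_indicator)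
    next
      case False
      then have "y \<noteq> 0" by auto
      then show ?thesis
        using fejer_nonneg[of y] fejer_le[of y] False by (auto split: split_indicator)
    qed
  qed
qed measurable

text \<open>The bound does not depend on the interval, which later allows \<open>a\<close> to tend
  to minus infinity. Multiplying by \<open>\<bar>s\<bar>\<close> instead of dividing includes
  \<open>s = 0\<close>.\<close>

lemma oscillatory_integral_bound:
  fixes a b s :: real
  assumes ab: "a \<le> b"
  shows "norm (\<integral>u. indicator {a<..b} u *\<^sub>R iexp (s * u) \<partial>lborel) * \<bar>s\<bar> \<le> 2"
proof (cases "s = 0")
  case False
  have "(\<integral>u. indicator {a<..b} u *\<^sub>R iexp (s * u) \<partial>lborel) = (\<integral>u. indicator {a..b} u *\<^sub>R iexp (s * u) \<partial>lborel)"
  proof (rule integral_cong_AE)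
    show "AE u in lborel. indicator {a<..b} u *\<^sub>R iexp (s * u) = indicator {a..b} u *\<^sub>R iexp (s * u)"
      using AE_lborel_singleton[of a] by eventually_elim (auto split: split_indicator)
  qed measurable
  also have "\<dots> = iexp (s * b) / (\<i> * s) - iexp (s * a) / (\<i> * s)"
  proof (rule integral_FTC_atLeastAtMost[OF ab])
    show "((\<lambda>u. iexp (s * u) / (\<i> * s)) has_vector_derivative iexp (s * u)) (at u within {a..b})" for u
    proof -
      have "((\<lambda>z. exp (\<i> * (of_real s * z)) / (\<i> * of_real s)) has_field_derivative exp (\<i> * (of_real s * of_real u)))
          (at (of_real u))"
        using False by (auto intro!: derivative_eq_intros simp: mult_ac)
      from has_vector_derivative_real_field[OF this] show ?thesis
        by simp
    qed
  qed (auto intro!: continuous_intros)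
  finally have "norm (\<integral>u. indicator {a<..b} u *\<^sub>R iexp (s * u) \<partial>lborel) \<le> 1 / \<bar>s\<bar> + 1 / \<bar>s\<bar>"
    by (simp only:) (rule order_trans[OF norm_triangle_ineq4], simp add: norm_divide norm_mult)
  then show ?thesis
    using False by (simp add: field_simps)
qed simp

section \<open>Smoothing of distribution functions and Esseen's inequality\<close>

definition osc :: "real \<Rightarrow> real \<Rightarrow> real \<Rightarrow> complex" where
  "osc a b s = (\<integral>u. indicator {a<..b} u *\<^sub>R iexp (s * u) \<partial>lborel)"

lemma osc_measurable [measurable]: "osc a b \<in> borel_measurable borel"
  unfolding osc_def [abs_def] by measurable

lemma integrable_indicator_Ioc [intro]: "integrable lborel (indicator {a<..b::real} :: real \<Rightarrow> real)"
  by (cases "a \<le> b") (simp_all add: integrable_indicator_iff)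

lemma norm_osc_le: "norm (osc a b s) \<le> (\<integral>u. indicator {a<..b} u \<partial>lborel)"
  unfolding osc_def by (rule order_trans[OF integral_norm_bound]) simp

lemma Re_iexp [simp]: "Re (iexp x) = cos x"
  by (simp add: Re_exp)

lemma integrable_fejer_scaled: "T \<noteq> 0 \<Longrightarrow> integrable lborel (\<lambda>y. fejer (T * y))"
  using lborel_integrable_real_affine[OF integrable_fejer, of T 0] by simp

text \<open>A Parseval identity: both sides are the \<open>M\<close>-mean of the kernel smoothed
  over the interval from \<open>a\<close> to \<open>b\<close>, expressed once through probabilities
  and once through Fourier transforms. Increments are used because a distribution function itself
  has no integrable Fourier representation on the whole line.\<close>

lemma (in real_distribution) fejer_smoothing_identity:
  assumes ab: "a < b" and T: "0 < T"
  shows "(\<integral>y. fejer (T * y) * (cdf M (b - y) - cdf M (a - y)) \<partial>lborel)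
    = (\<integral>t. triangle t * Re (char M (- (t * T)) * osc a b (t * T)) \<partial>lborel)"
proof -
  interpret LM: pair_sigma_finite lborel M ..
  have one: "integrable M (\<lambda>_. 1 :: real)" by simp
  have M [measurable_cong]: "sets M = sets borel" by (rule events_eq_borel)
  define K where "K x = (\<integral>u. indicator {a<..b} u * fejer (T * (u - x)) \<partial>lborel)" for x
  have shift: "K x = (\<integral>y. indicator {a<..b} (x + y) * fejer (T * y) \<partial>lborel)" for x
    unfolding K_def by (subst lborel_integral_real_affine[of 1 _ x]) simp_all
  have "(\<integral>y. fejer (T * y) * (cdf M (b - y) - cdf M (a - y)) \<partial>lborel)
     = (\<integral>y. \<integral>x. indicator {a<..b} (x + y) * fejer (T * y) \<partial>M \<partial>lborel)"
  proof (rule Bochner_Integration.integral_cong[OF refl])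
    fix y
    have "(\<integral>x. indicator {a<..b} (x + y) * fejer (T * y) \<partial>M) = (\<integral>x. indicator {a - y<..b - y} x * fejer (T * y) \<partial>M)"
      by (intro Bochner_Integration.integral_cong) (auto split: split_indicator)
    also have "\<dots> = fejer (T * y) * measure M {a - y<..b - y}"
      by simp
    also have "measure M {a - y<..b - y} = cdf M (b - y) - cdf M (a - y)"
      using ab by (intro cdf_diff_eq[symmetric]) simp
    finally show "fejer (T * y) * (cdf M (b - y) - cdf M (a - y)) = (\<integral>x. indicator {a<..b} (x + y) * fejer (T * y) \<partial>M)" ..
  qed
  also have "\<dots> = (\<integral>x. K x \<partial>M)"
    unfolding shift
  proof (rule LM.Fubini_integral[symmetric])
    show "integrable (lborel \<Otimes>\<^sub>M M) (\<lambda>(y, x). indicator {a<..b} (x + y) * fejer (T * y))"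
      using T by (intro LM.integrable_pair_bound[OF _ integrable_fejer_scaled[of T] one])
        (auto simp: fejer_nonneg split: split_indicator)
  qed
  also have "\<dots> = (\<integral>x. \<integral>t. triangle t * Re (iexp (- (t * T) * x) * osc a b (t * T)) \<partial>lborel \<partial>M)"
  proof (rule Bochner_Integration.integral_cong[OF refl])
    fix x
    have "K x = (\<integral>u. \<integral>t. indicator {a<..b} u * (triangle t * cos (t * (T * (u - x)))) \<partial>lborel \<partial>lborel)"
      unfolding K_def fejer_def by simp
    also have "\<dots> = (\<integral>t. \<integral>u. indicator {a<..b} u * (triangle t * cos (t * (T * (u - x)))) \<partial>lborel \<partial>lborel)"
    proof (rule lborel_pair.Fubini_integral[symmetric])
      show "integrable (lborel \<Otimes>\<^sub>M lborel) (\<lambda>(u, t). indicator {a<..b} u * (triangle t * cos (t * (T * (u - x)))))"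
        by (intro lborel_pair.integrable_pair_bound[OF _ integrable_indicator_Ioc[of a b] integrable_triangle])
          (auto simp: abs_mult triangle_bounds mult_left_le split: split_indicator)
    qed
    also have "\<dots> = (\<integral>t. triangle t * Re (iexp (- (t * T) * x) * osc a b (t * T)) \<partial>lborel)"
    proof (rule Bochner_Integration.integral_cong[OF refl])
      fix t
      have "iexp (- (t * T) * x) * osc a b (t * T) = (\<integral>u. iexp (- (t * T) * x) * (indicator {a<..b} u *\<^sub>R iexp (t * T * u)) \<partial>lborel)"
        unfolding osc_def by (rule integral_mult_right_zero[symmetric])
      also have "\<dots> = (\<integral>u. indicator {a<..b} u *\<^sub>R iexp (t * (T * (u - x))) \<partial>lborel)"
        by (intro Bochner_Integration.integral_cong refl) (simp add: mult_exp_exp algebra_simps)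
      finally have eq: "iexp (- (t * T) * x) * osc a b (t * T) = \<dots>" .
      have "integrable lborel (\<lambda>u. indicator {a<..b} u *\<^sub>R iexp (t * (T * (u - x))))"
        by (rule Bochner_Integration.integrable_bound[OF integrable_indicator_Ioc[of a b]]) (auto intro!: AE_I2)
      from integral_Re[OF this] have "Re (iexp (- (t * T) * x) * osc a b (t * T)) = (\<integral>u. indicator {a<..b} u * cos (t * (T * (u - x))) \<partial>lborel)"
        unfolding eq by (simp only: scaleR_complex.sel Re_iexp)
      then have "triangle t * Re (iexp (- (t * T) * x) * osc a b (t * T)) = (\<integral>u. triangle t * (indicator {a<..b} u * cos (t * (T * (u - x)))) \<partial>lborel)"
        by simp
      also have "\<dots> = (\<integral>u. indicator {a<..b} u * (triangle t * cos (t * (T * (u - x)))) \<partial>lborel)"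
        by (intro Bochner_Integration.integral_cong refl) (simp only: mult_ac)
      finally show "(\<integral>u. indicator {a<..b} u * (triangle t * cos (t * (T * (u - x)))) \<partial>lborel)
          = triangle t * Re (iexp (- (t * T) * x) * osc a b (t * T))" ..
    qed
    finally show "K x = (\<integral>t. triangle t * Re (iexp (- (t * T) * x) * osc a b (t * T)) \<partial>lborel)" .
  qed
  also have "\<dots> = (\<integral>t. \<integral>x. triangle t * Re (iexp (- (t * T) * x) * osc a b (t * T)) \<partial>M \<partial>lborel)"
  proof (rule LM.Fubini_integral)
    let ?c = "\<integral>u. indicator {a<..b} u \<partial>lborel :: real"
    have "norm (triangle t * Re (iexp (- (t * T) * x) * osc a b (t * T))) \<le> triangle t * ?c" for t x
    proof -
      have "\<bar>Re (iexp (- (t * T) * x) * osc a b (t * T))\<bar> \<le> norm (iexp (- (t * T) * x) * osc a b (t * T))"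
        by (rule abs_Re_le_cmod)
      also have "\<dots> \<le> ?c"
        using norm_osc_le by (simp add: norm_mult)
      finally show ?thesis
        by (simp add: abs_mult triangle_bounds mult_left_mono)
    qed
    then show "integrable (lborel \<Otimes>\<^sub>M M) (\<lambda>(t, x). triangle t * Re (iexp (- (t * T) * x) * osc a b (t * T)))"
      by (intro LM.integrable_pair_bound[OF _ integrable_triangle, of _ "\<lambda>_. ?c"]) (auto simp del: integral_indicator)
  qed
  also have "\<dots> = (\<integral>t. triangle t * Re (char M (- (t * T)) * osc a b (t * T)) \<partial>lborel)"
  proof (rule Bochner_Integration.integral_cong[OF refl])
    fix t
    have i: "integrable M (\<lambda>x. iexp (- (t * T) * x))"
      by (rule integrable_iexp) measurable
    have "Re (char M (- (t * T)) * osc a b (t * T)) = (\<integral>x. Re (iexp (- (t * T) * x) * osc a b (t * T)) \<partial>M)"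
      unfolding char_def integral_mult_left_zero[symmetric]
      by (rule integral_Re[symmetric]) (rule integrable_mult_left[OF i])
    then show "(\<integral>x. triangle t * Re (iexp (- (t * T) * x) * osc a b (t * T)) \<partial>M)
        = triangle t * Re (char M (- (t * T)) * osc a b (t * T))"
      by simp
  qed
  finally show ?thesis .
qed

lemma (in real_distribution) integrable_triangle_char:
  "integrable lborel (\<lambda>t. triangle t * Re (char M (- (t * T)) * osc a b (t * T)))"
proof (rule Bochner_Integration.integrable_bound)
  let ?c = "\<integral>u. indicator {a<..b} u \<partial>lborel :: real"
  show "integrable lborel (\<lambda>t. triangle t * ?c)"
    by (intro integrable_mult_left integrable_triangle)
  show "AE t in lborel. norm (triangle t * Re (char M (- (t * T)) * osc a b (t * T))) \<le> norm (triangle t * ?c)"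
  proof (intro AE_I2)
    fix t
    have "\<bar>Re (char M (- (t * T)) * osc a b (t * T))\<bar> \<le> norm (char M (- (t * T)) * osc a b (t * T))"
      by (rule abs_Re_le_cmod)
    also have "\<dots> \<le> 1 * ?c"
      unfolding norm_mult by (intro mult_mono cmod_char_le_1 norm_osc_le) auto
    finally show "norm (triangle t * Re (char M (- (t * T)) * osc a b (t * T))) \<le> norm (triangle t * ?c)"
      using triangle_bounds(1)[of t] by (simp add: abs_mult mult_left_mono del: integral_indicator)
  qed
qed measurable

lemma cdf_measurable:
  assumes "real_distribution F" shows "(\<lambda>y. cdf F (c - y)) \<in> borel_measurable borel"
proof -
  interpret real_distribution F by fact
  have "cdf F \<in> borel_measurable borel"
    by (intro borel_measurable_mono monoI cdf_nondecreasing)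
  then show ?thesis by measurable
qed

text \<open>The factor \<open>\<bar>s\<bar>\<close> in the assumption on the characteristic
  functions cancels the singularity of the Fourier transform of an interval, so the bound for
  increments from \<open>a\<close> to \<open>b\<close> is uniform in \<open>a\<close>; the left
  endpoint is then sent to minus infinity.\<close>

lemma smoothed_cdf_difference:
  assumes F: "real_distribution F" and G: "real_distribution G" and T: "0 < T"
    and k: "integrable lborel k" "\<And>s. 0 \<le> k s"
    and char: "\<And>s. \<bar>s\<bar> \<le> T \<Longrightarrow> norm (char F s - char G s) \<le> \<bar>s\<bar> * k s"
  shows "\<bar>\<integral>y. fejer (T * y) * (cdf F (b - y) - cdf G (b - y)) \<partial>lborel\<bar> \<le> 2 / T * (\<integral>s. k s \<partial>lborel)"
proof -
  interpret F: real_distribution F by fact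
  interpret G: real_distribution G by fact
  note [measurable] = cdf_measurable[OF F] cdf_measurable[OF G]
  define \<Delta> where "\<Delta> x = cdf F x - cdf G x" for x
  have \<Delta>: "\<bar>\<Delta> x\<bar> \<le> 1" for x
    using F.cdf_nonneg[of x] F.cdf_bounded_prob[of x] G.cdf_nonneg[of x] G.cdf_bounded_prob[of x]
    unfolding \<Delta>_def by linarith
  have \<Delta>_meas [measurable]: "(\<lambda>y. \<Delta> (c - y)) \<in> borel_measurable borel" for c
    unfolding \<Delta>_def by measurable
  have int: "integrable lborel (\<lambda>y. fejer (T * y) * \<Delta> (c - y))" for c
    using T \<Delta> by (intro Bochner_Integration.integrable_bound[OF integrable_fejer_scaled[of T]])
      (auto simp: abs_mult mult_left_le intro!: AE_I2)
  have intc: "integrable lborel (\<lambda>y. fejer (T * y) * cdf D (c - y))" if D: "real_distribution D" for D c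
  proof -
    interpret D: real_distribution D by fact
    show ?thesis
      using T D.cdf_nonneg D.cdf_bounded_prob cdf_measurable[OF D]
      by (intro Bochner_Integration.integrable_bound[OF integrable_fejer_scaled[of T]])
        (auto simp: abs_mult mult_left_le intro!: AE_I2)
  qed
  have k_scaled: "integrable lborel (\<lambda>t. k (- (t * T)))" and k_int: "(\<integral>t. k (- (t * T)) \<partial>lborel) = (\<integral>s. k s \<partial>lborel) / T"
    using lborel_integrable_real_affine[OF k(1), of "-T" 0] lborel_integral_real_affine[of "-T" k 0] T
    by (simp_all add: mult.commute field_simps)
  have diff: "\<bar>(\<integral>y. fejer (T * y) * \<Delta> (b - y) \<partial>lborel) - (\<integral>y. fejer (T * y) * \<Delta> (a - y) \<partial>lborel)\<bar>
      \<le> 2 / T * (\<integral>s. k s \<partial>lborel)" if ab: "a < b" for a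
  proof -
    have "(\<integral>y. fejer (T * y) * \<Delta> (b - y) \<partial>lborel) - (\<integral>y. fejer (T * y) * \<Delta> (a - y) \<partial>lborel)
      = (\<integral>y. fejer (T * y) * (cdf F (b - y) - cdf F (a - y)) \<partial>lborel) - (\<integral>y. fejer (T * y) * (cdf G (b - y) - cdf G (a - y)) \<partial>lborel)"
      unfolding \<Delta>_def right_diff_distrib using intc[OF F] intc[OF G] by simp
    also have "\<dots> = (\<integral>t. triangle t * Re (char F (- (t * T)) * osc a b (t * T)) - triangle t * Re (char G (- (t * T)) * osc a b (t * T)) \<partial>lborel)"
      unfolding F.fejer_smoothing_identity[OF ab T] G.fejer_smoothing_identity[OF ab T]
      by (rule Bochner_Integration.integral_diff[symmetric]) (rule F.integrable_triangle_char G.integrable_triangle_char)+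
    also have "\<bar>\<dots>\<bar> \<le> (\<integral>t. 2 * k (- (t * T)) \<partial>lborel)"
    proof (rule integral_abs_bound_integral)
      show "integrable lborel (\<lambda>t. triangle t * Re (char F (- (t * T)) * osc a b (t * T)) - triangle t * Re (char G (- (t * T)) * osc a b (t * T)))"
        by (intro Bochner_Integration.integrable_diff F.integrable_triangle_char G.integrable_triangle_char)
      show "integrable lborel (\<lambda>t. 2 * k (- (t * T)))"
        using k_scaled by simp
      fix t :: real
      show "\<bar>triangle t * Re (char F (- (t * T)) * osc a b (t * T)) - triangle t * Re (char G (- (t * T)) * osc a b (t * T))\<bar> \<le> 2 * k (- (t * T))"
      proof (cases "\<bar>t\<bar> \<le> 1")
        case True
        then have tT: "\<bar>- (t * T)\<bar> \<le> T"
          using T by (simp add: abs_mult)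
        have "triangle t * Re (char F (- (t * T)) * osc a b (t * T)) - triangle t * Re (char G (- (t * T)) * osc a b (t * T))
          = triangle t * Re ((char F (- (t * T)) - char G (- (t * T))) * osc a b (t * T))"
          by (simp add: algebra_simps)
        also have "\<bar>\<dots>\<bar> \<le> 1 * norm ((char F (- (t * T)) - char G (- (t * T))) * osc a b (t * T))"
          unfolding abs_mult by (intro mult_mono abs_Re_le_cmod) (auto simp: triangle_def)
        also have "\<dots> \<le> (\<bar>- (t * T)\<bar> * k (- (t * T))) * norm (osc a b (t * T))"
          unfolding norm_mult mult_1 by (intro mult_right_mono char tT) auto
        also have "\<dots> = k (- (t * T)) * (norm (osc a b (t * T)) * \<bar>t * T\<bar>)"
          by (simp add: mult_ac)
        also have "\<dots> \<le> k (- (t * T)) * 2"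
          using ab unfolding osc_def by (intro mult_left_mono oscillatory_integral_bound k) auto
        finally show ?thesis by simp
      next
        case False
        then have "triangle t = 0" by (auto simp: triangle_def)
        then show ?thesis using k by simp
      qed
    qed
    also have "\<dots> = 2 / T * (\<integral>s. k s \<partial>lborel)"
      using k_int by simp
    finally show ?thesis .
  qed
  \<comment> \<open>Both distribution functions vanish at minus infinity, and the kernel
    dominates.\<close>
  have "((\<lambda>n. \<integral>y. fejer (T * y) * \<Delta> (- real n - y) \<partial>lborel) \<longlongrightarrow> (\<integral>y. 0 \<partial>(lborel :: real measure))) sequentially"
  proof (rule integral_dominated_convergence)
    show "integrable lborel (\<lambda>y. fejer (T * y))"
      using T integrable_fejer_scaled by simp
    show "AE y in lborel. (\<lambda>n. fejer (T * y) * \<Delta> (- real n - y)) \<longlonglongrightarrow> 0"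
    proof (intro AE_I2)
      fix y :: real
      have f: "filterlim (\<lambda>n. - real n - y) at_bot sequentially"
        unfolding filterlim_uminus_at_bot
        using filterlim_tendsto_add_at_top[OF tendsto_const[of y] filterlim_real_sequentially]
        by (simp add: add.commute)
      have "(\<lambda>n. fejer (T * y) * (cdf F (- real n - y) - cdf G (- real n - y))) \<longlonglongrightarrow> fejer (T * y) * (0 - 0)"
        by (intro tendsto_mult tendsto_diff tendsto_const filterlim_compose[OF F.cdf_lim_at_bot f] filterlim_compose[OF G.cdf_lim_at_bot f])
      then show "(\<lambda>n. fejer (T * y) * \<Delta> (- real n - y)) \<longlonglongrightarrow> 0"
        by (simp add: \<Delta>_def)
    qed
    show "AE y in lborel. norm (fejer (T * y) * \<Delta> (- real n - y)) \<le> fejer (T * y)" for n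
      using \<Delta> by (auto simp: abs_mult fejer_nonneg mult_left_le)
  qed measurable
  then have lim: "(\<lambda>n. \<bar>(\<integral>y. fejer (T * y) * \<Delta> (b - y) \<partial>lborel) - (\<integral>y. fejer (T * y) * \<Delta> (- real n - y) \<partial>lborel)\<bar>)
      \<longlonglongrightarrow> \<bar>(\<integral>y. fejer (T * y) * \<Delta> (b - y) \<partial>lborel) - 0\<bar>"
    by (intro tendsto_rabs tendsto_diff tendsto_const) simp
  obtain n0 :: nat where n0: "- b < real n0"
    using reals_Archimedean2 by blast
  have "\<bar>(\<integral>y. fejer (T * y) * \<Delta> (b - y) \<partial>lborel) - 0\<bar> \<le> 2 / T * (\<integral>s. k s \<partial>lborel)"
  proof (rule LIMSEQ_le_const2[OF lim], intro exI[of _ n0] allI impI diff)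
    show "- real n < b" if "n0 \<le> n" for n
      using n0 that by linarith
  qed
  then show ?thesis
    by (simp add: \<Delta>_def)
qed

text \<open>A value close to the supremum \<open>\<eta>\<close> of the difference persists on a
  window of half-width \<open>h\<close> proportional to \<open>\<eta>\<close>. Inside the window the
  smoothed difference gains about \<open>\<eta>\<close>; outside it loses at most
  \<open>\<eta>\<close> times the kernel's tail, which is of order \<open>1 / (T^2 * h)\<close>.
  Since \<open>h\<close> is proportional to \<open>\<eta>\<close>, this loss no longer depends on
  \<open>\<eta>\<close> and contributes \<open>L / T\<close>.\<close>

theorem esseen_inequality:
  assumes F: "real_distribution F" and G: "real_distribution G" and T: "0 < T"
    and k: "integrable lborel k" "\<And>s. 0 \<le> k s"
    and char: "\<And>s. \<bar>s\<bar> \<le> T \<Longrightarrow> norm (char F s - char G s) \<le> \<bar>s\<bar> * k s"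
    and lip: "\<And>x y. x \<le> y \<Longrightarrow> cdf G y - cdf G x \<le> L * (y - x)" and L: "0 < L"
  shows "\<bar>cdf F x - cdf G x\<bar> \<le> 8 * (\<integral>s. k s \<partial>lborel) + 384 * L / T"
proof -
  interpret F: real_distribution F by fact
  interpret G: real_distribution G by fact
  note [measurable] = cdf_measurable[OF F] cdf_measurable[OF G]
  define \<Delta> where "\<Delta> x = cdf F x - cdf G x" for x
  have \<Delta>1: "\<bar>\<Delta> x\<bar> \<le> 1" for x
    using F.cdf_nonneg[of x] F.cdf_bounded_prob[of x] G.cdf_nonneg[of x] G.cdf_bounded_prob[of x]
    unfolding \<Delta>_def by linarith
  have \<Delta>_meas [measurable]: "(\<lambda>y. \<Delta> (c - y)) \<in> borel_measurable borel" for c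
    unfolding \<Delta>_def by measurable
  have \<Delta>_up: "\<Delta> x - L * (y - x) \<le> \<Delta> y" if "x \<le> y" for x y
    using lip[OF that] F.cdf_nondecreasing[OF that] by (simp add: \<Delta>_def)
  define \<eta> where "\<eta> = (SUP x. \<bar>\<Delta> x\<bar>)"
  have bdd: "bdd_above (range (\<lambda>x. \<bar>\<Delta> x\<bar>))"
    using \<Delta>1 by (intro bdd_aboveI[of _ 1]) auto
  have le: "\<bar>\<Delta> x\<bar> \<le> \<eta>" for x
    unfolding \<eta>_def using bdd by (rule cSUP_upper2) auto
  let ?I = "\<integral>s. k s \<partial>lborel"
  have I: "0 \<le> ?I" using k by simp
  have "\<eta> \<le> 8 * ?I + 384 * L / T"
  proof (cases "\<eta> > 0")
    case False
    then show ?thesis using I L T by (smt (verit) divide_nonneg_pos mult_nonneg_nonneg)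
  next
    case True
    \<comment> \<open>Moving by \<open>2 * h\<close> changes the difference by at most
      \<open>\<eta> / 4\<close>, so the value above \<open>3/4 * \<eta>\<close> at \<open>x0\<close>
      stays above \<open>\<eta> / 2\<close> on the whole window.\<close>
    define h where "h = \<eta> / (8 * L)"
    have h: "0 < h" "2 * L * h = \<eta> / 4" using True L by (auto simp: h_def)
    have "\<exists>x\<in>UNIV. 3/4 * \<eta> < \<bar>\<Delta> x\<bar>"
      using True bdd unfolding \<eta>_def by (subst less_cSUP_iff[symmetric]) auto
    then obtain x0 where x0: "3/4 * \<eta> < \<bar>\<Delta> x0\<bar>" by auto
    \<comment> \<open>\<open>\<Delta>\<close> decreases at most with slope \<open>L\<close>, so a large positive value persists to the right
      and a large negative one to the left.\<close>
    obtain s x1 where s: "s = 1 \<or> s = -1" and near: "\<And>y. \<bar>y\<bar> \<le> h \<Longrightarrow> \<eta> / 2 \<le> s * \<Delta> (x1 - y)"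
    proof (cases "0 \<le> \<Delta> x0")
      case True
      show thesis
      proof (rule that[of 1 "x0 + h"])
        fix y assume y: "\<bar>y\<bar> \<le> h"
        then have "\<Delta> x0 - L * (h - y) \<le> \<Delta> (x0 + h - y)"
          using \<Delta>_up[of x0 "x0 + h - y"] by simp
        moreover have "L * (h - y) \<le> L * (2 * h)"
          using y L by (intro mult_left_mono) auto
        ultimately show "\<eta> / 2 \<le> 1 * \<Delta> (x0 + h - y)"
          using x0 True h(2) by simp
      qed simp
    next
      case False
      show thesis
      proof (rule that[of "-1" "x0 - h"])
        fix y assume y: "\<bar>y\<bar> \<le> h"
        then have "\<Delta> (x0 - h - y) - L * (h + y) \<le> \<Delta> x0"
          using \<Delta>_up[of "x0 - h - y" x0] by (simp add: algebra_simps)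
        moreover have "L * (h + y) \<le> L * (2 * h)"
          using y L by (intro mult_left_mono) auto
        ultimately show "\<eta> / 2 \<le> -1 * \<Delta> (x0 - h - y)"
          using x0 False h(2) by simp
      qed simp
    qed
    let ?V = "\<integral>y. fejer (T * y) \<partial>lborel"
    let ?q = "\<lambda>y. indicator {y. h \<le> \<bar>y\<bar>} y / y\<^sup>2 :: real"
    have q: "integrable lborel ?q" "(\<integral>y. ?q y \<partial>lborel) = 2 / h"
      using has_bochner_integral_inverse_square_tail[OF h(1)] by (auto simp: has_bochner_integral_iff)
    have V: "integrable lborel (\<lambda>y. fejer (T * y))"
      using T integrable_fejer_scaled by simp
    \<comment> \<open>Outside the window the estimate from below is \<open>- \<eta>\<close>, so
      \<open>\<eta> / 2 + \<eta>\<close> times the kernel must be subtracted; with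
      \<open>fejer_le\<close> this gives the coefficient \<open>6 = 3/2 * 4\<close>.\<close>
    have pw: "\<eta> / 2 * fejer (T * y) - 6 * \<eta> / T\<^sup>2 * ?q y \<le> fejer (T * y) * (s * \<Delta> (x1 - y))" for y
    proof (cases "\<bar>y\<bar> \<le> h")
      case True
      have "\<eta> / 2 * fejer (T * y) \<le> fejer (T * y) * (s * \<Delta> (x1 - y))"
        using near[OF True] fejer_nonneg[of "T * y"] by (subst mult.commute) (intro mult_left_mono)
      moreover have "0 \<le> 6 * \<eta> / T\<^sup>2 * ?q y"
        using \<open>\<eta> > 0\<close> by (intro mult_nonneg_nonneg divide_nonneg_nonneg) auto
      ultimately show ?thesis by linarith
    next
      case False
      then have y: "y \<noteq> 0" "?q y = 1 / y\<^sup>2" using h by auto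
      have "- \<eta> \<le> s * \<Delta> (x1 - y)"
        using le[of "x1 - y"] s by auto
      then have "fejer (T * y) * (- \<eta>) \<le> fejer (T * y) * (s * \<Delta> (x1 - y))"
        by (intro mult_left_mono fejer_nonneg)
      moreover have "3/2 * \<eta> * fejer (T * y) \<le> 3/2 * \<eta> * (4 / (T * y)\<^sup>2)"
        using y T \<open>\<eta> > 0\<close> by (intro mult_left_mono fejer_le) auto
      moreover have "3/2 * \<eta> * (4 / (T * y)\<^sup>2) = 6 * \<eta> / T\<^sup>2 * ?q y"
        using y by (simp add: power_mult_distrib)
      moreover have "\<eta> / 2 * fejer (T * y) = 3/2 * \<eta> * fejer (T * y) + fejer (T * y) * (- \<eta>)"
        by (simp add: algebra_simps)
      ultimately show ?thesis by linarith
    qed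
    have int: "integrable lborel (\<lambda>y. fejer (T * y) * (s * \<Delta> (x1 - y)))"
      using \<Delta>1 s by (intro Bochner_Integration.integrable_bound[OF V])
        (auto simp: abs_mult fejer_nonneg mult_left_le intro!: AE_I2)
    have "\<eta> / 2 * ?V - 6 * \<eta> / T\<^sup>2 * (2 / h) = (\<integral>y. \<eta> / 2 * fejer (T * y) - 6 * \<eta> / T\<^sup>2 * ?q y \<partial>lborel)"
      unfolding Bochner_Integration.integral_diff[OF integrable_mult_right[OF V] integrable_mult_right[OF q(1)]]
        integral_mult_right_zero q(2) ..
    also have "\<dots> \<le> (\<integral>y. fejer (T * y) * (s * \<Delta> (x1 - y)) \<partial>lborel)"
      by (rule integral_mono[OF Bochner_Integration.integrable_diff[OF integrable_mult_right[OF V] integrable_mult_right[OF q(1)]] int pw])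
    also have "\<dots> = s * (\<integral>y. fejer (T * y) * \<Delta> (x1 - y) \<partial>lborel)"
      by (simp add: mult.left_commute)
    also have "\<dots> \<le> \<bar>\<integral>y. fejer (T * y) * \<Delta> (x1 - y) \<partial>lborel\<bar>"
      using s by auto
    also have "\<dots> \<le> 2 / T * ?I"
      unfolding \<Delta>_def by (rule smoothed_cdf_difference[OF F G T k char])
    finally have main: "\<eta> / 2 * ?V - 6 * \<eta> / T\<^sup>2 * (2 / h) \<le> 2 / T * ?I" .
    have "6 * \<eta> / T\<^sup>2 * (2 / h) = 96 * L / T\<^sup>2"
      using True L by (simp add: h_def)
    moreover have "1 / (2 * T) \<le> ?V"
    proof -
      have "1 / (2 * T) = (\<integral>y. indicator {-1/T..1/T} y * (1/4) \<partial>lborel)"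
        using T by simp
      also have "\<dots> \<le> ?V"
      proof (intro integral_mono V integrable_mult_left integrable_indicator_interval)
        fix y :: real
        show "indicator {-1/T..1/T} y * (1/4) \<le> fejer (T * y)"
        proof (cases "y \<in> {-1/T..1/T}")
          case True
          then have "\<bar>T * y\<bar> \<le> 1"
            using T by (auto simp: abs_le_iff field_simps)
          then show ?thesis using True fejer_ge[of "T * y"] by simp
        next
          case False
          then show ?thesis using fejer_nonneg by simp
        qed
      qed
      finally show ?thesis .
    qed
    then have "\<eta> / 2 * (1 / (2 * T)) \<le> \<eta> / 2 * ?V"
      using True by (intro mult_left_mono) auto
    ultimately have "\<eta> / 2 * (1 / (2 * T)) \<le> 2 / T * ?I + 96 * L / T\<^sup>2"
      using main by linarith
    then have "4 * T * (\<eta> / 2 * (1 / (2 * T))) \<le> 4 * T * (2 / T * ?I + 96 * L / T\<^sup>2)"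
      using T by (intro mult_left_mono) auto
    moreover have "4 * T * (\<eta> / 2 * (1 / (2 * T))) = \<eta>"
      using T by simp
    moreover have "4 * T * (2 / T * ?I + 96 * L / T\<^sup>2) = 8 * ?I + 384 * L / T"
      using T by (simp add: distrib_left power2_eq_square)
    ultimately show ?thesis by simp
  qed
  with le[of x] show ?thesis
    by (simp add: \<Delta>_def)
qed

section \<open>From characteristic functions to the rate of convergence\<close>

text \<open>Turns first-order control of the powers up to the time \<open>1 / t^2\<close> into
  third-order control of the base. It will be applied to the ratio of \<open>l\<close> to the
  Gaussian factor; \<open>t^2 \<le> 1/2\<close> guarantees that the integer part \<open>m\<close> of
  \<open>1 / t^2\<close> is at least half of it.\<close>

lemma eigenvalue_gaussian_expansion:
  fixes w :: complex
  assumes K2: "0 \<le> K2" "K2 * t \<le> 1/2" and t: "0 < t" "t\<^sup>2 \<le> 1/2"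
    and near: "\<And>n. real n * t\<^sup>2 \<le> 1 \<Longrightarrow> norm (w ^ n - 1) \<le> K2 * t"
  shows "norm (w - 1) \<le> 4 * K2 * t ^ 3"
proof -
  define m where "m = nat \<lfloor>1 / t\<^sup>2\<rfloor>"
  have m: "real m * t\<^sup>2 \<le> 1" "1 / (2 * t\<^sup>2) \<le> real m"
  proof -
    have m_eq: "real m = of_int \<lfloor>1 / t\<^sup>2\<rfloor>"
      using t by (simp add: m_def)
    then have "real m \<le> 1 / t\<^sup>2" by simp
    then show "real m * t\<^sup>2 \<le> 1" using t by (simp add: field_simps)
    have "1 / t\<^sup>2 - 1 < real m" unfolding m_eq by linarith
    moreover have "1 \<le> 1 / (2 * t\<^sup>2)" using t by (simp add: field_simps)
    moreover have "1 / t\<^sup>2 = 2 * (1 / (2 * t\<^sup>2))" by simp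
    ultimately show "1 / (2 * t\<^sup>2) \<le> real m" by linarith
  qed
  have wn: "norm (w ^ n - 1) \<le> K2 * t" if "n \<le> m" for n
  proof (rule near)
    have "real n * t\<^sup>2 \<le> real m * t\<^sup>2" using that by (intro mult_right_mono) auto
    with m(1) show "real n * t\<^sup>2 \<le> 1" by simp
  qed
  \<comment> \<open>The geometric sum turns control of all powers up to \<open>m\<close> into control of \<open>w\<close> itself, with a gain of \<open>1 / m\<close>;
    this avoids choosing a branch of the \<open>m\<close>-th root.\<close>
  have "norm ((\<Sum>n<m. w ^ n) - of_nat m) = norm (\<Sum>n<m. w ^ n - 1)"
    by (simp add: sum_subtractf)
  also have "\<dots> \<le> (\<Sum>n<m. K2 * t)"
    by (intro sum_norm_le wn) auto
  also have "\<dots> \<le> real m / 2"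
    using K2 mult_left_mono[of "K2 * t" "1/2" "real m"] by simp
  finally have "real m / 2 \<le> norm (\<Sum>n<m. w ^ n)"
    using norm_triangle_ineq2[of "of_nat m" "of_nat m - (\<Sum>n<m. w ^ n)"] by (simp add: norm_minus_commute)
  then have "norm (w - 1) * (real m / 2) \<le> norm (w - 1) * norm (\<Sum>n<m. w ^ n)"
    by (intro mult_left_mono) auto
  also have "\<dots> = norm (w ^ m - 1)"
    by (simp add: power_diff_1_eq norm_mult)
  also have "\<dots> \<le> K2 * t"
    by (rule wn) simp
  finally have a: "norm (w - 1) * (real m / 2) \<le> K2 * t" .
  have "norm (w - 1) * (1 / (2 * t\<^sup>2)) \<le> norm (w - 1) * real m"
    using m by (intro mult_left_mono) auto
  with a have "norm (w - 1) * (1 / (2 * t\<^sup>2)) \<le> 2 * (K2 * t)"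
    by simp
  then have "norm (w - 1) * (1 / (2 * t\<^sup>2)) * (2 * t\<^sup>2) \<le> 2 * (K2 * t) * (2 * t\<^sup>2)"
    by (intro mult_right_mono) auto
  then show ?thesis
    using t by (simp add: power2_eq_square power3_eq_cube mult_ac)
qed

text \<open>Here the Gaussian decay in \<open>n\<close> is gained. Once \<open>l\<close> is within
  \<open>O(t^3)\<close> of the Gaussian factor, half of the Gaussian exponent suffices to absorb the
  error, so \<open>norm l \<le> exp (- s2 * t^2 / 4)\<close> for small \<open>t\<close>, and all
  powers are compared on this scale.\<close>

lemma char_gaussian_estimate:
  fixes \<phi> :: "real \<Rightarrow> nat \<Rightarrow> complex"
  assumes s2: "0 < s2" and K: "0 \<le> K" "0 \<le> KM" "0 < \<delta>"
    and near: "\<And>t n. \<bar>t\<bar> \<le> 1 \<Longrightarrow> norm (\<phi> t n - exp (- s2 * t\<^sup>2 / 2) ^ n) \<le> KM * (\<bar>t\<bar> + real n * \<bar>t\<bar> ^ 3)"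
    and quasi: "\<And>t. \<bar>t\<bar> < \<delta> \<Longrightarrow> \<exists>l. l \<noteq> 0 \<and> (\<forall>n. norm (\<phi> t n - l ^ n) \<le> K * \<bar>t\<bar> * norm l ^ n)"
    and bound: "\<And>t n. norm (\<phi> t n) \<le> 1"
  obtains C \<delta>' where "0 \<le> C" "0 < \<delta>'"
    "\<And>t n. \<bar>t\<bar> < \<delta>' \<Longrightarrow> norm (\<phi> t n - exp (- s2 * t\<^sup>2 / 2) ^ n) \<le> C * (\<bar>t\<bar> + real n * \<bar>t\<bar> ^ 3) * exp (- s2 * t\<^sup>2 / 4) ^ n"
proof -
  \<comment> \<open>\<open>K1\<close> bounds the distance of \<open>l^k\<close> from the Gaussian
    power for \<open>k * t^2 \<le> 1\<close>: twice \<open>K\<close> since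
    \<open>norm l ^ k \<le> 2\<close>, twice \<open>KM\<close> since \<open>k * t^3 \<le> t\<close>.
    Dividing by the Gaussian power costs the further factor in \<open>K2\<close>.\<close>
  define K1 where "K1 = 2 * K + 2 * KM"
  define K2 where "K2 = K1 * exp s2"
  have K12: "0 \<le> K1" "0 \<le> K2" using K by (auto simp: K1_def K2_def)
  define C where "C = K + 4 * K2 * exp s2"
  define \<delta>' where "\<delta>' = Min {\<delta>, 1/2, 1 / (2 * (K + 1)), 1 / (2 * (K2 + 1)), 1 / (s2 + 1), s2 / (32 * (K2 + 1))}"
  have "0 < \<delta>'" using K K12 s2 by (simp add: \<delta>'_def)
  show ?thesis
  proof (rule that[of C \<delta>'])
    show "0 \<le> C" using K K12 by (simp add: C_def)
    show "0 < \<delta>'" by fact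
    fix t n assume t': "\<bar>t\<bar> < \<delta>'"
    define \<tau> where "\<tau> = \<bar>t\<bar>"
    define \<gamma> where "\<gamma> = exp (- s2 * t\<^sup>2 / 2)"
    define q where "q = exp (- s2 * t\<^sup>2 / 4)"
    have t2: "t\<^sup>2 = \<tau>\<^sup>2" by (simp add: \<tau>_def)
    have small: "\<tau> < \<delta>" "\<tau> < 1/2" "\<tau> < 1 / (2 * (K + 1))" "\<tau> < 1 / (2 * (K2 + 1))" "\<tau> < 1 / (s2 + 1)" "\<tau> < s2 / (32 * (K2 + 1))"
      using t' by (auto simp: \<delta>'_def \<tau>_def)
    show "norm (\<phi> t n - exp (- s2 * t\<^sup>2 / 2) ^ n) \<le> C * (\<bar>t\<bar> + real n * \<bar>t\<bar> ^ 3) * exp (- s2 * t\<^sup>2 / 4) ^ n"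
    proof (cases "t = 0")
      case True
      then show ?thesis using near[of 0 n] by simp
    next
      case False
      then have \<tau>: "0 < \<tau>" by (simp add: \<tau>_def)
      have K\<tau>: "K * \<tau> \<le> 1/2" "K2 * \<tau> \<le> 1/2" "s2 * \<tau> \<le> 1" "32 * K2 * \<tau> \<le> s2"
        using small(3-6) K K12 s2 \<tau> by (auto simp: less_divide_eq algebra_simps)
      obtain l where l: "l \<noteq> 0" "\<And>n. norm (\<phi> t n - l ^ n) \<le> K * \<tau> * norm l ^ n"
        using quasi[of t] small(1) by (auto simp: \<tau>_def)
      have s\<tau>: "s2 * \<tau>\<^sup>2 \<le> 1"
        using mult_mono[OF K\<tau>(3), of \<tau> 1] small(2) \<tau> s2 by (simp add: power2_eq_square mult.assoc)
      have \<tau>2: "\<tau>\<^sup>2 \<le> 1/2"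
        using mult_mono[of \<tau> "1/2" \<tau> "1/2"] small(2) \<tau> by (simp add: power2_eq_square)
      define w where "w = l / of_real \<gamma>"
      have \<gamma>pos: "0 < \<gamma>" by (simp add: \<gamma>_def)
      have "norm (w - 1) \<le> 4 * K2 * \<tau> ^ 3"
      proof (rule eigenvalue_gaussian_expansion[OF K12(2) K\<tau>(2) \<tau> \<tau>2])
        fix k :: nat assume k: "real k * \<tau>\<^sup>2 \<le> 1"
        have "real k * \<tau> ^ 3 = real k * \<tau>\<^sup>2 * \<tau>" by (simp add: power2_eq_square power3_eq_cube)
        also have "\<dots> \<le> 1 * \<tau>" using k \<tau> by (intro mult_right_mono) auto
        finally have k3: "real k * \<tau> ^ 3 \<le> \<tau>" by simp
        have "norm (\<phi> t k - \<gamma> ^ k) \<le> KM * (\<tau> + real k * \<tau> ^ 3)"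
          using near[of t k] small(2) unfolding \<tau>_def \<gamma>_def by simp
        also have "\<dots> \<le> KM * (\<tau> + \<tau>)"
          using k3 K by (intro mult_left_mono) auto
        finally have 1: "norm (\<phi> t k - \<gamma> ^ k) \<le> 2 * KM * \<tau>" by simp
        \<comment> \<open>The error is relative to \<open>norm l ^ k\<close> itself; as its
          coefficient is at most \<open>1/2\<close> and the characteristic function is bounded by 1,
          it can be absorbed.\<close>
        have "norm l ^ k \<le> norm (\<phi> t k) + norm (\<phi> t k - l ^ k)"
          using norm_triangle_ineq4[of "\<phi> t k" "\<phi> t k - l ^ k"] by (simp add: norm_power)
        also have "\<dots> \<le> 1 + 1/2 * norm l ^ k"
          using bound[of t k] l(2)[of k] mult_right_mono[OF K\<tau>(1), of "norm l ^ k"] by simp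
        finally have "norm l ^ k \<le> 2" by simp
        then have "K * \<tau> * norm l ^ k \<le> K * \<tau> * 2"
          using K \<tau> by (intro mult_left_mono) auto
        with l(2)[of k] have 2: "norm (\<phi> t k - l ^ k) \<le> 2 * K * \<tau>" by simp
        have "norm (l ^ k - \<gamma> ^ k) \<le> norm (\<phi> t k - l ^ k) + norm (\<phi> t k - \<gamma> ^ k)"
          using norm_triangle_ineq4[of "\<phi> t k - \<gamma> ^ k" "\<phi> t k - l ^ k"] by simp
        with 1 2 have 3: "norm (l ^ k - \<gamma> ^ k) \<le> K1 * \<tau>"
          by (simp add: K1_def algebra_simps)
        have "w ^ k - 1 = (l ^ k - \<gamma> ^ k) / of_real (\<gamma> ^ k)"
          using \<gamma>pos by (simp add: w_def power_divide diff_divide_distrib)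
        then have "norm (w ^ k - 1) = norm (l ^ k - \<gamma> ^ k) * (1 / \<gamma> ^ k)"
          using \<gamma>pos by (simp add: norm_divide norm_power)
        also have "\<dots> \<le> (K1 * \<tau>) * exp s2"
        proof (intro mult_mono 3)
          have "\<gamma> ^ k = exp (- (real k * (s2 * t\<^sup>2 / 2)))"
            by (simp add: \<gamma>_def exp_of_nat_mult[symmetric])
          then have "1 / \<gamma> ^ k = exp (real k * (s2 * t\<^sup>2 / 2))"
            by (simp add: exp_minus inverse_eq_divide)
          also have "real k * (s2 * t\<^sup>2 / 2) \<le> s2"
          proof -
            have "real k * (s2 * t\<^sup>2 / 2) = (real k * \<tau>\<^sup>2) * (s2 / 2)" by (simp add: t2)
            also have "\<dots> \<le> 1 * (s2 / 2)" using k s2 by (intro mult_right_mono) auto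
            finally show ?thesis using s2 by simp
          qed
          finally show "1 / \<gamma> ^ k \<le> exp s2" by simp
        qed (use K12 \<tau> \<gamma>pos in auto)
        finally show "norm (w ^ k - 1) \<le> K2 * \<tau>" by (simp add: K2_def mult_ac)
      qed
      moreover have "norm (l - \<gamma>) = \<gamma> * norm (w - 1)"
      proof -
        have "l - \<gamma> = of_real \<gamma> * (w - 1)" using \<gamma>pos by (simp add: w_def right_diff_distrib)
        then show ?thesis using \<gamma>pos by (simp add: norm_mult)
      qed
      moreover have "\<gamma> \<le> 1" using s2 by (simp add: \<gamma>_def)
      ultimately have l\<gamma>: "norm (l - \<gamma>) \<le> 4 * K2 * \<tau> ^ 3"
        using mult_mono[of \<gamma> 1 "norm (w - 1)" "4 * K2 * \<tau> ^ 3"] \<gamma>pos by simp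
      have q: "0 < q" "\<gamma> \<le> q" using s2 by (auto simp: q_def \<gamma>_def)
      \<comment> \<open>The exponent is budgeted as follows: \<open>s2 * \<tau>^2 / 2\<close> is
        available, the second-order term of the exponential and the error
        \<open>4 * K2 * \<tau>^3\<close> each use at most \<open>s2 * \<tau>^2 / 8\<close>, and
        \<open>s2 * \<tau>^2 / 4\<close> remains.\<close>
      have "norm l \<le> q"
      proof -
        have "norm l \<le> \<gamma> + 4 * K2 * \<tau> ^ 3"
          using norm_triangle_ineq[of "of_real \<gamma>" "l - \<gamma>"] l\<gamma> \<gamma>pos by simp
        also have "\<gamma> \<le> 1 - s2 * \<tau>\<^sup>2 / 2 + (s2 * \<tau>\<^sup>2 / 2)\<^sup>2 / 2"
        proof -
          have "0 \<le> s2 * \<tau>\<^sup>2 / 2" using s2 by simp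
          moreover have "\<gamma> = exp (- (s2 * \<tau>\<^sup>2 / 2))" by (simp add: \<gamma>_def t2)
          ultimately show ?thesis
            using abs_le_D1[OF exp_minus_linear_bound, of "s2 * \<tau>\<^sup>2 / 2"] by linarith
        qed
        also have "(s2 * \<tau>\<^sup>2 / 2)\<^sup>2 / 2 \<le> s2 * \<tau>\<^sup>2 / 8"
          using mult_mono[OF s\<tau> order_refl, of "s2 * \<tau>\<^sup>2"] s2 by (simp add: power2_eq_square)
        also have "4 * K2 * \<tau> ^ 3 \<le> s2 * \<tau>\<^sup>2 / 8"
          using mult_right_mono[OF K\<tau>(4), of "\<tau>\<^sup>2"] by (simp add: power2_eq_square power3_eq_cube mult_ac)
        finally have "norm l \<le> 1 - s2 * t\<^sup>2 / 4" by (simp add: t2)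
        also have "\<dots> \<le> q" using exp_ge_add_one_self[of "- s2 * t\<^sup>2 / 4"] by (simp add: q_def)
        finally show ?thesis by simp
      qed
      \<comment> \<open>Dividing by \<open>q\<close> brings both bases into the unit disc, where the
        difference of \<open>n\<close>-th powers is at most \<open>n\<close> times the difference of
        the bases. The remaining factor \<open>1 / q\<close> is bounded by
        \<open>exp s2\<close>.\<close>
      have "norm (l ^ n - \<gamma> ^ n) = q ^ n * norm ((l / q) ^ n - (\<gamma> / q) ^ n)"
      proof -
        have "l ^ n - \<gamma> ^ n = of_real (q ^ n) * ((l / q) ^ n - (\<gamma> / q) ^ n)"
          using q by (simp add: power_divide right_diff_distrib)
        then show ?thesis using q by (simp add: norm_mult norm_power)
      qed
      also have "norm ((l / q) ^ n - (\<gamma> / q) ^ n) \<le> real n * norm (l / q - \<gamma> / q)"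
        using norm_power_diff[of "l / q" "\<gamma> / q" n] \<open>norm l \<le> q\<close> q \<gamma>pos by (simp add: norm_divide)
      also have "norm (l / q - \<gamma> / q) = norm (l - \<gamma>) * (1 / q)"
        using q by (simp add: diff_divide_distrib[symmetric] norm_divide)
      also have "\<dots> \<le> 4 * K2 * \<tau> ^ 3 * exp s2"
      proof (intro mult_mono l\<gamma>)
        have "1 / q = exp (s2 * \<tau>\<^sup>2 / 4)" by (simp add: q_def t2 exp_minus inverse_eq_divide)
        also have "\<dots> \<le> exp s2"
          using mult_left_mono[of "\<tau>\<^sup>2" 1 s2] \<tau>2 s2 by simp
        finally show "1 / q \<le> exp s2" .
      qed (use q K12 \<tau> in auto)
      finally have "norm (l ^ n - \<gamma> ^ n) \<le> q ^ n * (real n * (4 * K2 * \<tau> ^ 3 * exp s2))"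
        using q by (simp add: mult_left_mono)
      moreover have "norm (\<phi> t n - l ^ n) \<le> K * \<tau> * q ^ n"
        using l(2)[of n] \<open>norm l \<le> q\<close> K \<tau> by (intro order_trans[OF l(2)] mult_left_mono power_mono) auto
      moreover have "norm (\<phi> t n - \<gamma> ^ n) \<le> norm (\<phi> t n - l ^ n) + norm (l ^ n - \<gamma> ^ n)"
        using norm_triangle_ineq[of "\<phi> t n - l ^ n" "l ^ n - \<gamma> ^ n"] by simp
      ultimately have "norm (\<phi> t n - \<gamma> ^ n) \<le> (K * \<tau> + 4 * K2 * exp s2 * (real n * \<tau> ^ 3)) * q ^ n"
        by (simp add: algebra_simps)
      also have "\<dots> \<le> (C * \<tau> + C * (real n * \<tau> ^ 3)) * q ^ n"
        using K K12 \<tau> q by (intro mult_right_mono add_mono) (auto simp: C_def)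
      finally show ?thesis
        unfolding \<tau>_def q_def \<gamma>_def by (simp add: distrib_left)
    qed
  qed
qed

section \<open>Gaussian facts and rescaling\<close>

lemma normal_distribution_cdf:
  assumes \<sigma>: "0 < \<sigma>"
  shows "cdf (density lborel (normal_density 0 \<sigma>)) x = cdf std_normal_distribution (x / \<sigma>)"
proof -
  interpret N: prob_space "density lborel (normal_density 0 \<sigma>)"
    using \<sigma> by (rule prob_space_normal_density)
  have "distributed (density lborel (normal_density 0 \<sigma>)) lborel (\<lambda>x. x) (normal_density 0 \<sigma>)"
    by (simp add: distributed_def distr_id2 measurable_ident_sets)
  then have "distributed (density lborel (normal_density 0 \<sigma>)) lborel (\<lambda>x. (x - 0) / \<sigma>) std_normal_density"
    using N.normal_standard_normal_convert[OF \<sigma>, of "\<lambda>x. x" 0] by simp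
  then have "std_normal_distribution = distr (density lborel (normal_density 0 \<sigma>)) lborel (\<lambda>x. x / \<sigma>)"
    by (simp add: distributed_def)
  then have "cdf std_normal_distribution (x / \<sigma>) = measure (density lborel (normal_density 0 \<sigma>)) ((\<lambda>x. x / \<sigma>) -` {..x / \<sigma>})"
    unfolding cdf_def by (simp only:) (subst measure_distr, auto)
  also have "(\<lambda>x. x / \<sigma>) -` {..x / \<sigma>} = {..x}"
    using \<sigma> by (auto simp: divide_le_cancel)
  finally show ?thesis by (simp add: cdf_def)
qed

lemma std_normal_cdf_lipschitz:
  assumes "x \<le> y"
  shows "cdf std_normal_distribution y - cdf std_normal_distribution x \<le> 1 * (y - x)"
proof (cases "x < y")
  case True
  interpret real_distribution std_normal_distribution by (rule real_dist_normal_dist)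
  have "ennreal (cdf std_normal_distribution y - cdf std_normal_distribution x) = emeasure std_normal_distribution {x<..y}"
    using True by (simp add: cdf_diff_eq emeasure_eq_measure)
  also have "\<dots> = (\<integral>\<^sup>+z. ennreal (std_normal_density z) * indicator {x<..y} z \<partial>lborel)"
    by (rule emeasure_density) auto
  also have "\<dots> \<le> (\<integral>\<^sup>+z. indicator {x<..y} z \<partial>lborel)"
  proof (rule nn_integral_mono)
    fix z :: real
    have "1 / sqrt (2 * pi) * exp (- z\<^sup>2 / 2) \<le> 1 * 1"
      using pi_gt3 by (intro mult_mono) auto
    then show "ennreal (std_normal_density z) * indicator {x<..y} z \<le> indicator {x<..y} z"
      by (auto simp: std_normal_density_def ennreal_le_1 split: split_indicator)
  qed
  also have "\<dots> = ennreal (y - x)" using assms by simp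
  finally show ?thesis using assms by simp
qed (use assms in simp)

text \<open>Up to a constant the exponential is the normal density of variance 2, hence standard
  deviation \<open>sqrt 2\<close>.\<close>

lemma integrable_gaussian_weight:
  "integrable lborel (\<lambda>s::real. (1 + s\<^sup>2 / b) * exp (- s\<^sup>2 / 4))"
proof -
  define c where "c = sqrt (2 * pi * (sqrt 2)\<^sup>2)"
  have c: "0 < c" by (simp add: c_def)
  have "exp (- s\<^sup>2 / 4) = c * normal_density 0 (sqrt 2) s" for s :: real
    using c by (simp add: normal_density_def c_def)
  then have eq: "(1 + s\<^sup>2 / b) * exp (- s\<^sup>2 / 4) = c * normal_density 0 (sqrt 2) s + c / b * (normal_density 0 (sqrt 2) s * (s - 0)\<^sup>2)" for s :: real
    by (simp add: algebra_simps)
  show ?thesis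
    unfolding eq by (intro Bochner_Integration.integrable_add integrable_mult_right integrable_normal_moment) auto
qed

text \<open>With \<open>s = t * \<sigma> * sqrt n\<close> the assumed error becomes
  \<open>\<bar>s\<bar>\<close> times an integrable weight of size \<open>n^(-1/2)\<close>, just the
  shape that \<open>esseen_inequality\<close> takes. The cut-off is of order \<open>sqrt n\<close>,
  so its contribution has the same order; \<open>\<delta> / 2\<close> is used because the cut-off
  interval is closed whereas the estimate needs \<open>\<bar>t\<bar> < \<delta>\<close>.\<close>

theorem berry_esseen_from_char:
  fixes S :: "nat \<Rightarrow> 'w \<Rightarrow> real"
  assumes M: "prob_space M" and S [measurable]: "\<And>n. S n \<in> borel_measurable M" and \<sigma>: "0 < \<sigma>" and C: "0 \<le> C" "0 < \<delta>"
    and char: "\<And>t n. \<bar>t\<bar> < \<delta> \<Longrightarrow> norm ((\<integral>\<omega>. iexp (t * S n \<omega>) \<partial>M) - exp (- \<sigma>\<^sup>2 * t\<^sup>2 / 2) ^ n)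
       \<le> C * (\<bar>t\<bar> + real n * \<bar>t\<bar> ^ 3) * exp (- \<sigma>\<^sup>2 * t\<^sup>2 / 4) ^ n"
  obtains A where "\<And>n x. 0 < n \<Longrightarrow>
    \<bar>measure M {\<omega>\<in>space M. S n \<omega> / (\<sigma> * sqrt (real n)) \<le> x} - cdf std_normal_distribution x\<bar> \<le> A / sqrt (real n)"
proof -
  interpret M: prob_space M by fact
  define J where "J = (\<integral>s. (1 + s\<^sup>2 / \<sigma>\<^sup>2) * exp (- s\<^sup>2 / 4) \<partial>lborel)"
  show ?thesis
  proof (rule that[of "8 * (C / \<sigma> * J) + 384 * 1 / (\<delta> / 2 * \<sigma>)"])
    fix n :: nat and x assume n: "0 < n"
    define r where "r = \<sigma> * sqrt (real n)"
    have r: "0 < r" using n \<sigma> by (simp add: r_def)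
    define F where "F = distr M borel (\<lambda>\<omega>. S n \<omega> / r)"
    have F: "real_distribution F"
      unfolding F_def by (intro M.real_distribution_distr) measurable
    define k where "k s = C / r * ((1 + s\<^sup>2 / \<sigma>\<^sup>2) * exp (- s\<^sup>2 / 4))" for s
    have charF: "char F s = (\<integral>\<omega>. iexp (s / r * S n \<omega>) \<partial>M)" for s
      unfolding char_def F_def by (subst integral_distr) auto
    have "\<bar>cdf F x - cdf std_normal_distribution x\<bar> \<le> 8 * (\<integral>s. k s \<partial>lborel) + 384 * 1 / (\<delta> / 2 * r)"
    proof (rule esseen_inequality[OF F real_dist_normal_dist])
      show "0 < \<delta> / 2 * r" using C r by simp
      show "integrable lborel k"
        unfolding k_def by (intro integrable_mult_right integrable_gaussian_weight)
      show "0 \<le> k s" for s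
        using C r by (simp add: k_def)
      fix s assume s: "\<bar>s\<bar> \<le> \<delta> / 2 * r"
      define t where "t = s / r"
      have t: "\<bar>t\<bar> < \<delta>"
        using s r C by (simp add: t_def abs_divide divide_less_eq) (smt (verit) mult_pos_pos)
      have rn: "r\<^sup>2 = \<sigma>\<^sup>2 * real n" by (simp add: r_def power_mult_distrib)
      have e2: "exp (- \<sigma>\<^sup>2 * t\<^sup>2 / 2) ^ n = exp (- s\<^sup>2 / 2)"
        using \<sigma> n by (simp add: exp_of_nat_mult[symmetric] t_def power_divide rn)
      have e4: "exp (- \<sigma>\<^sup>2 * t\<^sup>2 / 4) ^ n = exp (- s\<^sup>2 / 4)"
        using \<sigma> n by (simp add: exp_of_nat_mult[symmetric] t_def power_divide rn)
      have nt: "real n * \<bar>t\<bar> ^ 3 = \<bar>s\<bar> / r * (s\<^sup>2 / \<sigma>\<^sup>2)"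
      proof -
        have "real n * \<bar>t\<bar> ^ 3 = \<bar>s\<bar> / r * (real n * s\<^sup>2 / r\<^sup>2)"
          using r by (simp add: t_def power3_eq_cube power2_eq_square abs_divide abs_mult_self_eq mult_ac)
        also have "real n * s\<^sup>2 / r\<^sup>2 = s\<^sup>2 / \<sigma>\<^sup>2"
          using n \<sigma> by (simp add: rn)
        finally show ?thesis .
      qed
      have "char F s - char std_normal_distribution s = (\<integral>\<omega>. iexp (t * S n \<omega>) \<partial>M) - exp (- \<sigma>\<^sup>2 * t\<^sup>2 / 2) ^ n"
        unfolding e2 by (simp only: charF char_std_normal_distribution t_def)
      also have "norm \<dots> \<le> C * (\<bar>t\<bar> + real n * \<bar>t\<bar> ^ 3) * exp (- \<sigma>\<^sup>2 * t\<^sup>2 / 4) ^ n"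
        by (rule char[OF t])
      also have "\<dots> = \<bar>s\<bar> * k s"
        unfolding e4 nt using r by (simp add: k_def t_def abs_divide distrib_left distrib_right mult_ac)
      finally show "norm (char F s - char std_normal_distribution s) \<le> \<bar>s\<bar> * k s" .
    qed (use std_normal_cdf_lipschitz in auto)
    also have "(\<integral>s. k s \<partial>lborel) = C / r * J"
      unfolding k_def J_def by simp
    also have "8 * (C / r * J) + 384 * 1 / (\<delta> / 2 * r) = (8 * (C / \<sigma> * J) + 384 * 1 / (\<delta> / 2 * \<sigma>)) / sqrt (real n)"
      using \<sigma> n C by (simp add: r_def field_simps)
    also have "cdf F x = measure M {\<omega>\<in>space M. S n \<omega> / r \<le> x}"
      unfolding cdf_def F_def by (subst measure_distr) (auto intro!: arg_cong[where f="measure M"])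
    finally show "\<bar>measure M {\<omega>\<in>space M. S n \<omega> / (\<sigma> * sqrt (real n)) \<le> x} - cdf std_normal_distribution x\<bar>
       \<le> (8 * (C / \<sigma> * J) + 384 * 1 / (\<delta> / 2 * \<sigma>)) / sqrt (real n)"
      unfolding r_def .
  qed
qed

section \<open>The Poisson equation in \<open>B\<close> and the martingale data\<close>

lemma linear_op_add: "linear_op B T \<Longrightarrow> f \<in> B \<Longrightarrow> g \<in> B \<Longrightarrow> T (\<lambda>x. f x + g x) = (\<lambda>x. T f x + T g x)"
  by (simp add: linear_op_def)

lemma linear_op_scale: "linear_op B T \<Longrightarrow> f \<in> B \<Longrightarrow> T (\<lambda>x. c * f x) = (\<lambda>x. c * T f x)"
  by (simp add: linear_op_def)

lemma linear_op_sum: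
  assumes T: "linear_op B T" and B: "(\<lambda>x. 0) \<in> B" "\<And>f h. f \<in> B \<Longrightarrow> h \<in> B \<Longrightarrow> (\<lambda>x. f x + h x) \<in> B"
    and u: "\<And>k. u k \<in> B"
  shows "(\<lambda>x. \<Sum>k<n. u k x) \<in> B \<and> T (\<lambda>x. \<Sum>k<(n::nat). u k x) = (\<lambda>x. \<Sum>k<n. T (u k) x)"
proof (induction n)
  case 0
  show ?case
    using linear_op_scale[OF T B(1), of 0] B(1) by simp
next
  case (Suc n)
  then have IH: "(\<lambda>x. \<Sum>k<n. u k x) \<in> B" "T (\<lambda>x. \<Sum>k<n. u k x) = (\<lambda>x. \<Sum>k<n. T (u k) x)"
    by auto
  have "T (\<lambda>x. (\<Sum>k<n. u k x) + u n x) = (\<lambda>x. T (\<lambda>x. \<Sum>k<n. u k x) x + T (u n) x)"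
    by (rule linear_op_add[OF T IH(1) u])
  with IH(2) B(2)[OF IH(1) u[of n]] show ?case by simp
qed

context hypothesis_H
begin

definition \<xi>c :: "'a \<Rightarrow> complex" where
  "\<xi>c x = complex_of_real (\<xi> x)"

definition partial :: "nat \<Rightarrow> 'a \<Rightarrow> complex" where
  "partial n x = (\<Sum>k<n. (Qop Q ^^ k) \<xi>c x)"

lemma \<xi>c_B: "\<xi>c \<in> B"
  using \<xi>_B unfolding \<xi>c_def [abs_def] .

lemma Q_pow_\<xi>_B: "(Qop Q ^^ k) \<xi>c \<in> B"
  by (rule linear_op_pow_mem[OF Q_linear \<xi>c_B])

lemma partial_B: "partial n \<in> B"
  and Q_partial: "Qop Q (partial n) = (\<lambda>x. \<Sum>k<n. Qop Q ((Qop Q ^^ k) \<xi>c) x)"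
proof -
  have "(\<lambda>x. \<Sum>k<n. (Qop Q ^^ k) \<xi>c x) \<in> B \<and>
      Qop Q (\<lambda>x. \<Sum>k<n. (Qop Q ^^ k) \<xi>c x) = (\<lambda>x. \<Sum>k<n. Qop Q ((Qop Q ^^ k) \<xi>c) x)"
    by (rule linear_op_sum[OF Q_linear B_zero]) (auto intro: B_add Q_pow_\<xi>_B)
  then show "partial n \<in> B" "Qop Q (partial n) = (\<lambda>x. \<Sum>k<n. Qop Q ((Qop Q ^^ k) \<xi>c) x)"
    unfolding partial_def [abs_def] by auto
qed

lemma partial_Suc: "partial (Suc n) x = \<xi>c x + Qop Q (partial n) x"
  unfolding Q_partial unfolding partial_def by (subst sum.lessThan_Suc_shift) simp

lemma N_minus_commute: "f \<in> B \<Longrightarrow> h \<in> B \<Longrightarrow> N (\<lambda>x. f x - h x) = N (\<lambda>x. h x - f x)"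
  using N_scale[OF B_minus[of f h], of "-1"] by simp

lemma N_triangle: "f \<in> B \<Longrightarrow> g \<in> B \<Longrightarrow> h \<in> B \<Longrightarrow> N (\<lambda>x. f x - h x) \<le> N (\<lambda>x. f x - g x) + N (\<lambda>x. g x - h x)"
  using N_add[OF B_minus[of f g] B_minus[of g h]] by simp

lemma \<xi>c_centered: "(\<integral>x. \<xi>c x \<partial>\<nu>) = 0"
  using \<xi>_centered by (simp add: \<xi>c_def)

text \<open>Because \<open>\<xi>\<close> is centred, its iterates under \<open>Q\<close> decay
  geometrically in \<open>N\<close>.\<close>

lemma partial_Cauchy: "\<forall>e>0. \<exists>K. \<forall>m\<ge>K. \<forall>n\<ge>K. N (\<lambda>x. partial m x - partial n x) < e"
proof (intro allI impI)
  fix e :: real assume e: "0 < e"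
  obtain C C1 C3 \<kappa> \<delta>0 where
    "weak_perturbation B N (\<lambda>f. \<integral>x. norm (f x) \<partial>\<nu>) (\<lambda>f. \<integral>x. f x \<partial>\<nu>) (Qop Q) (Qfourier Q \<xi>) (\<lambda>x. 1) C C1 C3 \<kappa> \<delta>0"
    by (rule weak_perturbation_instance)
  then interpret wp: weak_perturbation B N "\<lambda>f. \<integral>x. norm (f x) \<partial>\<nu>" "\<lambda>f. \<integral>x. f x \<partial>\<nu>" "Qop Q" "Qfourier Q \<xi>" "\<lambda>x. 1" C C1 C3 \<kappa> \<delta>0 .
  define D where "D = C * N \<xi>c / (1 - \<kappa>)"
  have D: "0 \<le> C * N \<xi>c" using wp.const_bounds N_nonneg[OF \<xi>c_B] by simp
  have step: "N (\<lambda>x. partial (n + j) x - partial n x) \<le> D * \<kappa> ^ n" for n j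
  proof -
    have "N (\<lambda>x. partial (n + j) x - partial n x) \<le> (\<Sum>i<j. C * \<kappa> ^ (n + i) * N \<xi>c)"
    proof (induction j)
      case 0
      have "N (\<lambda>x. 0) = 0" using N_eq_0[OF B_zero] by simp
      then show ?case by simp
    next
      case (Suc j)
      have "(\<lambda>x. partial (n + Suc j) x - partial n x) = (\<lambda>x. (partial (n + j) x - partial n x) + (Qop Q ^^ (n + j)) \<xi>c x)"
        by (simp add: partial_def fun_eq_iff)
      then have "N (\<lambda>x. partial (n + Suc j) x - partial n x) \<le> N (\<lambda>x. partial (n + j) x - partial n x) + N ((Qop Q ^^ (n + j)) \<xi>c)"
        using N_add[OF B_minus[OF partial_B[of "n + j"] partial_B[of n]] Q_pow_\<xi>_B[of "n + j"]] by simp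
      also have "\<dots> \<le> (\<Sum>i<j. C * \<kappa> ^ (n + i) * N \<xi>c) + C * \<kappa> ^ (n + j) * N \<xi>c"
        by (intro add_mono Suc wp.P_N \<xi>c_B \<xi>c_centered)
      finally show ?case by simp
    qed
    also have "\<dots> = C * N \<xi>c * \<kappa> ^ n * (\<Sum>i<j. \<kappa> ^ i)"
      by (simp add: sum_distrib_left power_add mult_ac)
    also have "\<dots> \<le> C * N \<xi>c * \<kappa> ^ n * (1 / (1 - \<kappa>))"
      using wp.const_bounds by (intro mult_left_mono geometric_partial_sum_le mult_nonneg_nonneg[OF D]) auto
    finally show ?thesis by (simp add: D_def mult_ac)
  qed
  have "(\<lambda>n. D * \<kappa> ^ n) \<longlonglongrightarrow> D * 0"
    using wp.const_bounds by (intro tendsto_mult tendsto_const LIMSEQ_realpow_zero) auto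
  then have "eventually (\<lambda>n. D * \<kappa> ^ n < e) sequentially"
    using e by (intro order_tendstoD) auto
  then obtain K where K: "\<And>n. K \<le> n \<Longrightarrow> D * \<kappa> ^ n < e"
    by (auto simp: eventually_sequentially)
  have close: "N (\<lambda>x. partial m x - partial n x) < e" if "K \<le> n" "n \<le> m" for m n
    using step[of n "m - n"] K[OF that(1)] that by simp
  show "\<exists>K. \<forall>m\<ge>K. \<forall>n\<ge>K. N (\<lambda>x. partial m x - partial n x) < e"
  proof (intro exI[of _ K] allI impI)
    fix m n assume "K \<le> m" "K \<le> n"
    then show "N (\<lambda>x. partial m x - partial n x) < e"
      using close[of n m] close[of m n] N_minus_commute[OF partial_B[of m] partial_B[of n]] by (cases "n \<le> m") auto
  qed
qed

definition \<zeta>c :: "'a \<Rightarrow> complex" where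
  "\<zeta>c = xi_check Q B N \<xi>"

text \<open>\<open>xi_check\<close> is a definite description, so its properties are accessible only
  after existence (completeness) and uniqueness (definiteness of \<open>N\<close>) of the
  limit.\<close>

lemma \<zeta>c_B: "\<zeta>c \<in> B" and partial_tendsto: "(\<lambda>n. N (\<lambda>x. partial n x - \<zeta>c x)) \<longlonglongrightarrow> 0"
proof -
  let ?P = "\<lambda>h. h \<in> B \<and> (\<lambda>n. N (\<lambda>x. partial n x - h x)) \<longlonglongrightarrow> 0"
  have "\<exists>!h. ?P h"
  proof (rule ex_ex1I)
    show "\<exists>h. ?P h"
      using B_complete[OF partial_B partial_Cauchy] by blast
    fix g h assume g: "?P g" and h: "?P h"
    have "N (\<lambda>x. g x - h x) \<le> 0"
    proof (rule LIMSEQ_le_const)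
      show "(\<lambda>n. N (\<lambda>x. partial n x - g x) + N (\<lambda>x. partial n x - h x)) \<longlonglongrightarrow> 0"
        using tendsto_add[OF conjunct2[OF g] conjunct2[OF h]] by simp
      show "\<exists>K. \<forall>n\<ge>K. N (\<lambda>x. g x - h x) \<le> N (\<lambda>x. partial n x - g x) + N (\<lambda>x. partial n x - h x)"
        using N_triangle[of g "partial n" h for n] N_minus_commute[of g "partial n" for n] g h partial_B by auto
    qed
    then have "(\<lambda>x. g x - h x) = (\<lambda>x. 0)"
      using N_eq_0[OF B_minus[of g h]] N_nonneg[OF B_minus[of g h]] g h by auto
    then show "g = h" by (auto simp: fun_eq_iff)
  qed
  from theI'[OF this] have "?P \<zeta>c"
    unfolding \<zeta>c_def xi_check_def partial_def \<xi>c_def [abs_def] .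
  then show "\<zeta>c \<in> B" "(\<lambda>n. N (\<lambda>x. partial n x - \<zeta>c x)) \<longlonglongrightarrow> 0" by auto
qed

lemma Q\<zeta>c_B: "Qop Q \<zeta>c \<in> B"
  by (rule linear_op_mem[OF Q_linear \<zeta>c_B])

text \<open>The recursion for the partial sums passes to the limit by boundedness of
  \<open>Q\<close> on \<open>B\<close>. The equation holds at every point, since \<open>N\<close>
  vanishes only at the zero function.\<close>

lemma poisson_equation: "\<zeta>c x = \<xi>c x + Qop Q \<zeta>c x"
proof -
  obtain A where A: "\<And>f. f \<in> B \<Longrightarrow> N (Qop Q f) \<le> A * N f"
    using Q_bounded unfolding bounded_op_def by blast
  let ?r = "\<lambda>x. \<zeta>c x - (\<xi>c x + Qop Q \<zeta>c x)"
  have rB: "?r \<in> B" by (intro B_minus B_add \<zeta>c_B \<xi>c_B Q\<zeta>c_B)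
  have "N ?r \<le> N (\<lambda>x. partial (Suc n) x - \<zeta>c x) + A * N (\<lambda>x. partial n x - \<zeta>c x)" for n
  proof -
    have "(\<lambda>x. Qop Q (partial n) x - Qop Q \<zeta>c x) = Qop Q (\<lambda>x. partial n x - \<zeta>c x)"
    proof -
      have "Qop Q (\<lambda>x. partial n x + (-1) * \<zeta>c x) = (\<lambda>x. Qop Q (partial n) x + Qop Q (\<lambda>x. (-1) * \<zeta>c x) x)"
        by (rule linear_op_add[OF Q_linear partial_B B_scale[OF \<zeta>c_B]])
      also have "Qop Q (\<lambda>x. (-1) * \<zeta>c x) = (\<lambda>x. (-1) * Qop Q \<zeta>c x)"
        by (rule linear_op_scale[OF Q_linear \<zeta>c_B])
      finally show ?thesis by simp
    qed
    then have Nq: "N (\<lambda>x. Qop Q (partial n) x - Qop Q \<zeta>c x) \<le> A * N (\<lambda>x. partial n x - \<zeta>c x)"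
      using A[OF B_minus[OF partial_B \<zeta>c_B]] by simp
    have eq: "?r = (\<lambda>x. (Qop Q (partial n) x - Qop Q \<zeta>c x) - (partial (Suc n) x - \<zeta>c x))"
      by (simp add: partial_Suc fun_eq_iff)
    have "N ?r \<le> N (\<lambda>x. Qop Q (partial n) x - Qop Q \<zeta>c x) + N (\<lambda>x. partial (Suc n) x - \<zeta>c x)"
      unfolding eq by (intro N_minus B_minus Q\<zeta>c_B \<zeta>c_B partial_B linear_op_mem[OF Q_linear])
    with Nq show ?thesis by simp
  qed
  moreover have "(\<lambda>n. N (\<lambda>x. partial (Suc n) x - \<zeta>c x) + A * N (\<lambda>x. partial n x - \<zeta>c x)) \<longlonglongrightarrow> 0 + A * 0"
    by (intro tendsto_add tendsto_mult tendsto_const partial_tendsto LIMSEQ_Suc[OF partial_tendsto])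
  ultimately have "N ?r \<le> 0"
    by (intro LIMSEQ_le_const[of _ 0]) auto
  then have "?r = (\<lambda>x. 0)"
    using N_eq_0[OF rB] N_nonneg[OF rB] by auto
  then have "?r x = 0" by (rule fun_cong)
  then show ?thesis by simp
qed

text \<open>Realness is propagated only almost everywhere: an exceptional \<open>\<nu>\<close>-null
  set is, by invariance, null for \<open>Q x\<close> for almost every \<open>x\<close>.\<close>

lemma AE_real_Q:
  assumes f: "f \<in> B" and real: "AE x in \<nu>. Im (f x) = 0"
  shows "AE x in \<nu>. Im (Qop Q f x) = 0"
    and "AE x in \<nu>. Qop Q f x = complex_of_real (\<integral>y. Re (f y) \<partial>Q x)"
    and "AE x in \<nu>. Qop Q (\<lambda>y. (f y)\<^sup>2) x = complex_of_real (\<integral>y. (Re (f y))\<^sup>2 \<partial>Q x)"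
proof -
  note [measurable] = B_meas[OF f]
  have AE2: "AE x in \<nu>. AE y in Q x. Im (f y) = 0"
    using real by (intro AE_Q) measurable
  show 1: "AE x in \<nu>. Qop Q f x = complex_of_real (\<integral>y. Re (f y) \<partial>Q x)"
    using AE2 AE_space
  proof eventually_elim
    case (elim x)
    then have x: "x \<in> space E" by (simp add: space_\<nu>)
    have [measurable]: "f \<in> borel_measurable (Q x)"
      by (subst measurable_cong_sets[OF Q_sets[OF x] refl]) measurable
    have "Qop Q f x = (\<integral>y. complex_of_real (Re (f y)) \<partial>Q x)"
      unfolding Qop_def using elim(1) by (intro integral_cong_AE) (auto simp: complex_eq_iff)
    then show ?case by simp
  qed
  then show "AE x in \<nu>. Im (Qop Q f x) = 0"
    by eventually_elim simp
  show "AE x in \<nu>. Qop Q (\<lambda>y. (f y)\<^sup>2) x = complex_of_real (\<integral>y. (Re (f y))\<^sup>2 \<partial>Q x)"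
    using AE2 AE_space
  proof eventually_elim
    case (elim x)
    then have x: "x \<in> space E" by (simp add: space_\<nu>)
    have [measurable]: "f \<in> borel_measurable (Q x)"
      by (subst measurable_cong_sets[OF Q_sets[OF x] refl]) measurable
    have "AE y in Q x. (f y)\<^sup>2 = complex_of_real ((Re (f y))\<^sup>2)"
      using elim(1) by eventually_elim (simp add: complex_eq_iff power2_eq_square)
    then have "Qop Q (\<lambda>y. (f y)\<^sup>2) x = (\<integral>y. complex_of_real ((Re (f y))\<^sup>2) \<partial>Q x)"
      unfolding Qop_def by (intro integral_cong_AE) measurable
    then show ?case by (simp only: integral_complex_of_real)
  qed
qed

text \<open>Convergence in \<open>N\<close> controls the limit through the embedding in
  \<open>L^1\<close>, not pointwise, so that the imaginary part is shown to have vanishing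
  integral.\<close>

lemma \<zeta>c_real: "AE x in \<nu>. Im (\<zeta>c x) = 0"
proof -
  have "AE x in \<nu>. Im ((Qop Q ^^ k) \<xi>c x) = 0" for k
  proof (induction k)
    case (Suc k)
    from AE_real_Q(1)[OF Q_pow_\<xi>_B Suc] show ?case by simp
  qed (simp add: \<xi>c_def)
  then have "AE x in \<nu>. \<forall>k. Im ((Qop Q ^^ k) \<xi>c x) = 0"
    by (simp add: AE_all_countable)
  then have part: "AE x in \<nu>. \<forall>n. Im (partial n x) = 0"
    by eventually_elim (simp add: partial_def)
  obtain C where C: "\<And>f. f \<in> B \<Longrightarrow> (\<integral>x. norm (f x) \<partial>\<nu>) \<le> C * N f"
    using L1_le by blast
  note [measurable] = B_meas[OF \<zeta>c_B]
  have int: "integrable \<nu> (\<lambda>x. \<bar>Im (\<zeta>c x)\<bar>)"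
    using B_integrable[OF \<zeta>c_B] by (intro integrable_abs integrable_Im)
  have "(\<integral>x. \<bar>Im (\<zeta>c x)\<bar> \<partial>\<nu>) \<le> C * N (\<lambda>x. partial n x - \<zeta>c x)" for n
  proof -
    have "AE x in \<nu>. \<bar>Im (\<zeta>c x)\<bar> \<le> norm (partial n x - \<zeta>c x)"
      using part
    proof eventually_elim
      case (elim x)
      then have "\<bar>Im (\<zeta>c x)\<bar> = \<bar>Im (partial n x - \<zeta>c x)\<bar>" by simp
      then show ?case using abs_Im_le_cmod[of "partial n x - \<zeta>c x"] by simp
    qed
    then have "(\<integral>x. \<bar>Im (\<zeta>c x)\<bar> \<partial>\<nu>) \<le> (\<integral>x. norm (partial n x - \<zeta>c x) \<partial>\<nu>)"
      using int B_integrable[OF B_minus[OF partial_B \<zeta>c_B]] by (intro integral_mono_AE integrable_norm) auto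
    also have "\<dots> \<le> C * N (\<lambda>x. partial n x - \<zeta>c x)"
      by (intro C B_minus partial_B \<zeta>c_B)
    finally show ?thesis .
  qed
  moreover have "(\<lambda>n. C * N (\<lambda>x. partial n x - \<zeta>c x)) \<longlonglongrightarrow> C * 0"
    by (intro tendsto_mult tendsto_const partial_tendsto)
  ultimately have "(\<integral>x. \<bar>Im (\<zeta>c x)\<bar> \<partial>\<nu>) \<le> 0"
    by (intro LIMSEQ_le_const[of _ 0]) auto
  then have "(\<integral>x. \<bar>Im (\<zeta>c x)\<bar> \<partial>\<nu>) = 0"
    by (intro antisym Bochner_Integration.integral_nonneg) auto
  then have "AE x in \<nu>. \<bar>Im (\<zeta>c x)\<bar> = 0"
    using int by (subst (asm) integral_nonneg_eq_0_iff_AE) auto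
  then show ?thesis by simp
qed

definition \<psi> :: "'a \<Rightarrow> complex" where
  "\<psi> = psi_fun Q \<nu> B N \<xi>"

lemma \<psi>_eq: "\<psi> x = Qop Q (\<lambda>y. (\<zeta>c y)\<^sup>2) x - (Qop Q \<zeta>c x)\<^sup>2 - complex_of_real (\<sigma>\<^sup>2)"
  by (simp add: \<psi>_def psi_fun_def \<zeta>c_def \<sigma>)

lemma Qop_measurable [measurable]: "f \<in> borel_measurable E \<Longrightarrow> Qop Q f \<in> borel_measurable E"
  unfolding Qop_def by (rule Q_integral_measurable)

lemma square_powr:
  assumes "f \<in> B" shows "integrable \<nu> (\<lambda>x. norm ((f x)\<^sup>2) powr (3/2))"
  using cube[OF assms] by (simp add: norm_power square_powr_three_halves)

lemma \<psi>_measurable [measurable]: "\<psi> \<in> borel_measurable E"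
proof -
  note [measurable] = B_meas[OF \<zeta>c_B]
  show ?thesis unfolding \<psi>_eq [abs_def] by measurable
qed

lemma Qpow_\<psi>_measurable [measurable]: "(Qop Q ^^ p) \<psi> \<in> borel_measurable E"
  by (induction p) auto

text \<open>Squares of elements of \<open>B\<close> lie in \<open>L^(3/2)\<close> because
  \<open>B\<close> is contained in \<open>L^3\<close>; Jensen's inequality then carries the property
  along the iterates of \<open>Q\<close>.\<close>

lemma \<psi>_powr: "integrable \<nu> (\<lambda>x. norm ((Qop Q ^^ p) \<psi> x) powr (3/2))"
proof (induction p)
  case 0
  note [measurable] = B_meas[OF \<zeta>c_B]
  let ?a = "\<lambda>x. norm (Qop Q (\<lambda>y. (\<zeta>c y)\<^sup>2) x)" and ?b = "\<lambda>x. norm ((Qop Q \<zeta>c x)\<^sup>2)"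
  have a: "integrable \<nu> (\<lambda>x. ?a x powr (3/2))"
    unfolding Qop_def by (rule integrable_Q_powr_three_halves[OF _ square_powr[OF \<zeta>c_B]]) measurable
  have b: "integrable \<nu> (\<lambda>x. ?b x powr (3/2))"
    by (rule square_powr[OF Q\<zeta>c_B])
  have le: "norm (\<psi> x) powr (3/2) \<le> 2 powr (3/2) * (?a x powr (3/2) + 2 powr (3/2) * (?b x powr (3/2) + (\<sigma>\<^sup>2) powr (3/2)))" for x
  proof -
    have "norm (\<psi> x) \<le> ?a x + (?b x + \<sigma>\<^sup>2)"
      unfolding \<psi>_eq
      using norm_triangle_ineq4[of "Qop Q (\<lambda>y. (\<zeta>c y)\<^sup>2) x - (Qop Q \<zeta>c x)\<^sup>2" "complex_of_real (\<sigma>\<^sup>2)"]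
        norm_triangle_ineq4[of "Qop Q (\<lambda>y. (\<zeta>c y)\<^sup>2) x" "(Qop Q \<zeta>c x)\<^sup>2"] by (simp add: norm_power)
    then have "norm (\<psi> x) powr (3/2) \<le> (?a x + (?b x + \<sigma>\<^sup>2)) powr (3/2)"
      by (intro powr_mono2) auto
    also have "\<dots> \<le> 2 powr (3/2) * (?a x powr (3/2) + (?b x + \<sigma>\<^sup>2) powr (3/2))"
      by (intro powr_add_three_halves_le) auto
    also have "\<dots> \<le> 2 powr (3/2) * (?a x powr (3/2) + 2 powr (3/2) * (?b x powr (3/2) + (\<sigma>\<^sup>2) powr (3/2)))"
      by (intro mult_left_mono add_left_mono powr_add_three_halves_le) auto
    finally show ?thesis .
  qed
  have "integrable \<nu> (\<lambda>x. norm (\<psi> x) powr (3/2))"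
  proof (rule Bochner_Integration.integrable_bound)
    show "integrable \<nu> (\<lambda>x. 2 powr (3/2) * (?a x powr (3/2) + 2 powr (3/2) * (?b x powr (3/2) + (\<sigma>\<^sup>2) powr (3/2))))"
      using a b by (intro integrable_mult_right Bochner_Integration.integrable_add \<nu>.integrable_const)
    show "AE x in \<nu>. norm (norm (\<psi> x) powr (3/2)) \<le> norm (2 powr (3/2) * (?a x powr (3/2) + 2 powr (3/2) * (?b x powr (3/2) + (\<sigma>\<^sup>2) powr (3/2))))"
    proof (intro AE_I2)
      fix x
      show "norm (norm (\<psi> x) powr (3/2)) \<le> norm (2 powr (3/2) * (?a x powr (3/2) + 2 powr (3/2) * (?b x powr (3/2) + (\<sigma>\<^sup>2) powr (3/2))))"
        using order_trans[OF le[of x] abs_ge_self] unfolding real_norm_def abs_of_nonneg[OF powr_ge_zero] .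
    qed
  qed measurable
  then show ?case by simp
next
  case (Suc p)
  from integrable_Q_powr_three_halves[OF Qpow_\<psi>_measurable Suc] show ?case
    by (simp add: Qop_def)
qed

text \<open>The \<open>L^(3/2)\<close> norms summed in (H2), made strictly positive by a summable
  term.\<close>

definition \<beta> :: "nat \<Rightarrow> real" where
  "\<beta> p = (\<integral>x. norm ((Qop Q ^^ p) \<psi> x) powr (3/2) \<partial>\<nu>) powr (2/3) + (1/2) ^ p"

lemma martingale_instance:
  "martingale_approximation E Q \<nu> M X \<xi> (\<lambda>x. Re (\<zeta>c x)) (\<lambda>x. Re (Qop Q \<zeta>c x)) (\<sigma>\<^sup>2) (\<lambda>p. (Qop Q ^^ p) \<psi>) \<beta>"
proof
  note [measurable] = B_meas[OF \<zeta>c_B]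
  note real = AE_real_Q[OF \<zeta>c_B \<zeta>c_real]
  fix p :: nat and x :: 'a
  show "(\<lambda>x. Re (\<zeta>c x)) \<in> borel_measurable E" "(\<lambda>x. Re (Qop Q \<zeta>c x)) \<in> borel_measurable E"
    "\<xi> \<in> borel_measurable E" "(Qop Q ^^ p) \<psi> \<in> borel_measurable E"
    by measurable
  show "AE x in \<nu>. Re (Qop Q \<zeta>c x) = (\<integral>y. Re (\<zeta>c y) \<partial>Q x)"
    using real(2) by eventually_elim simp
  show "AE x in \<nu>. \<xi> x = Re (\<zeta>c x) - Re (Qop Q \<zeta>c x)"
    using poisson_equation by (intro AE_I2) (simp add: \<xi>c_def)
  have Re_cube: "integrable \<nu> (\<lambda>x. \<bar>Re (f x)\<bar> ^ 3)" if f: "f \<in> B" for f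
  proof (rule Bochner_Integration.integrable_bound[OF cube[OF f]])
    note [measurable] = B_meas[OF f]
    show "(\<lambda>x. \<bar>Re (f x)\<bar> ^ 3) \<in> borel_measurable \<nu>" by measurable
    show "AE x in \<nu>. norm (\<bar>Re (f x)\<bar> ^ 3) \<le> norm (norm (f x) ^ 3)"
      by (intro AE_I2) (simp add: power_mono abs_Re_le_cmod)
  qed
  show "integrable \<nu> (\<lambda>x. \<bar>Re (\<zeta>c x)\<bar> ^ 3)" "integrable \<nu> (\<lambda>x. \<bar>Re (Qop Q \<zeta>c x)\<bar> ^ 3)"
    by (intro Re_cube \<zeta>c_B Q\<zeta>c_B)+
  show "AE x in \<nu>. (Qop Q ^^ 0) \<psi> x = complex_of_real ((\<integral>y. (Re (\<zeta>c y))\<^sup>2 \<partial>Q x) - (Re (Qop Q \<zeta>c x))\<^sup>2 - \<sigma>\<^sup>2)"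
    using real(1,3)
  proof eventually_elim
    case (elim x)
    have "Qop Q \<zeta>c x = complex_of_real (Re (Qop Q \<zeta>c x))"
      using elim(1) by (simp add: complex_eq_iff)
    then have "(Qop Q \<zeta>c x)\<^sup>2 = complex_of_real ((Re (Qop Q \<zeta>c x))\<^sup>2)"
      by (metis of_real_power)
    then show ?case using elim(2) by (simp add: \<psi>_eq)
  qed
  show "(Qop Q ^^ Suc p) \<psi> x = (\<integral>y. (Qop Q ^^ p) \<psi> y \<partial>Q x)"
    by (simp add: Qop_def)
  show "integrable \<nu> (\<lambda>x. norm ((Qop Q ^^ p) \<psi> x) powr (3/2))"
    by (rule \<psi>_powr)
  let ?I = "\<lambda>p. \<integral>x. norm ((Qop Q ^^ p) \<psi> x) powr (3/2) \<partial>\<nu>"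
  have I: "0 \<le> ?I p" for p by (rule Bochner_Integration.integral_nonneg) simp
  show "?I p \<le> \<beta> p powr (3/2)"
  proof -
    have "?I p = (?I p powr (2/3)) powr (3/2)"
      using I[of p] unfolding powr_powr by (simp add: powr_one)
    also have "\<dots> \<le> \<beta> p powr (3/2)"
      unfolding \<beta>_def by (intro powr_mono2) auto
    finally show ?thesis .
  qed
  show "0 < \<beta> p"
    unfolding \<beta>_def by (rule add_nonneg_pos) auto
  show "summable \<beta>"
    unfolding \<beta>_def using H2 by (intro summable_add summable_geometric) (auto simp: \<psi>_def)
  \<comment> \<open>By invariance the mean of \<open>Q\<close> applied to the square of
    \<open>\<zeta>c\<close> is that of the square itself, so the definition of \<open>sigma2\<close>
    is exactly what centres \<open>\<psi>\<close>.\<close>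
  show "(\<integral>x. (Qop Q ^^ 0) \<psi> x \<partial>\<nu>) = 0"
  proof -
    have i1: "integrable \<nu> (\<lambda>x. (\<zeta>c x)\<^sup>2)"
      by (rule integrable_of_powr_three_halves[OF _ square_powr[OF \<zeta>c_B]]) measurable
    have i2: "integrable \<nu> (\<lambda>x. (Qop Q \<zeta>c x)\<^sup>2)"
      by (rule integrable_of_powr_three_halves[OF _ square_powr[OF Q\<zeta>c_B]]) measurable
    have i3: "integrable \<nu> (Qop Q (\<lambda>y. (\<zeta>c y)\<^sup>2))" and e3: "(\<integral>x. Qop Q (\<lambda>y. (\<zeta>c y)\<^sup>2) x \<partial>\<nu>) = (\<integral>x. (\<zeta>c x)\<^sup>2 \<partial>\<nu>)"
      using integrable_Q_integral[OF i1] integral_Q_integral[OF i1] by (simp_all add: Qop_def)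
    have "(\<integral>x. \<psi> x \<partial>\<nu>) = (\<integral>x. (\<zeta>c x)\<^sup>2 \<partial>\<nu>) - (\<integral>x. (Qop Q \<zeta>c x)\<^sup>2 \<partial>\<nu>) - complex_of_real (\<sigma>\<^sup>2)"
      unfolding \<psi>_eq using i2 i3 e3 \<nu>.prob_space by simp
    also have "\<dots> = 0"
      using \<sigma> unfolding sigma2_def \<zeta>c_def by simp
    finally show ?thesis by simp
  qed
qed simp

theorem berry_esseen_bound:
  assumes \<sigma>_pos: "0 < \<sigma>"
  obtains A where "\<And>n x. 0 < n \<Longrightarrow>
    \<bar>measure M {\<omega>\<in>space M. (\<Sum>k=1..n. \<xi> (X k \<omega>)) / (\<sigma> * sqrt (real n)) \<le> x} - cdf std_normal_distribution x\<bar> \<le> A / sqrt (real n)"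
proof -
  let ?\<phi> = "\<lambda>t n. \<integral>\<omega>. iexp (t * (\<Sum>k=1..n. \<xi> (X k \<omega>))) \<partial>M"
  interpret ma: martingale_approximation E Q \<nu> M X \<xi> "\<lambda>x. Re (\<zeta>c x)" "\<lambda>x. Re (Qop Q \<zeta>c x)" "\<sigma>\<^sup>2" "\<lambda>p. (Qop Q ^^ p) \<psi>" \<beta>
    by (rule martingale_instance)
  obtain C C1 C3 \<kappa> \<delta>0 where
    "weak_perturbation B N (\<lambda>f. \<integral>x. norm (f x) \<partial>\<nu>) (\<lambda>f. \<integral>x. f x \<partial>\<nu>) (Qop Q) (Qfourier Q \<xi>) (\<lambda>x. 1) C C1 C3 \<kappa> \<delta>0"
    by (rule weak_perturbation_instance)
  then interpret wp: weak_perturbation B N "\<lambda>f. \<integral>x. norm (f x) \<partial>\<nu>" "\<lambda>f. \<integral>x. f x \<partial>\<nu>" "Qop Q" "Qfourier Q \<xi>" "\<lambda>x. 1" C C1 C3 \<kappa> \<delta>0 .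
  obtain K \<delta> where K: "0 \<le> K" and \<delta>: "0 < \<delta>" "\<delta> \<le> \<delta>0"
    and quasi: "\<And>t. \<bar>t\<bar> < \<delta> \<Longrightarrow> \<exists>l. l \<noteq> 0 \<and> (\<forall>n. norm (wp.\<phi> t n - l ^ n) \<le> K * \<bar>t\<bar> * norm l ^ n)"
    by (rule wp.quasi_multiplicative) blast
  \<comment> \<open>The operator formula is available only for \<open>t\<close> small enough that
    the Fourier kernel acts on \<open>B\<close>.\<close>
  have \<phi>: "wp.\<phi> t n = ?\<phi> t n" if "\<bar>t\<bar> < \<delta>" for t n
    using char_eq_operator[OF wp.T one_B, of t n] that \<delta> by (simp add: wp.\<phi>_def)
  \<comment> \<open>Nonnegativity is read off from the estimate itself at \<open>t = 1\<close> and
    \<open>n = 0\<close>, where the left side vanishes.\<close>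
  have KM: "0 \<le> ma.KM"
    using ma.char_near_gaussian[of 1 0] M.prob_space by simp
  obtain C' \<delta>' where C': "0 \<le> C'" "0 < \<delta>'"
    and est: "\<And>t n. \<bar>t\<bar> < \<delta>' \<Longrightarrow> norm (?\<phi> t n - exp (- \<sigma>\<^sup>2 * t\<^sup>2 / 2) ^ n) \<le> C' * (\<bar>t\<bar> + real n * \<bar>t\<bar> ^ 3) * exp (- \<sigma>\<^sup>2 * t\<^sup>2 / 4) ^ n"
  proof (rule char_gaussian_estimate[of "\<sigma>\<^sup>2" K ma.KM \<delta> ?\<phi>])
    show "norm (?\<phi> t n) \<le> 1" for t n
      using integral_norm_bound[of M "\<lambda>\<omega>. iexp (t * (\<Sum>k=1..n. \<xi> (X k \<omega>)))"] M.prob_space by simp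
    show "\<exists>l. l \<noteq> 0 \<and> (\<forall>n. norm (?\<phi> t n - l ^ n) \<le> K * \<bar>t\<bar> * norm l ^ n)" if "\<bar>t\<bar> < \<delta>" for t
      using quasi[OF that] \<phi>[OF that] by simp
  qed (use \<sigma>_pos K KM \<delta> ma.char_near_gaussian in auto)
  have S: "(\<lambda>\<omega>. \<Sum>k=1..n. \<xi> (X k \<omega>)) \<in> borel_measurable M" for n
    by measurable
  show thesis
    by (rule berry_esseen_from_char[OF M.prob_space_axioms S \<sigma>_pos C' est that])
qed

end

theorem theorem2p1:
  fixes E :: "'a measure" and Q :: "'a \<Rightarrow> 'a measure" and \<nu> :: "'a measure"
    and M :: "'w measure" and X :: "nat \<Rightarrow> 'w \<Rightarrow> 'a" and \<xi> :: "'a \<Rightarrow> real"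
    and \<sigma> :: real
  assumes Q_kernel: "Q \<in> measurable E (prob_algebra E)"
    and \<nu>_prob: "prob_space \<nu>" and \<nu>_sets: "sets \<nu> = sets E"
    and \<nu>_inv: "bind \<nu> Q = \<nu>"
    and chain: "markov_chain M E Q \<nu> X"
    and \<xi>_meas: "\<xi> \<in> borel_measurable E" and \<xi>_int: "integrable \<nu> \<xi>"
    and \<xi>_centered: "(\<integral>x. \<xi> x \<partial>\<nu>) = 0"
    and H: "\<exists>B N. hyp_H E Q \<nu> \<xi> B N \<and> sigma2 Q \<nu> B N \<xi> = complex_of_real (\<sigma>\<^sup>2)"
    and \<sigma>_pos: "\<sigma> > 0"
  shows "weak_conv_m (\<lambda>n. distr M borel (\<lambda>\<omega>. (\<Sum>k=1..n. \<xi> (X k \<omega>)) / sqrt (real n)))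
                     (density lborel (normal_density 0 \<sigma>)) \<and>
     (\<forall>\<tau><1. \<exists>C. \<forall>\<^sub>F n in sequentially. \<forall>x::real.
           \<bar>measure M {\<omega>\<in>space M. (\<Sum>k=1..n. \<xi> (X k \<omega>)) / (\<sigma> * sqrt (real n)) \<le> x}
            - measure (density lborel std_normal_density) {..x}\<bar> \<le> C * real n powr (- \<tau> / 2))"
proof -
  obtain B N where BN: "hyp_H E Q \<nu> \<xi> B N" "sigma2 Q \<nu> B N \<xi> = complex_of_real (\<sigma>\<^sup>2)"
    using H by blast
  interpret hypothesis_H E Q \<nu> M X \<xi> B N \<sigma>
    by (intro hypothesis_H.intro stationary_chain.intro hypothesis_H_axioms.intro
        Q_kernel \<nu>_prob \<nu>_sets \<nu>_inv chain \<xi>_meas \<xi>_centered BN)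
  let ?S = "\<lambda>n \<omega>. \<Sum>k=1..n. \<xi> (X k \<omega>)"
  obtain A where A: "\<And>n x. 0 < n \<Longrightarrow>
    \<bar>measure M {\<omega>\<in>space M. ?S n \<omega> / (\<sigma> * sqrt (real n)) \<le> x} - cdf std_normal_distribution x\<bar> \<le> A / sqrt (real n)"
    using berry_esseen_bound[OF \<sigma>_pos] by blast
  have A0: "0 \<le> A" using order_trans[OF abs_ge_zero A[of 1 0]] by simp
  show ?thesis
  proof (intro conjI allI impI)
    show "weak_conv_m (\<lambda>n. distr M borel (\<lambda>\<omega>. ?S n \<omega> / sqrt (real n))) (density lborel (normal_density 0 \<sigma>))"
      unfolding weak_conv_m_def weak_conv_def
    proof (intro allI impI)
      \<comment> \<open>The uniform bound, evaluated at \<open>x / \<sigma>\<close>, gives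
        convergence of the distribution functions at every point.\<close>
      fix x :: real
      have cdf: "cdf (distr M borel (\<lambda>\<omega>. ?S n \<omega> / sqrt (real n))) x = measure M {\<omega>\<in>space M. ?S n \<omega> / (\<sigma> * sqrt (real n)) \<le> x / \<sigma>}" for n
      proof -
        have "cdf (distr M borel (\<lambda>\<omega>. ?S n \<omega> / sqrt (real n))) x = measure M ((\<lambda>\<omega>. ?S n \<omega> / sqrt (real n)) -` {..x} \<inter> space M)"
          unfolding cdf_def by (intro measure_distr) measurable
        also have "(\<lambda>\<omega>. ?S n \<omega> / sqrt (real n)) -` {..x} \<inter> space M = {\<omega>\<in>space M. ?S n \<omega> / (\<sigma> * sqrt (real n)) \<le> x / \<sigma>}"
        proof -
          have "?S n \<omega> / (\<sigma> * sqrt (real n)) \<le> x / \<sigma> \<longleftrightarrow> ?S n \<omega> / sqrt (real n) \<le> x" for \<omega>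
            using \<sigma>_pos by (simp add: divide_le_cancel mult.commute[of \<sigma>] flip: divide_divide_eq_left)
          then show ?thesis by auto
        qed
        finally show ?thesis .
      qed
      define F where "F n = cdf (distr M borel (\<lambda>\<omega>. ?S n \<omega> / sqrt (real n))) x" for n
      define G where "G = cdf (density lborel (normal_density 0 \<sigma>)) x"
      have "(\<lambda>n. A / sqrt (real n)) \<longlonglongrightarrow> 0"
        by (intro tendsto_divide_0[OF tendsto_const] filterlim_at_top_imp_at_infinity
            filterlim_compose[OF sqrt_at_top filterlim_real_sequentially])
      moreover have "\<forall>\<^sub>F n in sequentially. norm (F n - G) \<le> A / sqrt (real n)"
        using eventually_gt_at_top[of 0]
        by eventually_elim (simp only: F_def G_def cdf normal_distribution_cdf[OF \<sigma>_pos] real_norm_def A)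
      ultimately have "(\<lambda>n. F n - G) \<longlonglongrightarrow> 0"
        by (rule Lim_null_comparison[rotated])
      then have "F \<longlonglongrightarrow> G"
        by (rule LIM_zero_cancel[of F G])
      then show "(\<lambda>n. cdf (distr M borel (\<lambda>\<omega>. ?S n \<omega> / sqrt (real n))) x) \<longlonglongrightarrow> cdf (density lborel (normal_density 0 \<sigma>)) x"
        unfolding F_def G_def .
    qed
  next
    fix \<tau> :: real assume \<tau>: "\<tau> < 1"
    show "\<exists>C. \<forall>\<^sub>F n in sequentially. \<forall>x::real.
           \<bar>measure M {\<omega>\<in>space M. ?S n \<omega> / (\<sigma> * sqrt (real n)) \<le> x}
            - measure (density lborel std_normal_density) {..x}\<bar> \<le> C * real n powr (- \<tau> / 2)"
    proof (rule exI[of _ A], rule eventually_mono[OF eventually_gt_at_top[of 0]], rule allI)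
      fix n :: nat and x :: real assume n: "0 < n"
      have le: "\<bar>measure M {\<omega>\<in>space M. ?S n \<omega> / (\<sigma> * sqrt (real n)) \<le> x}
            - measure (density lborel std_normal_density) {..x}\<bar> \<le> A / sqrt (real n)"
        using A[OF n, of x] unfolding cdf_def .
      \<comment> \<open>For \<open>n \<ge> 1\<close> the rate with exponent \<open>1/2\<close>
        dominates the one with \<open>\<tau> / 2\<close>, so the same constant serves every
        \<open>\<tau> < 1\<close>.\<close>
      have "A / sqrt (real n) = A * real n powr (- (1 / 2))"
        unfolding powr_minus powr_half_sqrt[OF of_nat_0_le_iff] by (rule divide_inverse)
      also have "\<dots> \<le> A * real n powr (- \<tau> / 2)"
        using n \<tau> A0 by (intro mult_left_mono powr_mono) auto
      finally show "\<bar>measure M {\<omega>\<in>space M. ?S n \<omega> / (\<sigma> * sqrt (real n)) \<le> x}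
            - measure (density lborel std_normal_density) {..x}\<bar> \<le> A * real n powr (- \<tau> / 2)"
        by (rule order_trans[OF le])
    qed
  qed
qed

end
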